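(* Let $f,g\in C^1(\mathbb{R}^n)$ be real-valued functions such that, for almost all $\xi'=(\xi_2,\ldots,\xi_n)\in\mathbb{R}^{n-1}$, $f(\xi_1,\xi')$ and $g(\xi_1,\xi')$ are strictly monotone in $\xi_1$ on the support of a measurable function $\chi$ on $\mathbb{R}^n$. Let $\sigma,\tau\in C^0(\mathbb{R}^n)$ be such that, for some $A>0$, we have $$\frac{|\sigma(\xi)|}{|\partial_{\xi_1}f(\xi)|^{1/2}}\leq A\,\frac{|\tau(\xi)|}{|\partial_{\xi_1}g(\xi)|^{1/2}}\qquad (\mathrm{I})$$ for all $\xi\in\operatorname{supp}\chi$ satisfying $\partial_{\xi_1}f(\xi)\neq0$ and $\partial_{\xi_1}g(\xi)\neq0$. Then we have $$\left\|\chi(D_x)\sigma(D_x)e^{itf(D_x)}\varphi(x_1,x')\right\|_{L^2(\mathbb{R}_t\times\mathbb{R}^{n-1}_{x'})}\leq A\left\|\chi(D_x)\tau(D_x)e^{itg(D_x)}\varphi(\widetilde x_1,x')\right\|_{L^2(\mathbb{R}_t\times\mathbb{R}^{n-1}_{x'})}\qquad(\mathrm{II})$$ for all $x_1,\widetilde x_1\in\mathbb{R}$, where $x'=(x_2,\ldots,x_n)\in\mathbb{R}^{n-1}$. Consequently, for any measurable function $w$ on $\mathbb{R}$ we have $$\left\|w(x_1)\chi(D_x)\sigma(D_x)e^{itf(D_x)}\varphi(x)\right\|_{L^2(\mathbb{R}_t\times\mathbb{R}^n_x)}\leq A\left\|w(x_1)\chi(D_x)\tau(D_x)e^{itg(D_x)}\varphi(x)\right\|_{L^2(\mathbb{R}_t\times\mathbb{R}^n_x)}.\qquad(\mathrm{III})$$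 Moreover, if $\chi\in C^0(\mathbb{R}^n)$ and $w\neq0$ on a set of $\mathbb{R}$ with positive measure, the converse is true, namely, if we have estimate (II) for all $\varphi$, for some $x_1,\widetilde x_1\in\mathbb{R}$, or if we have estimate (III) for all $\varphi$, and the norms are finite, then we also have inequality (I) (for all $\xi\in\operatorname{supp}\chi$ satisfying $\partial_{\xi_1}f(\xi)\neq0$ and $\partial_{\xi_1}g(\xi)\neq0$).
   Context: Notation: $x=(x_1,\ldots,x_n)$, $\xi=(\xi_1,\ldots,\xi_n)$, $D_x=(D_1,\ldots,D_n)$ with $D_j=\frac1i\frac{\partial}{\partial x_j}$. For a function $a$ on $\mathbb{R}^n$, $a(D_x)$ denotes the Fourier multiplier with symbol $a(\xi)$, i.e. $a(D_x)\varphi(x)=(2\pi)^{-n}\int_{\mathbb{R}^n}e^{ix\cdot\xi}a(\xi)\widehat\varphi(\xi)\,d\xi$ with $\widehat\varphi(\xi)=\int_{\mathbb{R}^n}e^{-ix\cdot\xi}\varphi(x)\,dx$. Thus $e^{itf(D_x)}\varphi$ and $e^{itg(D_x)}\varphi$ are the solutions of $(i\partial_t+f(D_x))u=0$ and $(i\partial_t+g(D_x))v=0$ with initial data $\varphi$ at $t=0$. The function $\varphi$ is an arbitrary initial datum (the paper does not specify its class). In (II) the points $x_1$, $\widetilde x_1$ are fixed and the norms are taken in $(t,x')$; when $n=1$ the variable $x'$ is omitted.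
   Formalization: For (I)⇒(II),(III), (I) is also assumed at almost every ξ in supp χ with ∂₁f=0 or ∂₁g=0, with quotients in [0,∞] (c/0=∞ for c≠0, 0/0=0); otherwise (II) can fail when such ξ have positive measure. Data φ are those whose defining integrals converge absolutely. *)

theory Defs
  imports "HOL-Analysis.Analysis"
begin

text \<open>
  Points of \<open>\<real>\<^sup>n\<close> have type \<^typ>\<open>real ^ 'n\<close>, and the distinguished first coordinate is
  an arbitrary index \<open>k :: 'n\<close>. The remaining variables \<open>x'\<close> are families indexed by
  \<open>UNIV - {k}\<close>. For \<open>n = 1\<close> the space \<open>lborel_rest k\<close> below is a single point of mass one,
  so that \<open>x'\<close> drops out. The cut-off symbol, usually called chi, is written \<open>X\<close> because the
  letter chi is the binder for vectors.
\<close>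

definition lborel_rest :: "'n::finite \<Rightarrow> ('n \<Rightarrow> real) measure" where
  "lborel_rest k = (\<Pi>\<^sub>M i\<in>UNIV - {k}. lborel)"

definition join_coord :: "'n::finite \<Rightarrow> real \<Rightarrow> ('n \<Rightarrow> real) \<Rightarrow> real ^ 'n" where
  "join_coord k s x' = (\<chi> i. if i = k then s else x' i)"

definition partial_deriv :: "'n::finite \<Rightarrow> (real ^ 'n \<Rightarrow> real) \<Rightarrow> real ^ 'n \<Rightarrow> real" where
  "partial_deriv k f \<xi> = deriv (\<lambda>s. f (\<xi> + s *\<^sub>R axis k 1)) 0"

definition C1_fun :: "('a::real_normed_vector \<Rightarrow> real) \<Rightarrow> bool" where
  "C1_fun f \<longleftrightarrow> (\<exists>f' :: 'a \<Rightarrow> 'a \<Rightarrow>\<^sub>L real.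
     (\<forall>x. (f has_derivative blinfun_apply (f' x)) (at x)) \<and> continuous_on UNIV f')"

text \<open>
  The support of a measurable function: the complement of the largest open set on which the
  function vanishes almost everywhere. It is contained in the closure of the set of
  points where the function is nonzero, with equality for continuous functions.
\<close>

definition ess_support :: "('a::euclidean_space \<Rightarrow> complex) \<Rightarrow> 'a set" where
  "ess_support h = - \<Union>{U. open U \<and> (AE \<xi> in lborel. \<xi> \<in> U \<longrightarrow> h \<xi> = 0)}"

lemma ess_support_subset: "ess_support h \<subseteq> closure {\<xi>. h \<xi> \<noteq> 0}"
proof -
  have "- closure {\<xi>. h \<xi> \<noteq> 0} \<in> {U. open U \<and> (AE \<xi> in lborel. \<xi> \<in> U \<longrightarrow> h \<xi> = 0)}"
    using closure_subset[of "{\<xi>. h \<xi> \<noteq> 0}"] by (auto intro!: AE_I2)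
  then show ?thesis
    unfolding ess_support_def by blast
qed

lemma ess_support_continuous:
  assumes "continuous_on UNIV h"
  shows "ess_support h = closure {\<xi>. h \<xi> \<noteq> 0}"
proof
  show "ess_support h \<subseteq> closure {\<xi>. h \<xi> \<noteq> 0}"
    by (rule ess_support_subset)
  have op: "open {\<xi>. h \<xi> \<noteq> 0}"
    using assms by (intro open_Collect_neq) auto
  have "U \<inter> {\<xi>. h \<xi> \<noteq> 0} = {}" if U: "open U" and ae: "AE \<xi> in lborel. \<xi> \<in> U \<longrightarrow> h \<xi> = 0" for U
  proof (rule ccontr)
    assume ne: "U \<inter> {\<xi>. h \<xi> \<noteq> 0} \<noteq> {}"
    have "open (U \<inter> {\<xi>. h \<xi> \<noteq> 0})"
      using U op by blast
    moreover have "AE \<xi> in lebesgue. \<xi> \<notin> U \<inter> {\<xi>. h \<xi> \<noteq> 0}"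
      by (rule AE_completion) (use ae in eventually_elim, auto)
    then have "negligible (U \<inter> {\<xi>. h \<xi> \<noteq> 0})"
      by (simp add: negligible_iff_null_sets AE_iff_null_sets U op open_Int)
    ultimately show False
      using ne open_not_negligible by blast
  qed
  then have "{\<xi>. h \<xi> \<noteq> 0} \<subseteq> ess_support h"
    unfolding ess_support_def by blast
  moreover have "closed (ess_support h)"
    unfolding ess_support_def by auto
  ultimately show "closure {\<xi>. h \<xi> \<noteq> 0} \<subseteq> ess_support h"
    by (rule closure_minimal)
qed

definition strictly_monotone_on :: "real set \<Rightarrow> (real \<Rightarrow> real) \<Rightarrow> bool" where
  "strictly_monotone_on S h \<longleftrightarrow> strict_mono_on S h \<or> strict_antimono_on S h"

definition L2_norm :: "'a measure \<Rightarrow> ('a \<Rightarrow> complex) \<Rightarrow> ennreal" where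
  "L2_norm M u = (let I = (\<integral>\<^sup>+ x. ennreal ((cmod (u x))\<^sup>2) \<partial>M)
     in if I = \<infinity> then \<infinity> else ennreal (sqrt (enn2real I)))"

definition fourier :: "(real ^ 'n::finite \<Rightarrow> complex) \<Rightarrow> real ^ 'n \<Rightarrow> complex" where
  "fourier \<phi> \<xi> = (LINT x|lebesgue. cis (- (x \<bullet> \<xi>)) * \<phi> x)"

definition fourier_multiplier ::
    "(real ^ 'n::finite \<Rightarrow> complex) \<Rightarrow> (real ^ 'n \<Rightarrow> complex) \<Rightarrow> real ^ 'n \<Rightarrow> complex" where
  "fourier_multiplier a \<phi> x =
     (LINT \<xi>|lebesgue. cis (x \<bullet> \<xi>) * a \<xi> * fourier \<phi> \<xi>) / of_real ((2 * pi) ^ CARD('n))"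

text \<open>
  Bochner integrals of non-integrable functions are 0 in the library, so absolute convergence
  of the two integrals defining \<open>a(D) \<phi>\<close> has to be required explicitly.
\<close>

definition multiplier_defined ::
    "(real ^ 'n::finite \<Rightarrow> complex) \<Rightarrow> (real ^ 'n \<Rightarrow> complex) \<Rightarrow> bool" where
  "multiplier_defined a \<phi> \<longleftrightarrow>
     integrable lebesgue \<phi> \<and> integrable lebesgue (\<lambda>\<xi>. a \<xi> * fourier \<phi> \<xi>)"

text \<open>
  The function \<open>X(D) \<sigma>(D) e\<^bsup>itf(D)\<^esup> \<phi>\<close>. The product of commuting Fourier multipliers is
  the multiplier with the product symbol; the intermediate functions need not be integrable.
  The factor \<open>e\<^bsup>itf\<^esup>\<close> has modulus 1, so it does not affect \<^const>\<open>multiplier_defined\<close>.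
\<close>

definition evolution ::
    "(real ^ 'n::finite \<Rightarrow> complex) \<Rightarrow> (real ^ 'n \<Rightarrow> complex) \<Rightarrow> (real ^ 'n \<Rightarrow> real) \<Rightarrow>
     (real ^ 'n \<Rightarrow> complex) \<Rightarrow> real \<Rightarrow> real ^ 'n \<Rightarrow> complex" where
  "evolution X \<sigma> f \<phi> t = fourier_multiplier (\<lambda>\<xi>. X \<xi> * \<sigma> \<xi> * cis (t * f \<xi>)) \<phi>"

definition trace_norm ::
    "'n::finite \<Rightarrow> (real ^ 'n \<Rightarrow> complex) \<Rightarrow> (real ^ 'n \<Rightarrow> complex) \<Rightarrow> (real ^ 'n \<Rightarrow> real) \<Rightarrow>
     (real ^ 'n \<Rightarrow> complex) \<Rightarrow> real \<Rightarrow> ennreal" where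
  "trace_norm k X \<sigma> f \<phi> x\<^sub>1 =
     L2_norm (lborel \<Otimes>\<^sub>M lborel_rest k) (\<lambda>(t, x'). evolution X \<sigma> f \<phi> t (join_coord k x\<^sub>1 x'))"

definition weighted_norm ::
    "'n::finite \<Rightarrow> (real \<Rightarrow> complex) \<Rightarrow> (real ^ 'n \<Rightarrow> complex) \<Rightarrow> (real ^ 'n \<Rightarrow> complex) \<Rightarrow>
     (real ^ 'n \<Rightarrow> real) \<Rightarrow> (real ^ 'n \<Rightarrow> complex) \<Rightarrow> ennreal" where
  "weighted_norm k w X \<sigma> f \<phi> =
     L2_norm (lborel \<Otimes>\<^sub>M lborel) (\<lambda>(t, x). w (x $ k) * evolution X \<sigma> f \<phi> t x)"

definition symbol_comparison ::
    "'n::finite \<Rightarrow> (real ^ 'n \<Rightarrow> complex) \<Rightarrow> (real ^ 'n \<Rightarrow> complex) \<Rightarrow> (real ^ 'n \<Rightarrow> real) \<Rightarrow>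
     (real ^ 'n \<Rightarrow> complex) \<Rightarrow> (real ^ 'n \<Rightarrow> real) \<Rightarrow> real \<Rightarrow> bool" where
  "symbol_comparison k X \<sigma> f \<tau> g A \<longleftrightarrow>
     (\<forall>\<xi>\<in>ess_support X. partial_deriv k f \<xi> \<noteq> 0 \<longrightarrow> partial_deriv k g \<xi> \<noteq> 0 \<longrightarrow>
        cmod (\<sigma> \<xi>) / sqrt \<bar>partial_deriv k f \<xi>\<bar> \<le> A * (cmod (\<tau> \<xi>) / sqrt \<bar>partial_deriv k g \<xi>\<bar>))"

text \<open>
  The comparison at almost every critical point of the support, with quotients taken in
  \<open>[0, \<infinity>]\<close>, where \<open>c / 0 = \<infinity>\<close> for \<open>c \<noteq> 0\<close> and \<open>0 / 0 = 0\<close>. It holds trivially if the critical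
  points in the support form a null set. If they do not, the norm estimates do not follow
  from \<^const>\<open>symbol_comparison\<close> alone: let \<open>n = 1\<close>, \<open>X = 1\<close>, \<open>f(\<xi>) = \<xi>\<close> and \<open>g' = dist(\<cdot>, K)\<close>
  for a compact nowhere dense \<open>K\<close> of positive measure, so that \<open>g\<close> is strictly increasing. With
  \<open>\<sigma> = 1\<close>, \<open>\<tau> = |g'|\<^bsup>1/2\<^esup>\<close> and \<open>A = 1\<close>, the squared trace norms are, up to the same factor, the
  integrals of \<open>|\<phi>^(\<xi>)|\<^sup>2\<close> over the whole line on the left but only over the complement of
  \<open>K\<close> on the right.
\<close>

definition critical_comparison ::
    "'n::finite \<Rightarrow> (real ^ 'n \<Rightarrow> complex) \<Rightarrow> (real ^ 'n \<Rightarrow> complex) \<Rightarrow> (real ^ 'n \<Rightarrow> real) \<Rightarrow>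
     (real ^ 'n \<Rightarrow> complex) \<Rightarrow> (real ^ 'n \<Rightarrow> real) \<Rightarrow> real \<Rightarrow> bool" where
  "critical_comparison k X \<sigma> f \<tau> g A \<longleftrightarrow>
     (AE \<xi> in lborel. \<xi> \<in> ess_support X \<longrightarrow> partial_deriv k f \<xi> = 0 \<or> partial_deriv k g \<xi> = 0 \<longrightarrow>
        ennreal (cmod (\<sigma> \<xi>)) / ennreal (sqrt \<bar>partial_deriv k f \<xi>\<bar>)
          \<le> ennreal A * (ennreal (cmod (\<tau> \<xi>)) / ennreal (sqrt \<bar>partial_deriv k g \<xi>\<bar>)))"

end

theory Submission
  imports Defs "HOL-Probability.Probability"
begin

text \<open>
  Write \<open>D\<^sub>f(F)\<close> for the integral of \<open>|F|\<^sup>2 / |\<partial>f|\<close> over \<open>\<real>\<^sup>n\<close>, where \<open>\<partial>\<close> is the derivative in the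
  distinguished direction and the quotient takes values in \<open>[0, \<infinity>]\<close>. Everything rests on one
  identity: with \<open>F = X \<sigma> \<phi>^\<close>, the square of the trace norm of \<open>X(D) \<sigma>(D) e\<^bsup>itf(D)\<^esup> \<phi>\<close> on any
  hyperplane \<open>x\<^sub>1 = const\<close> equals \<open>(2\<pi>)\<^sup>-\<^sup>n D\<^sub>f(F)\<close>, both sides being allowed to be infinite
  (\<open>trace_energy\<close>). Heuristically, \<open>\<eta> = f(\<xi>\<^sub>1, \<xi>')\<close> is a legitimate coordinate in place of
  \<open>\<xi>\<^sub>1\<close> because \<open>f\<close> is injective along the line, so the trace is, up to a unimodular factor, the inverse
  Fourier transform of \<open>F / |\<partial>f|\<close> in the variables \<open>(\<eta>, \<xi>')\<close>, and Plancherel's theorem together with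
  \<open>d\<eta> = |\<partial>f| d\<xi>\<^sub>1\<close> gives \<open>D\<^sub>f(F)\<close>.

  The heuristic ignores that \<open>F\<close> is merely integrable and that \<open>\<partial>f\<close> may vanish on a set of positive
  measure, where the image of \<open>F d\<xi>\<^sub>1\<close> under \<open>f\<close> is a singular measure. The one-dimensional
  identity \<open>osc_plancherel\<close> copes with both by two separate inequalities. For the upper bound
  (\<open>osc_L2_upper\<close>) the transform is regularised by a Gaussian in \<open>t\<close>, which turns its \<open>L\<^sup>2\<close> norm into
  a double integral of \<open>F(s) F(r)\<close> against a Gaussian density in \<open>f(s) - f(r)\<close>; a weighted AM-GM
  inequality and the change of variables \<open>y = f(r)\<close> finish it. The lower bound (\<open>osc_L2_lower\<close>) is
  a duality argument: pairing \<open>F\<close> with a function \<open>v(f(s))\<close> costs at most a constant times the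
  \<open>L\<^sup>2\<close> norm of \<open>v\<close> times that of the transform, and by compactness and Tietze's theorem the functions \<open>v \<circ> f\<close> are
  rich enough to test \<open>F\<close> against everything on the support, critical points included; there the
  \<open>L\<^sup>2\<close> norm of \<open>v\<close> costs nothing, which forces \<open>F = 0\<close> almost everywhere on the critical set unless
  the transform has infinite norm. With the phase \<open>f(s) = s\<close> this is the usual Plancherel identity, so
  the remaining variables \<open>x'\<close> can be added one at a time (\<open>plancherel_step\<close>).

  Given the identity, the symbol comparison and its counterpart at critical points, multiplied by
  \<open>|X \<phi>^|\<close> and squared, say that the integrand of \<open>D\<^sub>f(X \<sigma> \<phi>^)\<close> is almost everywhere at most that of
  \<open>A\<^sup>2 D\<^sub>g(X \<tau> \<phi>^)\<close> (\<open>energy_comparison\<close>). Since the trace norm does not depend on \<open>x\<^sub>1\<close>, the squared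
  weighted norm is the squared trace norm times the integral of \<open>|w|\<^sup>2\<close> (\<open>weighted_norm_square\<close>).

  Conversely, if the comparison failed at a point of the
  support, it would fail strictly on a neighbourhood of a point where \<open>X \<noteq> 0\<close>, and a \<open>\<phi>\<close> whose
  Fourier transform lives in that neighbourhood (\<open>fourier_localized_test_function\<close>) would violate
  the norm estimate (\<open>symbol_comparison_if_energies\<close>).
\<close>

section \<open>Gaussian regularisation of oscillatory integrals\<close>

text \<open>
  The Fourier transform of the image under \<open>f\<close> of the complex measure \<open>F ds\<close>, with the sign convention
  of the evolution \<open>e\<^bsup>itf\<^esup>\<close>.
\<close>

definition osc :: "(real \<Rightarrow> real) \<Rightarrow> (real \<Rightarrow> complex) \<Rightarrow> real \<Rightarrow> complex" where
  "osc f F t = (LINT s|lborel. cis (t * f s) * F s)"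

lemma measurable_cis [measurable]: "cis \<in> borel_measurable borel"
  by (intro borel_measurable_continuous_onI continuous_intros)

lemma measurable_cnj [measurable]: "cnj \<in> borel_measurable borel"
  by (intro borel_measurable_continuous_onI continuous_intros)

lemma osc_measurable [measurable]:
  assumes [measurable]: "F \<in> borel_measurable borel" "f \<in> borel_measurable borel"
  shows "osc f F \<in> borel_measurable borel"
  unfolding osc_def by measurable

lemma norm_osc_le:
  assumes "integrable lborel F"
  shows "cmod (osc f F t) \<le> (LINT s|lborel. cmod (F s))"
  unfolding osc_def
  by (rule order_trans[OF integral_norm_bound]) (simp add: norm_mult)

lemma integrable_gaussian:
  assumes "\<epsilon> > 0"
  shows "integrable lborel (\<lambda>t::real. exp (- (\<epsilon>\<^sup>2 * t\<^sup>2 / 2)))"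
proof -
  have "integrable lborel (\<lambda>t. normal_density 0 (1/\<epsilon>) t * sqrt (2 * pi * (1/\<epsilon>)\<^sup>2))"
    using assms by (intro integrable_mult_left integrable_normal_density) auto
  moreover have "normal_density 0 (1/\<epsilon>) t * sqrt (2 * pi * (1/\<epsilon>)\<^sup>2) = exp (- (\<epsilon>\<^sup>2 * t\<^sup>2 / 2))" for t
    using assms by (simp add: normal_density_def field_simps)
  ultimately show ?thesis by simp
qed

lemma fourier_gaussian:
  assumes e: "\<epsilon> > 0"
  shows "(LINT t|lborel. cis (t * y) * of_real (exp (- (\<epsilon>\<^sup>2 * t\<^sup>2 / 2))))
         = of_real (2 * pi * normal_density 0 \<epsilon> y)"
proof -
  have "of_real (exp (- ((y/\<epsilon>)\<^sup>2) / 2)) = char std_normal_distribution (y/\<epsilon>)"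
    by (simp add: char_std_normal_distribution)
  also have "\<dots> = (LINT x|lborel. std_normal_density x *\<^sub>R cis (y/\<epsilon> * x))"
    unfolding char_def by (subst integral_density) (auto simp: cis_conv_exp)
  also have "\<dots> = \<epsilon> *\<^sub>R (LINT x|lborel. std_normal_density (\<epsilon> * x) *\<^sub>R cis (y/\<epsilon> * (\<epsilon> * x)))"
    using e lborel_integral_real_affine[of \<epsilon> "\<lambda>x. std_normal_density x *\<^sub>R cis (y/\<epsilon> * x)" 0] by simp
  also have "(LINT x|lborel. std_normal_density (\<epsilon> * x) *\<^sub>R cis (y/\<epsilon> * (\<epsilon> * x)))
     = (LINT x|lborel. of_real (1 / sqrt (2*pi)) * (cis (x * y) * of_real (exp (- (\<epsilon>\<^sup>2 * x\<^sup>2 / 2)))))"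
    using e by (intro Bochner_Integration.integral_cong refl)
      (simp add: std_normal_density_def scaleR_conv_of_real mult_ac power_mult_distrib)
  also have "\<dots> = of_real (1 / sqrt (2*pi)) * (LINT x|lborel. cis (x * y) * of_real (exp (- (\<epsilon>\<^sup>2 * x\<^sup>2 / 2))))"
    by (rule integral_mult_right_zero)
  finally have *: "complex_of_real (exp (- ((y/\<epsilon>)\<^sup>2) / 2)) =
    of_real (\<epsilon> / sqrt (2*pi)) * (LINT x|lborel. cis (x * y) * of_real (exp (- (\<epsilon>\<^sup>2 * x\<^sup>2 / 2))))"
    (is "_ = _ * ?I")
    by (simp add: scaleR_conv_of_real)
  have "?I = of_real (sqrt (2*pi) / \<epsilon>) * (of_real (\<epsilon> / sqrt (2*pi)) * ?I)"
    using e by (simp add: field_simps flip: of_real_mult)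
  also have "\<dots> = of_real (sqrt (2*pi) / \<epsilon> * exp (- ((y/\<epsilon>)\<^sup>2) / 2))"
    unfolding *[symmetric] by simp
  also have "sqrt (2*pi) / \<epsilon> * exp (- ((y/\<epsilon>)\<^sup>2) / 2) = 2 * pi * normal_density 0 \<epsilon> y"
  proof -
    have "sqrt (2*pi) / \<epsilon> = 2 * pi * (1 / sqrt (2 * pi * \<epsilon>\<^sup>2))"
      using e real_sqrt_mult_self[of "2*pi"] by (simp add: real_sqrt_mult field_simps)
    then show ?thesis by (simp add: normal_density_def power_divide)
  qed
  finally show ?thesis .
qed

lemma integrable_tensor:
  fixes F :: "'a \<Rightarrow> 'c::{real_normed_field, banach, second_countable_topology}"
  assumes "sigma_finite_measure M" "sigma_finite_measure N"
    and F: "integrable M F" and G: "integrable N G"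
  shows "integrable (M \<Otimes>\<^sub>M N) (\<lambda>p. F (fst p) * G (snd p))"
proof -
  interpret pair_sigma_finite M N
    using assms(1,2) by (rule pair_sigma_finite.intro)
  have [measurable]: "F \<in> borel_measurable M" "G \<in> borel_measurable N"
    using F G by auto
  show ?thesis
  proof (rule Fubini_integrable)
    show "integrable M (\<lambda>x. LINT y|N. norm (F (fst (x, y)) * G (snd (x, y))))"
      using F by (simp add: norm_mult)
    show "AE x in M. integrable N (\<lambda>y. F (fst (x, y)) * G (snd (x, y)))"
      using G by simp
  qed measurable
qed

text \<open>
  The Gaussian makes the integral over \<open>(t, s, r)\<close> absolutely convergent for merely integrable \<open>F\<close> and
  \<open>G\<close>, so that it may be evaluated in \<open>t\<close> first. The right-hand side is the \<open>L\<^sup>2\<close> pairing of the image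
  measures \<open>f(F)\<close> and \<open>g(G)\<close> blurred at scale \<open>\<epsilon>\<close>. It is used below both with \<open>f = g\<close> and with
  \<open>g\<close> the identity.
\<close>

lemma gaussian_pairing:
  assumes F: "integrable lborel F" and G: "integrable lborel G"
    and [measurable]: "f \<in> borel_measurable borel" "g \<in> borel_measurable borel"
    and e: "\<epsilon> > 0"
  shows "(LINT t|lborel. osc f F t * cnj (osc g G t) * of_real (exp (- (\<epsilon>\<^sup>2 * t\<^sup>2 / 2))))
    = of_real (2 * pi) * (LINT s|lborel. F s * (LINT r|lborel. cnj (G r) * of_real (normal_density 0 \<epsilon> (f s - g r))))"
proof -
  let ?w = "\<lambda>t::real. exp (- (\<epsilon>\<^sup>2 * t\<^sup>2 / 2))"
  have [measurable]: "F \<in> borel_measurable borel" "G \<in> borel_measurable borel"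
    using F G by auto
  let ?K = "\<lambda>t s r. cis (t * (f s - g r)) * (F s * cnj (G r)) * complex_of_real (?w t)"
  have intw: "integrable lborel (\<lambda>t. complex_of_real (?w t))"
    using integrable_gaussian[OF e] by simp
  have cG: "integrable lborel (\<lambda>r. cnj (G r))"
    using G by simp
  have L2: "sigma_finite_measure (lborel \<Otimes>\<^sub>M lborel :: (real \<times> real) measure)"
    unfolding lborel_prod by (rule lborel.sigma_finite_measure_axioms)
  interpret P: pair_sigma_finite lborel "lborel \<Otimes>\<^sub>M lborel :: (real \<times> real) measure"
    by (intro pair_sigma_finite.intro lborel.sigma_finite_measure_axioms L2)
  have FG: "integrable (lborel \<Otimes>\<^sub>M lborel) (\<lambda>p. F (fst p) * cnj (G (snd p)))"
    by (intro integrable_tensor lborel.sigma_finite_measure_axioms F cG)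
  \<comment> \<open>The integrand has modulus \<open>|F s| |G r|\<close> times the Gaussian, a tensor product of integrable functions.\<close>
  have int3: "integrable (lborel \<Otimes>\<^sub>M (lborel \<Otimes>\<^sub>M lborel)) (\<lambda>(t,p). ?K t (fst p) (snd p))"
    by (rule Bochner_Integration.integrable_bound[OF integrable_tensor[OF lborel.sigma_finite_measure_axioms
           L2 intw FG]])
       (auto simp: norm_mult split_beta mult_ac)
  have "(LINT t|lborel. osc f F t * cnj (osc g G t) * of_real (?w t))
      = (LINT t|lborel. LINT p|(lborel \<Otimes>\<^sub>M lborel). ?K t (fst p) (snd p))"
  proof (intro Bochner_Integration.integral_cong refl)
    fix t
    have "integrable lborel (\<lambda>s. cis (t * f s) * F s)" "integrable lborel (\<lambda>r. cnj (cis (t * g r) * G r))"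
      by (rule Bochner_Integration.integrable_bound[OF F]; simp add: norm_mult)
         (rule Bochner_Integration.integrable_bound[OF cG]; simp add: norm_mult)
    note i = this
    have "osc f F t * cnj (osc g G t)
        = (LINT s|lborel. (cis (t * f s) * F s) * (LINT r|lborel. cnj (cis (t * g r) * G r)))"
      unfolding osc_def by (simp del: complex_cnj_mult flip: integral_cnj)
    also have "\<dots> = (LINT s|lborel. LINT r|lborel. (cis (t * f s) * F s) * cnj (cis (t * g r) * G r))"
      by (simp del: complex_cnj_mult)
    also have "\<dots> = (LINT p|(lborel \<Otimes>\<^sub>M lborel). (cis (t * f (fst p)) * F (fst p)) * cnj (cis (t * g (snd p)) * G (snd p)))"
      using lborel_pair.integral_fst'[OF integrable_tensor[OF lborel.sigma_finite_measure_axioms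
           lborel.sigma_finite_measure_axioms i]] by simp
    finally have eq: "osc f F t * cnj (osc g G t) = \<dots>" .
    show "osc f F t * cnj (osc g G t) * of_real (?w t) = (LINT p|(lborel \<Otimes>\<^sub>M lborel). ?K t (fst p) (snd p))"
      unfolding eq by (subst integral_mult_left_zero[symmetric])
        (simp add: cis_cnj cis_mult right_diff_distrib mult_ac)
  qed
  also have "\<dots> = (LINT p|(lborel \<Otimes>\<^sub>M lborel). LINT t|lborel. ?K t (fst p) (snd p))"
    by (rule P.Fubini_integral[OF int3, symmetric])
  also have "\<dots> = (LINT p|(lborel \<Otimes>\<^sub>M lborel). of_real (2 * pi) *
      (F (fst p) * cnj (G (snd p)) * of_real (normal_density 0 \<epsilon> (f (fst p) - g (snd p)))))"
  proof (intro Bochner_Integration.integral_cong refl)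
    fix p :: "real \<times> real"
    have "(LINT t|lborel. ?K t (fst p) (snd p)) = (LINT t|lborel. (F (fst p) * cnj (G (snd p))) *
        (cis (t * (f (fst p) - g (snd p))) * of_real (?w t)))"
      by (intro Bochner_Integration.integral_cong refl) (simp add: mult_ac)
    also have "\<dots> = (F (fst p) * cnj (G (snd p))) *
        of_real (2 * pi * normal_density 0 \<epsilon> (f (fst p) - g (snd p)))"
      by (simp only: integral_mult_right_zero fourier_gaussian[OF e])
    finally show "(LINT t|lborel. ?K t (fst p) (snd p)) = of_real (2 * pi) *
      (F (fst p) * cnj (G (snd p)) * of_real (normal_density 0 \<epsilon> (f (fst p) - g (snd p))))"
      by (simp add: mult_ac)
  qed
  also have "\<dots> = of_real (2 * pi) * (LINT p|(lborel \<Otimes>\<^sub>M lborel).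
      F (fst p) * cnj (G (snd p)) * of_real (normal_density 0 \<epsilon> (f (fst p) - g (snd p))))"
    by (rule integral_mult_right_zero)
  also have "(LINT p|(lborel \<Otimes>\<^sub>M lborel).
      F (fst p) * cnj (G (snd p)) * of_real (normal_density 0 \<epsilon> (f (fst p) - g (snd p))))
     = (LINT s|lborel. LINT r|lborel. F s * cnj (G r) * of_real (normal_density 0 \<epsilon> (f s - g r)))"
  proof -
    have "integrable (lborel \<Otimes>\<^sub>M lborel)
      (\<lambda>p. F (fst p) * cnj (G (snd p)) * of_real (normal_density 0 \<epsilon> (f (fst p) - g (snd p))))"
    proof (rule Bochner_Integration.integrable_bound[where f = "\<lambda>p. of_real (normal_density 0 \<epsilon> 0) * (F (fst p) * cnj (G (snd p)))"])
      show "integrable (lborel \<Otimes>\<^sub>M lborel) (\<lambda>p. of_real (normal_density 0 \<epsilon> 0) * (F (fst p) * cnj (G (snd p))))"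
        using FG by (rule integrable_mult_right)
      have n0: "normal_density 0 \<epsilon> y \<le> normal_density 0 \<epsilon> 0" for y
        using e by (simp add: normal_density_def divide_right_mono)
      have "norm (F (fst p) * cnj (G (snd p)) * complex_of_real (normal_density 0 \<epsilon> (f (fst p) - g (snd p))))
          \<le> norm (complex_of_real (normal_density 0 \<epsilon> 0) * (F (fst p) * cnj (G (snd p))))" for p
        using mult_right_mono[OF n0[of "f (fst p) - g (snd p)"], of "cmod (F (fst p)) * cmod (G (snd p))"]
        by (simp add: norm_mult mult_ac)
      then show "AE p in lborel \<Otimes>\<^sub>M lborel.
        norm (F (fst p) * cnj (G (snd p)) * complex_of_real (normal_density 0 \<epsilon> (f (fst p) - g (snd p))))
          \<le> norm (complex_of_real (normal_density 0 \<epsilon> 0) * (F (fst p) * cnj (G (snd p))))"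
        by blast
    qed measurable
    from lborel_pair.integral_fst'[OF this] show ?thesis by simp
  qed
  finally show ?thesis
    by (simp add: mult.assoc)
qed

section \<open>The upper half of the one-dimensional Plancherel identity\<close>

lemma norm_integral_le_nn_integral:
  fixes f :: "'a \<Rightarrow> 'b::{banach, second_countable_topology}"
  shows "ennreal (norm (integral\<^sup>L M f)) \<le> (\<integral>\<^sup>+ x. ennreal (norm (f x)) \<partial>M)"
  by (cases "integrable M f") (auto simp: integral_norm_bound_ennreal not_integrable_integral_eq)

text \<open>
  Critical points of \<open>f\<close> are admitted: their contribution vanishes on the left, and by Sard's theorem
  their image is a null set on the right.
\<close>

lemma nn_integral_change_of_variables:
  fixes f f' q :: "real \<Rightarrow> real"
  assumes S: "closed S"
    and der: "\<And>s. (f has_real_derivative f' s) (at s)"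
    and inj: "inj_on f S"
    and q: "integrable lborel q" and q0: "\<And>y. 0 \<le> q y"
  shows "(\<integral>\<^sup>+ s. ennreal (\<bar>f' s\<bar> * q (f s)) * indicator S s \<partial>lborel)
         = (\<integral>\<^sup>+ y. ennreal (q y) * indicator (f ` S) y \<partial>lborel)"
proof -
  have S': "S \<in> sets lebesgue"
    using S by auto
  have dw: "(f has_field_derivative f' s) (at s within S)" for s
    using der has_field_derivative_at_within by blast
  have fS: "f ` S \<in> sets lebesgue"
    by (rule differentiable_image_in_sets_lebesgue[OF S'])
       (use dw in \<open>auto simp: differentiable_on_def differentiable_def has_field_derivative_def\<close>)
  have qi: "q absolutely_integrable_on (f ` S)"
    unfolding set_integrable_def using q fS
    by (intro integrable_mult_indicator) (auto simp: integrable_completion)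
  have *: "(\<lambda>s. \<bar>f' s\<bar> * q (f s)) absolutely_integrable_on S"
    and eq: "integral S (\<lambda>s. \<bar>f' s\<bar> * q (f s)) = integral (f ` S) q"
    using has_absolute_integral_change_of_variables_1'[OF S' dw inj, of q "integral (f ` S) q"] qi by auto
  have nn: "(\<integral>\<^sup>+ x. ennreal (h x) * indicator T x \<partial>lborel) = ennreal (integral T h)"
    if "h absolutely_integrable_on T" "\<And>x. 0 \<le> h x" for h :: "real \<Rightarrow> real" and T
  proof -
    have "(\<integral>\<^sup>+ x. ennreal (h x) * indicator T x \<partial>lborel) = (\<integral>\<^sup>+ x. ennreal (indicator T x *\<^sub>R h x) \<partial>lebesgue)"
      unfolding nn_integral_completion by (intro nn_integral_cong) (simp add: indicator_def)
    also have "\<dots> = ennreal (LINT x|lebesgue. indicator T x *\<^sub>R h x)"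
      using that by (intro nn_integral_eq_integral) (auto simp: set_integrable_def indicator_def)
    also have "(LINT x|lebesgue. indicator T x *\<^sub>R h x) = integral T h"
      using set_lebesgue_integral_eq_integral(2)[OF that(1)] by (simp add: set_lebesgue_integral_def)
    finally show ?thesis .
  qed
  show ?thesis
    using q0 by (simp add: nn[OF *] nn[OF qi] eq)
qed

lemma weighted_am_gm:
  fixes a b c d :: real
  assumes "c > 0" "d > 0"
  shows "2 * (a * b) \<le> a\<^sup>2 / c * d + b\<^sup>2 / d * c"
proof -
  have "a\<^sup>2 / c * d + b\<^sup>2 / d * c - 2 * (a * b) = (a * d - b * c)\<^sup>2 / (c * d)"
    using assms by (simp add: field_simps power2_eq_square)
  also have "\<dots> \<ge> 0" using assms by simp
  finally show ?thesis by simp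
qed

lemma ennreal_le_from_double: "2 * x \<le> 2 * y \<Longrightarrow> x \<le> y" for x y :: ennreal
  using ennreal_mult_le_mult_iff[of 2 x y] by simp

text \<open>
  When the right-hand side is finite, \<open>F\<close> vanishes almost everywhere at critical points. Expand the
  regularised \<open>L\<^sup>2\<close> norm by \<open>gaussian_pairing\<close> and bound \<open>2 |F s| |F r|\<close> by
  \<open>|F s|\<^sup>2 |f' r| / |f' s| + |F r|\<^sup>2 |f' s| / |f' r|\<close>. In the first term the integral over \<open>r\<close> becomes,
  after the change of variables \<open>y = f r\<close>, an integral of a Gaussian probability density, hence at
  most \<open>1\<close>; the second term is symmetric. Removing the regularisation is Fatou's lemma.
\<close>

lemma osc_L2_upper:
  fixes f f' :: "real \<Rightarrow> real"
  assumes F: "integrable lborel F" and S: "closed S" and F0: "AE s in lborel. s \<notin> S \<longrightarrow> F s = 0"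
    and der: "\<And>s. (f has_real_derivative f' s) (at s)" and f': "continuous_on UNIV f'"
    and inj: "inj_on f S"
  shows "(\<integral>\<^sup>+ t. ennreal ((cmod (osc f F t))\<^sup>2) \<partial>lborel)
      \<le> ennreal (2 * pi) * (\<integral>\<^sup>+ s. ennreal ((cmod (F s))\<^sup>2) / ennreal \<bar>f' s\<bar> \<partial>lborel)"
    (is "_ \<le> _ * ?D")
proof (cases "?D = \<infinity>")
  case True
  then show ?thesis by (simp add: ennreal_mult_top)
next
  case fin: False
  have [measurable]: "F \<in> borel_measurable borel" "f' \<in> borel_measurable borel" "S \<in> sets borel"
    using F f' S by (auto intro: borel_measurable_continuous_onI)
  have [measurable]: "f \<in> borel_measurable borel"
    using der by (intro borel_measurable_continuous_onI continuous_at_imp_continuous_on)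
      (auto intro: DERIV_isCont)
  let ?E = "\<lambda>s. ennreal ((cmod (F s))\<^sup>2) / ennreal \<bar>f' s\<bar>"
  have "AE s in lborel. ?E s \<noteq> \<infinity>"
    using fin by (intro nn_integral_PInf_AE) auto
  \<comment> \<open>A finite integral has an almost everywhere finite integrand, and a nonzero number divided by zero
    is infinite.\<close>
  then have good: "AE s in lborel. F s = 0 \<or> s \<in> S \<and> f' s \<noteq> 0"
    using F0 by eventually_elim (auto simp: ennreal_divide_eq_top_iff)
  have bound: "(\<integral>\<^sup>+ t. ennreal ((cmod (osc f F t))\<^sup>2 * exp (- (\<epsilon>\<^sup>2 * t\<^sup>2 / 2))) \<partial>lborel) \<le> ennreal (2 * pi) * ?D"
    if e: "\<epsilon> > 0" for \<epsilon>
  proof -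
    define p where "p s r = normal_density 0 \<epsilon> (f s - f r)" for s r
    have p0: "0 \<le> p s r" for s r by (simp add: p_def)
    have [measurable]: "(\<lambda>x. p (g x) (h x)) \<in> borel_measurable M"
      if [measurable]: "g \<in> borel_measurable M" "h \<in> borel_measurable M" for g h and M :: "'a measure"
      unfolding p_def by measurable
    have psym: "p s r = p r s" for s r
      by (simp add: p_def normal_density_def power2_commute)
    let ?w = "\<lambda>t::real. exp (- (\<epsilon>\<^sup>2 * t\<^sup>2 / 2))"
    have int: "integrable lborel (\<lambda>t. (cmod (osc f F t))\<^sup>2 * ?w t)"
      by (rule Bochner_Integration.integrable_bound
            [OF integrable_mult_right[OF integrable_gaussian[OF e], of "(LINT s|lborel. cmod (F s))\<^sup>2"]])
         (auto intro!: mult_right_mono power_mono norm_osc_le F simp: abs_mult)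
    have "complex_of_real (LINT t|lborel. (cmod (osc f F t))\<^sup>2 * ?w t)
       = (LINT t|lborel. osc f F t * cnj (osc f F t) * of_real (?w t))"
      by (simp only: integral_complex_of_real[symmetric] of_real_mult complex_norm_square)
    also have "\<dots> = of_real (2 * pi) * (LINT s|lborel. F s * (LINT r|lborel. cnj (F r) * of_real (p s r)))"
      unfolding p_def by (rule gaussian_pairing[OF F F _ _ e]) auto
    finally have eq: "complex_of_real (LINT t|lborel. (cmod (osc f F t))\<^sup>2 * ?w t) = \<dots>" .
    have "(LINT t|lborel. (cmod (osc f F t))\<^sup>2 * ?w t) = cmod (complex_of_real (LINT t|lborel. (cmod (osc f F t))\<^sup>2 * ?w t))"
      by simp
    also have "\<dots> = 2 * pi * cmod (LINT s|lborel. F s * (LINT r|lborel. cnj (F r) * of_real (p s r)))"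
      unfolding eq by (simp add: norm_mult)
    finally have eq2: "(LINT t|lborel. (cmod (osc f F t))\<^sup>2 * ?w t) = \<dots>" .
    have "(\<integral>\<^sup>+ t. ennreal ((cmod (osc f F t))\<^sup>2 * ?w t) \<partial>lborel) = ennreal (LINT t|lborel. (cmod (osc f F t))\<^sup>2 * ?w t)"
      by (rule nn_integral_eq_integral[OF int]) simp
    also have "\<dots> = ennreal (2 * pi) * ennreal (cmod (LINT s|lborel. F s * (LINT r|lborel. cnj (F r) * of_real (p s r))))"
      by (simp only: eq2) (rule ennreal_mult, simp_all)
    also have "\<dots> \<le> ennreal (2 * pi) * ?D"
    proof (rule mult_left_mono, rule ennreal_le_from_double)
      have "2 * ennreal (cmod (LINT s|lborel. F s * (LINT r|lborel. cnj (F r) * of_real (p s r))))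
          \<le> 2 * (\<integral>\<^sup>+ s. ennreal (cmod (F s)) * ennreal (cmod (LINT r|lborel. cnj (F r) * of_real (p s r))) \<partial>lborel)"
        by (intro mult_left_mono order_trans[OF norm_integral_le_nn_integral]) (auto simp: norm_mult ennreal_mult)
      also have "\<dots> \<le> 2 * (\<integral>\<^sup>+ s. ennreal (cmod (F s)) * (\<integral>\<^sup>+ r. ennreal (cmod (F r) * p s r) \<partial>lborel) \<partial>lborel)"
        by (intro mult_left_mono nn_integral_mono order_trans[OF norm_integral_le_nn_integral])
           (auto simp: norm_mult p0)
      also have "\<dots> = (\<integral>\<^sup>+ s. \<integral>\<^sup>+ r. 2 * (ennreal (cmod (F s)) * ennreal (cmod (F r) * p s r)) \<partial>lborel \<partial>lborel)"
        by (simp add: nn_integral_cmult)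
      also have "\<dots> \<le> (\<integral>\<^sup>+ s. \<integral>\<^sup>+ r. ?E s * (ennreal (\<bar>f' r\<bar> * p s r) * indicator S r)
                              + ?E r * (ennreal (\<bar>f' s\<bar> * p r s) * indicator S s) \<partial>lborel \<partial>lborel)"
      proof (rule nn_integral_mono_AE, use good in eventually_elim, rule nn_integral_mono_AE, use good in eventually_elim)
        fix s r assume s: "F s = 0 \<or> s \<in> S \<and> f' s \<noteq> 0" and r: "F r = 0 \<or> r \<in> S \<and> f' r \<noteq> 0"
        show "2 * (ennreal (cmod (F s)) * ennreal (cmod (F r) * p s r))
           \<le> ?E s * (ennreal (\<bar>f' r\<bar> * p s r) * indicator S r) + ?E r * (ennreal (\<bar>f' s\<bar> * p r s) * indicator S s)"
        proof (cases "F s = 0 \<or> F r = 0")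
          case False
          with s r have "s \<in> S" "r \<in> S" and pos: "\<bar>f' s\<bar> > 0" "\<bar>f' r\<bar> > 0" by auto
          have "2 * (cmod (F s) * cmod (F r)) * p s r
            \<le> ((cmod (F s))\<^sup>2 / \<bar>f' s\<bar> * \<bar>f' r\<bar> + (cmod (F r))\<^sup>2 / \<bar>f' r\<bar> * \<bar>f' s\<bar>) * p s r"
            by (rule mult_right_mono[OF weighted_am_gm[OF pos] p0])
          then show ?thesis
            using \<open>s \<in> S\<close> \<open>r \<in> S\<close> pos p0[of s r]
            by (simp add: divide_ennreal psym[of r s] algebra_simps flip: ennreal_mult ennreal_plus ennreal_numeral)
        qed auto
      qed
      also have "\<dots> = (\<integral>\<^sup>+ s. ?E s * (\<integral>\<^sup>+ r. ennreal (\<bar>f' r\<bar> * p s r) * indicator S r \<partial>lborel) \<partial>lborel)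
          + (\<integral>\<^sup>+ s. \<integral>\<^sup>+ r. ?E r * (ennreal (\<bar>f' s\<bar> * p r s) * indicator S s) \<partial>lborel \<partial>lborel)"
        by (simp add: nn_integral_add nn_integral_cmult)
      \<comment> \<open>Exchanging the names of \<open>s\<close> and \<open>r\<close> turns the second term into the first.\<close>
      also have "(\<integral>\<^sup>+ s. \<integral>\<^sup>+ r. ?E r * (ennreal (\<bar>f' s\<bar> * p r s) * indicator S s) \<partial>lborel \<partial>lborel)
        = (\<integral>\<^sup>+ r. \<integral>\<^sup>+ s. ?E r * (ennreal (\<bar>f' s\<bar> * p r s) * indicator S s) \<partial>lborel \<partial>lborel)"
        by (rule lborel_pair.Fubini') measurable
      also have "\<dots> = (\<integral>\<^sup>+ s. ?E s * (\<integral>\<^sup>+ r. ennreal (\<bar>f' r\<bar> * p s r) * indicator S r \<partial>lborel) \<partial>lborel)"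
        by (simp add: nn_integral_cmult)
      also have "(\<integral>\<^sup>+ s. ?E s * (\<integral>\<^sup>+ r. ennreal (\<bar>f' r\<bar> * p s r) * indicator S r \<partial>lborel) \<partial>lborel) \<le> ?D"
      proof (rule nn_integral_mono)
        fix s
        have "(\<lambda>y. normal_density 0 \<epsilon> (f s - y)) = normal_density (f s) \<epsilon>"
          by (simp add: fun_eq_iff normal_density_def power2_commute)
        then have "(\<integral>\<^sup>+ r. ennreal (\<bar>f' r\<bar> * p s r) * indicator S r \<partial>lborel)
           = (\<integral>\<^sup>+ y. ennreal (normal_density (f s) \<epsilon> y) * indicator (f ` S) y \<partial>lborel)"
          unfolding p_def
          using nn_integral_change_of_variables[OF S der inj, of "normal_density (f s) \<epsilon>"] e
          by (auto simp: fun_eq_iff)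
        also have "\<dots> \<le> (\<integral>\<^sup>+ y. ennreal (normal_density (f s) \<epsilon> y) \<partial>lborel)"
          by (intro nn_integral_mono) (auto simp: indicator_def)
        also have "\<dots> = 1"
          using e by (subst nn_integral_eq_integral) auto
        finally show "?E s * (\<integral>\<^sup>+ r. ennreal (\<bar>f' r\<bar> * p s r) * indicator S r \<partial>lborel) \<le> ?E s"
          using mult_left_mono[of _ 1 "?E s"] by simp
      qed
      finally show "2 * ennreal (cmod (LINT s|lborel. F s * (LINT r|lborel. cnj (F r) * of_real (p s r)))) \<le> 2 * ?D"
        by (simp add: mult_2 add_mono)
    qed simp
    finally show ?thesis .
  qed
  let ?e = "\<lambda>n. 1 / real (Suc n)"
  have "(\<integral>\<^sup>+ t. ennreal ((cmod (osc f F t))\<^sup>2) \<partial>lborel)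
     = (\<integral>\<^sup>+ t. liminf (\<lambda>n. ennreal ((cmod (osc f F t))\<^sup>2 * exp (- ((?e n)\<^sup>2 * t\<^sup>2 / 2)))) \<partial>lborel)"
  proof (intro nn_integral_cong)
    fix t
    have "?e \<longlonglongrightarrow> 0"
      using LIMSEQ_inverse_real_of_nat by (simp add: inverse_eq_divide)
    then have "(\<lambda>n. (cmod (osc f F t))\<^sup>2 * exp (- ((?e n)\<^sup>2 * t\<^sup>2 / 2))) \<longlonglongrightarrow> (cmod (osc f F t))\<^sup>2 * exp (- (0\<^sup>2 * t\<^sup>2 / 2))"
      by (intro tendsto_intros) auto
    then have "(\<lambda>n. ennreal ((cmod (osc f F t))\<^sup>2 * exp (- ((?e n)\<^sup>2 * t\<^sup>2 / 2)))) \<longlonglongrightarrow> ennreal ((cmod (osc f F t))\<^sup>2)"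
      by (intro tendsto_ennrealI) simp
    then show "ennreal ((cmod (osc f F t))\<^sup>2) = liminf (\<lambda>n. ennreal ((cmod (osc f F t))\<^sup>2 * exp (- ((?e n)\<^sup>2 * t\<^sup>2 / 2))))"
      by (intro lim_imp_Liminf[symmetric]) auto
  qed
  also have "\<dots> \<le> liminf (\<lambda>n. \<integral>\<^sup>+ t. ennreal ((cmod (osc f F t))\<^sup>2 * exp (- ((?e n)\<^sup>2 * t\<^sup>2 / 2))) \<partial>lborel)"
    by (intro nn_integral_liminf) measurable
  also have "\<dots> \<le> ennreal (2 * pi) * ?D"
    by (intro Liminf_le always_eventually allI bound) auto
  finally show ?thesis .
qed

section \<open>The lower half of the one-dimensional Plancherel identity\<close>

text \<open>
  Substituting \<open>r = y - \<epsilon> z\<close> exhibits the convolution as an average of \<open>v(y - \<epsilon> z)\<close> over a standard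
  normal variable \<open>z\<close>, so continuity of \<open>v\<close> at the single point \<open>y\<close> gives the limit.
\<close>

lemma gaussian_mollifier:
  fixes v :: "real \<Rightarrow> complex"
  assumes v: "continuous_on UNIV v" and C: "\<And>y. cmod (v y) \<le> C"
  shows "(\<lambda>n. LINT r|lborel. v r * of_real (normal_density 0 (1 / real (Suc n)) (y - r))) \<longlonglongrightarrow> v y"
    and "cmod (LINT r|lborel. v r * of_real (normal_density 0 (1 / real (Suc n)) (y - r))) \<le> C"
proof -
  have [measurable]: "v \<in> borel_measurable borel"
    using v by (rule borel_measurable_continuous_onI)
  have eq: "(LINT r|lborel. v r * of_real (normal_density 0 \<epsilon> (y - r)))
     = (LINT z|lborel. std_normal_density z *\<^sub>R v (y - \<epsilon> * z))" if e: "\<epsilon> > 0" for \<epsilon>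
  proof -
    have "(LINT r|lborel. v r * of_real (normal_density 0 \<epsilon> (y - r)))
       = \<epsilon> *\<^sub>R (LINT z|lborel. v (y + (-\<epsilon>) * z) * of_real (normal_density 0 \<epsilon> (y - (y + (-\<epsilon>) * z))))"
      using e lborel_integral_real_affine[of "-\<epsilon>" "\<lambda>r. v r * of_real (normal_density 0 \<epsilon> (y - r))" y] by simp
    also have "\<dots> = (LINT z|lborel. \<epsilon> *\<^sub>R (v (y + (-\<epsilon>) * z) * of_real (normal_density 0 \<epsilon> (y - (y + (-\<epsilon>) * z)))))"
      by simp
    also have "\<dots> = (LINT z|lborel. std_normal_density z *\<^sub>R v (y - \<epsilon> * z))"
    proof (intro Bochner_Integration.integral_cong refl)
      fix z
      have "\<epsilon> * normal_density 0 \<epsilon> (\<epsilon> * z) = std_normal_density z"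
        using e by (simp add: normal_density_def std_normal_density_def power_mult_distrib real_sqrt_mult)
      then show "\<epsilon> *\<^sub>R (v (y + (-\<epsilon>) * z) * of_real (normal_density 0 \<epsilon> (y - (y + (-\<epsilon>) * z))))
        = std_normal_density z *\<^sub>R v (y - \<epsilon> * z)"
        by (simp add: scaleR_conv_of_real mult_ac flip: of_real_mult)
    qed
    finally show ?thesis .
  qed
  have C0: "0 \<le> C" using C[of 0] norm_ge_zero order_trans by blast
  have dom: "integrable lborel (\<lambda>z. C * std_normal_density z)"
    by (intro integrable_mult_right) simp
  have le: "cmod (std_normal_density z *\<^sub>R v x) \<le> C * std_normal_density z" for z x
    using mult_right_mono[OF C[of x], of "std_normal_density z"] by (simp add: mult_ac)
  have int1: "(LINT z|lborel. std_normal_density z) = 1"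
    using integral_normal_density[of 1 0] by simp
  have e: "(\<lambda>n. 1 / real (Suc n)) \<longlonglongrightarrow> 0"
    using LIMSEQ_inverse_real_of_nat by (simp add: inverse_eq_divide)
  have "(\<lambda>n. LINT z|lborel. std_normal_density z *\<^sub>R v (y - 1 / real (Suc n) * z))
      \<longlonglongrightarrow> (LINT z|lborel. std_normal_density z *\<^sub>R v y)"
  proof (rule integral_dominated_convergence[OF _ _ dom])
    show "AE z in lborel. (\<lambda>n. std_normal_density z *\<^sub>R v (y - 1 / real (Suc n) * z)) \<longlonglongrightarrow> std_normal_density z *\<^sub>R v y"
    proof (intro AE_I2 tendsto_scaleR tendsto_const)
      fix z
      have "(\<lambda>n. y - 1 / real (Suc n) * z) \<longlonglongrightarrow> y - 0 * z"
        by (intro tendsto_intros e)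
      then show "(\<lambda>n. v (y - 1 / real (Suc n) * z)) \<longlonglongrightarrow> v y"
        using v by (intro isCont_tendsto_compose[of y v]) (auto simp: continuous_on_eq_continuous_at)
    qed
  qed (use le in auto)
  then show "(\<lambda>n. LINT r|lborel. v r * of_real (normal_density 0 (1 / real (Suc n)) (y - r))) \<longlonglongrightarrow> v y"
    by (simp add: eq int1)
  have "cmod (LINT z|lborel. std_normal_density z *\<^sub>R v (y - 1 / real (Suc n) * z)) \<le> (LINT z|lborel. C * std_normal_density z)"
    using le C0 by (intro Bochner_Integration.integral_norm_bound_integral dom Bochner_Integration.integrable_bound[OF dom])
      (auto simp: abs_mult)
  then show "cmod (LINT r|lborel. v r * of_real (normal_density 0 (1 / real (Suc n)) (y - r))) \<le> C"
    by (simp add: eq int1)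
qed

text \<open>
  Integrating \<open>cnj v\<close> against the image measure of \<open>F\<close> amounts to pairing the Fourier transforms.
  The Cauchy-Schwarz inequality bounds the regularised pairing by the \<open>L\<^sup>2\<close> norms of the transforms, and
  the transform of \<open>v\<close> is controlled by the upper bound for the phase \<open>y \<mapsto> y\<close>. Since
  the mollified \<open>v\<close> converges at every point, the limit may be taken even if the image measure is
  singular.
\<close>

lemma osc_test_function:
  fixes v :: "real \<Rightarrow> complex"
  assumes F: "integrable lborel F" and [measurable]: "f \<in> borel_measurable borel"
    and v: "continuous_on UNIV v" and C: "\<And>y. cmod (v y) \<le> C" and v0: "\<And>y. R < \<bar>y\<bar> \<Longrightarrow> v y = 0"
    and N: "(\<integral>\<^sup>+ t. ennreal ((cmod (osc f F t))\<^sup>2) \<partial>lborel) \<le> ennreal N" "0 \<le> N"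
  shows "2 * pi * (cmod (LINT s|lborel. F s * cnj (v (f s))))\<^sup>2 \<le> N * (LINT y|lborel. (cmod (v y))\<^sup>2)"
proof -
  have [measurable]: "v \<in> borel_measurable borel" "F \<in> borel_measurable borel"
    using v F by (auto intro: borel_measurable_continuous_onI)
  have C0: "0 \<le> C" using C[of 0] norm_ge_zero order_trans by blast
  have dom: "integrable lborel (\<lambda>y. c * indicator {-R..R} y :: real)" for c
    by (intro integrable_mult_right integrable_real_indicator) (auto simp: emeasure_lborel_Icc_eq)
  have vi: "integrable lborel v"
    by (rule Bochner_Integration.integrable_bound[OF dom[of C]])
       (use C v0 C0 in \<open>auto simp: indicator_def abs_if not_le\<close>)
  have v2i: "integrable lborel (\<lambda>y. (cmod (v y))\<^sup>2)"
  proof (rule Bochner_Integration.integrable_bound[OF dom[of "C\<^sup>2"]])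
    have "(cmod (v y))\<^sup>2 \<le> C\<^sup>2 * indicator {-R..R} y" for y
      using power_mono[OF C[of y], of 2] v0[of y] by (auto simp: indicator_def abs_if not_le)
    then show "AE y in lborel. norm ((cmod (v y))\<^sup>2) \<le> norm (C\<^sup>2 * indicator {-R..R} y :: real)"
      by (auto intro: order_trans)
  qed measurable
  let ?V = "LINT y|lborel. (cmod (v y))\<^sup>2"
  have upper: "(\<integral>\<^sup>+ t. ennreal ((cmod (osc (\<lambda>y. y) v t))\<^sup>2) \<partial>lborel) \<le> ennreal (2 * pi * ?V)"
  proof -
    have "(\<integral>\<^sup>+ t. ennreal ((cmod (osc (\<lambda>y. y) v t))\<^sup>2) \<partial>lborel)
       \<le> ennreal (2 * pi) * (\<integral>\<^sup>+ s. ennreal ((cmod (v s))\<^sup>2) / ennreal \<bar>1\<bar> \<partial>lborel)"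
      by (rule osc_L2_upper[OF vi closed_UNIV]) (auto intro: derivative_intros)
    also have "(\<integral>\<^sup>+ s. ennreal ((cmod (v s))\<^sup>2) / ennreal \<bar>1\<bar> \<partial>lborel) = ennreal ?V"
      using divide_ennreal[of _ 1] by (simp add: nn_integral_eq_integral[OF v2i])
    finally show ?thesis by (simp add: ennreal_mult)
  qed
  let ?I = "\<lambda>\<epsilon> s. LINT r|lborel. cnj (v r) * of_real (normal_density 0 \<epsilon> (f s - r))"
  have bound: "2 * pi * (cmod (LINT s|lborel. F s * ?I \<epsilon> s))\<^sup>2 \<le> N * ?V" if e: "\<epsilon> > 0" for \<epsilon>
  proof -
    let ?w = "\<lambda>t::real. exp (- (\<epsilon>\<^sup>2 * t\<^sup>2 / 2))"
    have "ennreal (2 * pi * cmod (LINT s|lborel. F s * ?I \<epsilon> s))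
       = ennreal (cmod (LINT t|lborel. osc f F t * cnj (osc (\<lambda>y. y) v t) * of_real (?w t)))"
      using e by (subst gaussian_pairing[OF F vi]) (auto simp: norm_mult)
    also have "\<dots> \<le> (\<integral>\<^sup>+ t. ennreal (cmod (osc f F t)) * ennreal (cmod (osc (\<lambda>y. y) v t)) \<partial>lborel)"
    proof (rule order_trans[OF norm_integral_le_nn_integral nn_integral_mono])
      fix t
      have "cmod (osc f F t) * cmod (osc (\<lambda>y. y) v t) * ?w t \<le> cmod (osc f F t) * cmod (osc (\<lambda>y. y) v t)"
        by (intro mult_left_le) auto
      then show "ennreal (cmod (osc f F t * cnj (osc (\<lambda>y. y) v t) * of_real (?w t)))
        \<le> ennreal (cmod (osc f F t)) * ennreal (cmod (osc (\<lambda>y. y) v t))"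
        by (simp add: norm_mult flip: ennreal_mult)
    qed
    finally have "(ennreal (2 * pi * cmod (LINT s|lborel. F s * ?I \<epsilon> s)))\<^sup>2
       \<le> (\<integral>\<^sup>+ t. ennreal (cmod (osc f F t)) * ennreal (cmod (osc (\<lambda>y. y) v t)) \<partial>lborel)\<^sup>2"
      by (rule power_mono) simp
    also have "\<dots> \<le> (\<integral>\<^sup>+ t. (ennreal (cmod (osc f F t)))\<^sup>2 \<partial>lborel) * (\<integral>\<^sup>+ t. (ennreal (cmod (osc (\<lambda>y. y) v t)))\<^sup>2 \<partial>lborel)"
      by (rule Cauchy_Schwarz_nn_integral) measurable
    also have "\<dots> \<le> ennreal N * ennreal (2 * pi * ?V)"
      using N upper by (intro mult_mono) (auto simp: ennreal_power)
    finally have "(2 * pi * cmod (LINT s|lborel. F s * ?I \<epsilon> s))\<^sup>2 \<le> N * (2 * pi * ?V)"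
      using N by (simp add: ennreal_power flip: ennreal_mult)
    then have "(2 * pi) * (2 * pi * (cmod (LINT s|lborel. F s * ?I \<epsilon> s))\<^sup>2) \<le> (2 * pi) * (N * ?V)"
      by (simp add: power_mult_distrib power2_eq_square mult_ac)
    then show ?thesis
      by (rule mult_left_le_imp_le) simp
  qed
  have "(\<lambda>n. LINT s|lborel. F s * ?I (1 / real (Suc n)) s) \<longlonglongrightarrow> (LINT s|lborel. F s * cnj (v (f s)))"
  proof (rule integral_dominated_convergence)
    have cv: "continuous_on UNIV (\<lambda>y. cnj (v y))"
      by (intro continuous_intros v)
    show "integrable lborel (\<lambda>s. C * cmod (F s))"
      using F by auto
    show "AE s in lborel. (\<lambda>n. F s * ?I (1 / real (Suc n)) s) \<longlonglongrightarrow> F s * cnj (v (f s))"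
      using C by (intro AE_I2 tendsto_mult tendsto_const gaussian_mollifier(1)[OF cv]) auto
    show "AE s in lborel. cmod (F s * ?I (1 / real (Suc n)) s) \<le> C * cmod (F s)" for n
    proof (intro AE_I2)
      fix s
      have "cmod (?I (1 / real (Suc n)) s) \<le> C"
        using C by (intro gaussian_mollifier(2)[OF cv]) auto
      from mult_right_mono[OF this, of "cmod (F s)"]
      show "cmod (F s * ?I (1 / real (Suc n)) s) \<le> C * cmod (F s)"
        by (simp add: norm_mult mult_ac)
    qed
  qed measurable
  then have "(\<lambda>n. 2 * pi * (cmod (LINT s|lborel. F s * ?I (1 / real (Suc n)) s))\<^sup>2)
     \<longlonglongrightarrow> 2 * pi * (cmod (LINT s|lborel. F s * cnj (v (f s))))\<^sup>2"
    by (intro tendsto_intros)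
  then show ?thesis
    by (rule LIMSEQ_le_const2) (intro exI[of _ 0] allI impI bound, simp)
qed

text \<open>
  On a compact \<open>B\<close> the injection \<open>f\<close> is a homeomorphism onto its image \<open>K\<close>, so \<open>H\<close> has the form \<open>h \<circ> f\<close>
  with \<open>h\<close> continuous on \<open>K\<close>. Extend \<open>h\<close> by Tietze's theorem, cut it off by tent functions shrinking
  to the indicator of \<open>K\<close>, and apply \<open>osc_test_function\<close>. In the limit only \<open>K\<close> is left, and the
  change of variables rewrites the \<open>L\<^sup>2\<close> norm of \<open>h\<close> on \<open>K\<close> as the weighted norm of \<open>H\<close> on \<open>B\<close>.
\<close>

lemma osc_duality_continuous:
  fixes f f' :: "real \<Rightarrow> real" and H :: "real \<Rightarrow> complex"
  assumes F: "integrable lborel F" and F0: "AE s in lborel. s \<notin> S \<longrightarrow> F s = 0"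
    and der: "\<And>s. (f has_real_derivative f' s) (at s)" and f': "continuous_on UNIV f'"
    and inj: "inj_on f S" and B: "compact B" "B \<subseteq> S" and H: "continuous_on B H"
    and N: "(\<integral>\<^sup>+ t. ennreal ((cmod (osc f F t))\<^sup>2) \<partial>lborel) \<le> ennreal N" "0 \<le> N"
  shows "2 * pi * (cmod (LINT s|lborel. indicator B s *\<^sub>R (F s * cnj (H s))))\<^sup>2
      \<le> N * (LINT s|lborel. indicator B s * (\<bar>f' s\<bar> * (cmod (H s))\<^sup>2))"
proof (cases "B = {}")
  case True
  then show ?thesis by simp
next
  case ne: False
  have fc: "continuous_on T f" for T
    using der by (intro continuous_at_imp_continuous_on) (auto intro: DERIV_isCont)
  have [measurable]: "F \<in> borel_measurable borel" "f' \<in> borel_measurable borel" "B \<in> sets borel"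
    "f \<in> borel_measurable borel"
    using F f' B fc[of UNIV] by (auto intro: borel_measurable_continuous_onI borel_compact)
  have injB: "inj_on f B"
    using inj B(2) by (rule inj_on_subset)
  define K where "K = f ` B"
  have K: "compact K" "K \<noteq> {}"
    unfolding K_def using B ne by (auto intro: compact_continuous_image fc)
  have Kc: "closed K" using K by (simp add: compact_imp_closed)
  have [measurable]: "K \<in> sets borel" using Kc by auto
  have "continuous_on K (the_inv_into B f)"
    unfolding K_def using B by (intro continuous_on_inv fc) (auto simp: the_inv_into_f_f[OF injB])
  then have "continuous_on K (H \<circ> the_inv_into B f)"
    by (rule continuous_on_compose) (use H in \<open>simp add: K_def the_inv_into_onto[OF injB]\<close>)
  then have cont: "continuous_on K (H \<circ> the_inv_into B f)" .
  obtain C where C: "C \<ge> 0" "\<And>s. s \<in> B \<Longrightarrow> cmod (H s) \<le> C"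
  proof -
    have "bounded (H ` B)"
      using H B by (intro compact_imp_bounded compact_continuous_image)
    then obtain C where "C > 0" "\<forall>x\<in>H ` B. norm x \<le> C"
      unfolding bounded_pos by blast
    then show ?thesis using that[of C] by auto
  qed
  obtain h where h: "continuous_on UNIV h" "\<And>y. y \<in> K \<Longrightarrow> h y = (H \<circ> the_inv_into B f) y"
      and hC: "\<And>y. cmod (h y) \<le> C"
  proof -
    have "norm ((H \<circ> the_inv_into B f) y) \<le> C" if "y \<in> K" for y
      using that C(2) by (auto simp: K_def the_inv_into_f_f[OF injB])
    moreover have "closedin (top_of_set UNIV) K"
      using Kc by simp
    ultimately show ?thesis
      using Tietze[OF cont _ C(1)] that by (metis UNIV_I)
  qed
  have hf: "h (f s) = H s" if "s \<in> B" for s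
    using that h(2)[of "f s"] by (simp add: K_def the_inv_into_f_f[OF injB])
  have [measurable]: "h \<in> borel_measurable borel"
    using h by (intro borel_measurable_continuous_onI)
  obtain R where R: "\<And>y. y \<in> K \<Longrightarrow> \<bar>y\<bar> \<le> R"
    using compact_imp_bounded[OF K(1)] by (auto simp: bounded_iff)
  define u where "u n y = max 0 (1 - real (Suc n) * infdist y K)" for n y
  have u01: "0 \<le> u n y" "u n y \<le> 1" for n y
    by (auto simp: u_def infdist_nonneg)
  have uc: "continuous_on UNIV (u n)" for n
    unfolding u_def by (intro continuous_intros)
  have [measurable]: "u n \<in> borel_measurable borel" for n
    using uc by (rule borel_measurable_continuous_onI)
  have uK: "u n y = 1" if "y \<in> K" for n y
    using that by (simp add: u_def)
  have u0: "u n y = 0" if "R + 1 < \<bar>y\<bar>" for n y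
  proof -
    obtain z where z: "z \<in> K" "infdist y K = dist y z"
      using infdist_attains_inf[OF Kc K(2)] by blast
    have "1 \<le> infdist y K"
      using R[OF z(1)] that unfolding z(2) by (auto simp: dist_real_def)
    then have "1 * 1 \<le> real (Suc n) * infdist y K"
      by (intro mult_mono) auto
    then show ?thesis by (simp add: u_def)
  qed
  have ulim: "(\<lambda>n. u n y) \<longlonglongrightarrow> indicator K y" for y
  proof (cases "y \<in> K")
    case True
    then show ?thesis by (simp add: uK)
  next
    case False
    then have d: "infdist y K > 0"
      using in_closed_iff_infdist_zero[OF Kc K(2)] infdist_nonneg[of y K] by (metis less_eq_real_def)
    obtain m :: nat where m: "1 < real m * infdist y K"
      using reals_Archimedean3[OF d] by blast
    have "u n y = 0" if "m \<le> n" for n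
    proof -
      have "real m * infdist y K \<le> real (Suc n) * infdist y K"
        using that d by (intro mult_right_mono) auto
      then show ?thesis using m by (simp add: u_def)
    qed
    then have "(\<lambda>n. u n y) \<longlonglongrightarrow> 0"
      by (intro tendsto_eventually eventually_sequentiallyI[of m])
    then show ?thesis using False by simp
  qed
  define v where "v n y = u n y *\<^sub>R h y" for n y
  have vC: "cmod (v n y) \<le> C" for n y
    using mult_mono[OF u01(2)[of n y] hC[of y]] u01[of n y] C by (simp add: v_def)
  have bound: "2 * pi * (cmod (LINT s|lborel. F s * cnj (v n (f s))))\<^sup>2 \<le> N * (LINT y|lborel. (cmod (v n y))\<^sup>2)" for n
    by (rule osc_test_function[OF F _ _ vC _ N, where R = "R + 1"])
       (auto simp: v_def u0 intro!: continuous_intros uc h(1))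
  have [measurable]: "v n \<in> borel_measurable borel" for n
    unfolding v_def by measurable
  have "(\<lambda>n. LINT s|lborel. F s * cnj (v n (f s))) \<longlonglongrightarrow> (LINT s|lborel. F s * cnj (indicator K (f s) *\<^sub>R h (f s)))"
  proof (rule integral_dominated_convergence)
    show "integrable lborel (\<lambda>s. C * cmod (F s))"
      using F by auto
    show "AE s in lborel. (\<lambda>n. F s * cnj (v n (f s))) \<longlonglongrightarrow> F s * cnj (indicator K (f s) *\<^sub>R h (f s))"
      unfolding v_def by (intro AE_I2 tendsto_intros ulim)
    show "AE s in lborel. cmod (F s * cnj (v n (f s))) \<le> C * cmod (F s)" for n
      using vC by (intro AE_I2) (simp add: norm_mult mult.commute[of C] mult_left_mono)
  qed measurable
  also have "(LINT s|lborel. F s * cnj (indicator K (f s) *\<^sub>R h (f s))) = (LINT s|lborel. indicator B s *\<^sub>R (F s * cnj (H s)))"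
  proof (rule integral_cong_AE)
    show "AE s in lborel. F s * cnj (indicator K (f s) *\<^sub>R h (f s)) = indicator B s *\<^sub>R (F s * cnj (H s))"
      using F0
    proof eventually_elim
      case (elim s)
      \<comment> \<open>Injectivity on all of \<open>S\<close> excludes points outside \<open>B\<close> with the same image; off \<open>S\<close>
        the factor \<open>F\<close> vanishes.\<close>
      have "f s \<in> K \<longleftrightarrow> s \<in> B" if "s \<in> S"
        unfolding K_def using that inj B by (auto dest: inj_onD)
      then show ?case using elim hf[of s] B by (auto simp: indicator_def)
    qed
  next
    have "(\<lambda>s. indicator B s *\<^sub>R (F s * cnj (h (f s)))) \<in> borel_measurable lborel"
      by measurable
    moreover have "(\<lambda>s. indicator B s *\<^sub>R (F s * cnj (h (f s)))) = (\<lambda>s. indicator B s *\<^sub>R (F s * cnj (H s)))"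
      using hf by (auto simp: fun_eq_iff indicator_def)
    ultimately show "(\<lambda>s. indicator B s *\<^sub>R (F s * cnj (H s))) \<in> borel_measurable lborel"
      by simp
  qed measurable
  finally have lim1: "(\<lambda>n. LINT s|lborel. F s * cnj (v n (f s))) \<longlonglongrightarrow> (LINT s|lborel. indicator B s *\<^sub>R (F s * cnj (H s)))" .
  have dom: "integrable lborel (\<lambda>y. C\<^sup>2 * indicator {-(R+1)..R+1} y :: real)"
    by (intro integrable_mult_right integrable_real_indicator) (auto simp: emeasure_lborel_Icc_eq)
  have v2: "(cmod (v n y))\<^sup>2 \<le> C\<^sup>2 * indicator {-(R+1)..R+1} y" for n y
  proof (cases "R + 1 < \<bar>y\<bar>")
    case True
    then show ?thesis by (simp add: v_def u0)
  next
    case False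
    then have "y \<in> {-(R+1)..R+1}" by auto
    then show ?thesis using power_mono[OF vC[of n y], of 2] by simp
  qed
  have "(\<lambda>n. LINT y|lborel. (cmod (v n y))\<^sup>2) \<longlonglongrightarrow> (LINT y|lborel. (cmod (indicator K y *\<^sub>R h y))\<^sup>2)"
  proof (rule integral_dominated_convergence[OF _ _ dom])
    show "AE y in lborel. (\<lambda>n. (cmod (v n y))\<^sup>2) \<longlonglongrightarrow> (cmod (indicator K y *\<^sub>R h y))\<^sup>2"
      unfolding v_def by (intro AE_I2 tendsto_intros ulim)
  qed (use v2 in auto)
  also have "(LINT y|lborel. (cmod (indicator K y *\<^sub>R h y))\<^sup>2) = (LINT s|lborel. indicator B s * (\<bar>f' s\<bar> * (cmod (H s))\<^sup>2))"
  proof -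
    have q: "integrable lborel (\<lambda>y. (cmod (v 0 y))\<^sup>2)"
      by (rule Bochner_Integration.integrable_bound[OF dom]) (use v2 in \<open>auto intro: order_trans\<close>)
    have "(LINT y|lborel. (cmod (indicator K y *\<^sub>R h y))\<^sup>2) = enn2real (\<integral>\<^sup>+ y. ennreal ((cmod (v 0 y))\<^sup>2) * indicator K y \<partial>lborel)"
      by (subst integral_eq_nn_integral)
         (auto simp: v_def uK indicator_def intro!: arg_cong[where f = enn2real] nn_integral_cong)
    also have "\<dots> = enn2real (\<integral>\<^sup>+ s. ennreal (\<bar>f' s\<bar> * (cmod (v 0 (f s)))\<^sup>2) * indicator B s \<partial>lborel)"
      using nn_integral_change_of_variables[OF compact_imp_closed[OF B(1)] der injB q] by (simp add: K_def)
    also have "\<dots> = (LINT s|lborel. indicator B s * (\<bar>f' s\<bar> * (cmod (v 0 (f s)))\<^sup>2))"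
      by (subst integral_eq_nn_integral)
         (auto simp: indicator_def intro!: arg_cong[where f = enn2real] nn_integral_cong)
    also have "\<dots> = (LINT s|lborel. indicator B s * (\<bar>f' s\<bar> * (cmod (H s))\<^sup>2))"
      using hf uK by (intro Bochner_Integration.integral_cong refl) (auto simp: indicator_def v_def K_def)
    finally show ?thesis .
  qed
  finally have lim2: "(\<lambda>n. LINT y|lborel. (cmod (v n y))\<^sup>2) \<longlonglongrightarrow> (LINT s|lborel. indicator B s * (\<bar>f' s\<bar> * (cmod (H s))\<^sup>2))" .
  show ?thesis
    by (rule LIMSEQ_le[OF tendsto_mult[OF tendsto_const tendsto_power[OF tendsto_norm[OF lim1]]]
          tendsto_mult[OF tendsto_const lim2]]) (use bound in auto)
qed

text \<open>
  A bounded measurable function is an almost everywhere limit of uniformly bounded continuous functions,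
  and both sides of the inequality in \<open>osc_duality_continuous\<close> pass to such limits because only Lebesgue
  measure in \<open>s\<close> is involved.
\<close>

lemma osc_duality:
  fixes f f' :: "real \<Rightarrow> real" and H :: "real \<Rightarrow> complex"
  assumes F: "integrable lborel F" and F0: "AE s in lborel. s \<notin> S \<longrightarrow> F s = 0"
    and der: "\<And>s. (f has_real_derivative f' s) (at s)" and f': "continuous_on UNIV f'"
    and inj: "inj_on f S" and B: "compact B" "B \<subseteq> S"
    and H [measurable]: "H \<in> borel_measurable borel" and C: "\<And>s. cmod (H s) \<le> C"
    and N: "(\<integral>\<^sup>+ t. ennreal ((cmod (osc f F t))\<^sup>2) \<partial>lborel) \<le> ennreal N" "0 \<le> N"
  shows "2 * pi * (cmod (LINT s|lborel. indicator B s *\<^sub>R (F s * cnj (H s))))\<^sup>2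
      \<le> N * (LINT s|lborel. indicator B s * (\<bar>f' s\<bar> * (cmod (H s))\<^sup>2))"
proof -
  have [measurable]: "F \<in> borel_measurable borel" "f' \<in> borel_measurable borel" "B \<in> sets borel"
    using F f' B by (auto intro: borel_measurable_continuous_onI borel_compact)
  define M where "M = max C 1"
  have M: "M > 0" "\<And>s. cmod (H s) \<le> M"
    using C by (auto simp: M_def intro: order_trans[OF C max.cobounded1])
  have "H measurable_on UNIV"
    by (intro lebesgue_measurable_imp_measurable_on measurable_completion) auto
  then obtain Z g where Z: "negligible Z" and g: "\<And>n. continuous_on UNIV (g n)"
    and gH: "\<And>x. x \<notin> Z \<Longrightarrow> (\<lambda>n. g n x) \<longlonglongrightarrow> H x"
    unfolding measurable_on_def by auto
  \<comment> \<open>Clipping at radius \<open>M\<close> makes the approximating functions uniformly bounded without affecting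
    their limit.\<close>
  define clip where "clip z = (1 / max 1 (cmod z / M)) *\<^sub>R z" for z :: complex
  have clipc: "continuous_on UNIV clip"
    unfolding clip_def using M(1) by (intro continuous_intros) (auto simp: max_def)
  have clipM: "cmod (clip z) \<le> M" for z
  proof -
    have "cmod z \<le> M * max 1 (cmod z / M)"
      using M by (auto simp: max_def field_simps)
    then show ?thesis
      using M(1) by (simp add: clip_def field_simps)
  qed
  have clipH: "clip (H s) = H s" for s
    using M(1) M(2)[of s] by (auto simp: clip_def max_def field_simps)
  define G where "G n s = clip (g n s)" for n s
  have Gc: "continuous_on UNIV (G n)" for n
    unfolding G_def using continuous_on_compose2[OF clipc g] by simp
  have [measurable]: "G n \<in> borel_measurable borel" for n
    using Gc by (rule borel_measurable_continuous_onI)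
  have GM: "cmod (G n s) \<le> M" for n s by (simp add: G_def clipM)
  have GH: "AE s in lborel. (\<lambda>n. G n s) \<longlonglongrightarrow> H s"
  proof -
    have "AE s in lebesgue. s \<notin> Z"
      using Z by (simp add: negligible_iff_null_sets AE_not_in)
    then have "AE s in lebesgue. (\<lambda>n. G n s) \<longlonglongrightarrow> H s"
    proof eventually_elim
      case (elim s)
      have "(\<lambda>n. clip (g n s)) \<longlonglongrightarrow> clip (H s)"
        using clipc by (intro isCont_tendsto_compose[OF _ gH[OF elim]]) (auto simp: continuous_on_eq_continuous_at)
      then show ?case by (simp add: G_def clipH)
    qed
    then show ?thesis by (simp add: AE_completion_iff)
  qed
  have lim1: "(\<lambda>n. LINT s|lborel. indicator B s *\<^sub>R (F s * cnj (G n s))) \<longlonglongrightarrow> (LINT s|lborel. indicator B s *\<^sub>R (F s * cnj (H s)))"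
  proof (rule integral_dominated_convergence)
    show "integrable lborel (\<lambda>s. M * cmod (F s))"
      using F by auto
    show "AE s in lborel. (\<lambda>n. indicator B s *\<^sub>R (F s * cnj (G n s))) \<longlonglongrightarrow> indicator B s *\<^sub>R (F s * cnj (H s))"
      using GH by eventually_elim (intro tendsto_intros)
    show "AE s in lborel. cmod (indicator B s *\<^sub>R (F s * cnj (G n s))) \<le> M * cmod (F s)" for n
      using GM M by (intro AE_I2) (auto simp: norm_mult mult.commute[of M] indicator_def mult_left_mono)
  qed measurable
  have f'B: "integrable lborel (\<lambda>s. indicator B s * \<bar>f' s\<bar>)"
  proof -
    have "integrable lborel (\<lambda>s. indicator B s *\<^sub>R \<bar>f' s\<bar>)"
      by (intro borel_integrable_compact B continuous_intros continuous_on_subset[OF f']) simp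
    then show ?thesis by simp
  qed
  have lim2: "(\<lambda>n. LINT s|lborel. indicator B s * (\<bar>f' s\<bar> * (cmod (G n s))\<^sup>2)) \<longlonglongrightarrow> (LINT s|lborel. indicator B s * (\<bar>f' s\<bar> * (cmod (H s))\<^sup>2))"
  proof (rule integral_dominated_convergence)
    show "integrable lborel (\<lambda>s. M\<^sup>2 * (indicator B s * \<bar>f' s\<bar>))"
      using f'B by (rule integrable_mult_right)
    show "AE s in lborel. (\<lambda>n. indicator B s * (\<bar>f' s\<bar> * (cmod (G n s))\<^sup>2)) \<longlonglongrightarrow> indicator B s * (\<bar>f' s\<bar> * (cmod (H s))\<^sup>2)"
      using GH by eventually_elim (intro tendsto_intros)
    show "AE s in lborel. norm (indicator B s * (\<bar>f' s\<bar> * (cmod (G n s))\<^sup>2)) \<le> M\<^sup>2 * (indicator B s * \<bar>f' s\<bar>)" for n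
      using power_mono[OF GM norm_ge_zero, where n = 2] by (intro AE_I2) (auto simp: abs_mult mult.commute[of "M\<^sup>2"] indicator_def mult_left_mono)
  qed measurable
  show ?thesis
  proof (rule LIMSEQ_le[OF tendsto_mult[OF tendsto_const tendsto_power[OF tendsto_norm[OF lim1]]]
          tendsto_mult[OF tendsto_const lim2]], intro exI[of _ 0] allI impI)
    fix n
    show "2 * pi * (cmod (LINT s|lborel. indicator B s *\<^sub>R (F s * cnj (G n s))))\<^sup>2
        \<le> N * (LINT s|lborel. indicator B s * (\<bar>f' s\<bar> * (cmod (G n s))\<^sup>2))"
      by (rule osc_duality_continuous[OF F F0 der f' inj B _ N]) (use Gc in \<open>auto intro: continuous_on_subset\<close>)
  qed
qed

text \<open>
  Test with the natural extremal \<open>H = F / |f'|\<close>, made bounded by truncating \<open>F\<close>, restricting to a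
  compact part of \<open>S\<close> and replacing \<open>|f'|\<close> by its maximum with a small constant. Both sides of
  \<open>osc_duality\<close> are then governed by the same number \<open>\<integral> Q\<close>, which gives \<open>2 \<pi> \<integral> Q \<le> N\<close>
  for the squared norm \<open>N\<close> of the transform. Fatou's lemma
  removes the truncations; at critical points with \<open>F \<noteq> 0\<close> the limit of the integrand is
  \<open>\<infinity>\<close>, so the estimate also shows that these form a null set if \<open>N\<close> is finite.
\<close>

lemma osc_L2_lower:
  fixes f f' :: "real \<Rightarrow> real"
  assumes F: "integrable lborel F" and S: "closed S" and F0: "AE s in lborel. s \<notin> S \<longrightarrow> F s = 0"
    and der: "\<And>s. (f has_real_derivative f' s) (at s)" and f': "continuous_on UNIV f'"
    and inj: "inj_on f S"
  shows "ennreal (2 * pi) * (\<integral>\<^sup>+ s. ennreal ((cmod (F s))\<^sup>2) / ennreal \<bar>f' s\<bar> \<partial>lborel)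
      \<le> (\<integral>\<^sup>+ t. ennreal ((cmod (osc f F t))\<^sup>2) \<partial>lborel)"
proof (cases "(\<integral>\<^sup>+ t. ennreal ((cmod (osc f F t))\<^sup>2) \<partial>lborel)")
  case top
  then show ?thesis by simp
next
  case (real N)
  have [measurable]: "F \<in> borel_measurable borel" "f' \<in> borel_measurable borel" "S \<in> sets borel"
    using F f' S by (auto intro: borel_measurable_continuous_onI)
  define B where "B M = S \<inter> {- real M..real M}" for M
  have B: "compact (B M)" "B M \<subseteq> S" for M
    unfolding B_def using S by (auto intro: closed_Int_compact)
  have [measurable]: "B M \<in> sets borel" for M
    using B by (auto intro: borel_compact)
  define a where "a M s = max \<bar>f' s\<bar> (1 / real (Suc M))" for M s
  have a0: "0 < a M s" "1 / real (Suc M) \<le> a M s" "\<bar>f' s\<bar> \<le> a M s" for M s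
    by (auto simp: a_def intro: less_le_trans[of 0 "1 / real (Suc M)"])
  have [measurable]: "a M \<in> borel_measurable borel" for M
    unfolding a_def by measurable
  define Q where "Q M s = indicator (B M) s * (if cmod (F s) \<le> real M then (cmod (F s))\<^sup>2 / a M s else 0)" for M s
  have [measurable]: "Q M \<in> borel_measurable borel" for M
    unfolding Q_def by measurable
  have Q0: "0 \<le> Q M s" for M s
    using a0(1)[of M s] by (auto simp: Q_def)
  have bound: "ennreal (2 * pi) * (\<integral>\<^sup>+ s. ennreal (Q M s) \<partial>lborel) \<le> ennreal N" for M
  proof -
    define H where "H s = (if cmod (F s) \<le> real M then F s / of_real (a M s) else 0)" for s
    have [measurable]: "H \<in> borel_measurable borel"
      unfolding H_def by measurable
    have HC: "cmod (H s) \<le> real M * real (Suc M)" for s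
    proof (cases "cmod (F s) \<le> real M")
      case True
      have "cmod (F s) * (1 / a M s) \<le> real M * real (Suc M)"
        using True a0(1,2)[of M s] by (intro mult_mono) (auto simp: field_simps)
      then show ?thesis using True a0(1)[of M s] by (simp add: H_def norm_divide)
    qed (simp add: H_def)
    have Qi: "integrable lborel (Q M)"
    proof (rule Bochner_Integration.integrable_bound)
      show "integrable lborel (\<lambda>s. real M * real (Suc M) * cmod (F s))"
        using F by (intro integrable_mult_right integrable_norm)
      have "Q M s \<le> real M * real (Suc M) * cmod (F s)" for s
        using mult_right_mono[OF HC[of s], of "cmod (F s)"] a0(1)[of M s]
        by (auto simp: Q_def H_def norm_divide power2_eq_square indicator_def)
      then show "AE s in lborel. norm (Q M s) \<le> norm (real M * real (Suc M) * cmod (F s))"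
        by (intro AE_I2) (use Q0 in auto)
    qed measurable
    have "(LINT s|lborel. indicator (B M) s *\<^sub>R (F s * cnj (H s))) = (LINT s|lborel. complex_of_real (Q M s))"
      by (intro Bochner_Integration.integral_cong refl)
         (auto simp: Q_def H_def indicator_def complex_norm_square simp del: of_real_power)
    also have "\<dots> = of_real (LINT s|lborel. Q M s)"
      by simp
    finally have e1: "(LINT s|lborel. indicator (B M) s *\<^sub>R (F s * cnj (H s))) = of_real (LINT s|lborel. Q M s)" .
    have "(LINT s|lborel. indicator (B M) s * (\<bar>f' s\<bar> * (cmod (H s))\<^sup>2)) \<le> (LINT s|lborel. Q M s)"
    proof (rule integral_mono')
      fix s
      have "\<bar>f' s\<bar> * (cmod (F s) / a M s)\<^sup>2 \<le> a M s * (cmod (F s) / a M s)\<^sup>2"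
        using a0(3) by (intro mult_right_mono) auto
      also have "\<dots> = (cmod (F s))\<^sup>2 / a M s"
        using a0(1)[of M s] by (simp add: power2_eq_square)
      finally show "indicator (B M) s * (\<bar>f' s\<bar> * (cmod (H s))\<^sup>2) \<le> Q M s"
        using a0(1)[of M s] by (auto simp: Q_def H_def indicator_def norm_divide)
    qed (use Qi Q0 in auto)
    then have "N * (LINT s|lborel. indicator (B M) s * (\<bar>f' s\<bar> * (cmod (H s))\<^sup>2)) \<le> N * (LINT s|lborel. Q M s)"
      using real by (intro mult_left_mono) auto
    moreover have "2 * pi * (LINT s|lborel. Q M s)\<^sup>2
        \<le> N * (LINT s|lborel. indicator (B M) s * (\<bar>f' s\<bar> * (cmod (H s))\<^sup>2))"
    proof -
      have "2 * pi * (cmod (LINT s|lborel. indicator (B M) s *\<^sub>R (F s * cnj (H s))))\<^sup>2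
        \<le> N * (LINT s|lborel. indicator (B M) s * (\<bar>f' s\<bar> * (cmod (H s))\<^sup>2))"
        by (rule osc_duality[OF F F0 der f' inj B _ HC]) (use real in auto)
      then show ?thesis unfolding e1 by simp
    qed
    ultimately have "(2 * pi * (LINT s|lborel. Q M s)) * (LINT s|lborel. Q M s) \<le> N * (LINT s|lborel. Q M s)"
      by (simp add: power2_eq_square mult.assoc)
    moreover have "0 \<le> (LINT s|lborel. Q M s)"
      using Q0 by simp
    ultimately have "2 * pi * (LINT s|lborel. Q M s) \<le> N"
      using real by (cases "(LINT s|lborel. Q M s) = 0") (auto simp: mult_le_cancel_right)
    then show ?thesis
      using Q0 by (simp add: nn_integral_eq_integral[OF Qi] ennreal_leI flip: ennreal_mult)
  qed
  have "(\<integral>\<^sup>+ s. ennreal ((cmod (F s))\<^sup>2) / ennreal \<bar>f' s\<bar> \<partial>lborel) = (\<integral>\<^sup>+ s. liminf (\<lambda>M. ennreal (Q M s)) \<partial>lborel)"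
  proof (rule nn_integral_cong_AE, use F0 in eventually_elim)
    fix s assume s: "s \<notin> S \<longrightarrow> F s = 0"
    have "(\<lambda>M. ennreal (Q M s)) \<longlonglongrightarrow> ennreal ((cmod (F s))\<^sup>2) / ennreal \<bar>f' s\<bar>"
    proof (cases "F s = 0")
      case True
      then show ?thesis by (simp add: Q_def)
    next
      case False
      obtain m where m: "max \<bar>s\<bar> (cmod (F s)) \<le> real m"
        using real_arch_simple by blast
      have "(\<lambda>M. max \<bar>f' s\<bar> (1 / real (Suc M))) \<longlonglongrightarrow> max \<bar>f' s\<bar> 0"
        using LIMSEQ_inverse_real_of_nat by (intro tendsto_intros) (simp add: inverse_eq_divide)
      then have "(\<lambda>M. ennreal (a M s)) \<longlonglongrightarrow> ennreal \<bar>f' s\<bar>"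
        unfolding a_def by (intro tendsto_ennrealI) simp
      then have "(\<lambda>M. inverse (ennreal (a M s))) \<longlonglongrightarrow> inverse (ennreal \<bar>f' s\<bar>)"
        using continuous_on_tendsto_compose[OF continuous_on_inverse_ennreal[OF continuous_on_id[of UNIV]]] by auto
      then have "(\<lambda>M. ennreal ((cmod (F s))\<^sup>2) * inverse (ennreal (a M s))) \<longlonglongrightarrow> ennreal ((cmod (F s))\<^sup>2) * inverse (ennreal \<bar>f' s\<bar>)"
        by (intro ennreal_tendsto_cmult) auto
      moreover have "eventually (\<lambda>M. ennreal ((cmod (F s))\<^sup>2) * inverse (ennreal (a M s)) = ennreal (Q M s)) sequentially"
      proof (rule eventually_sequentiallyI[of m])
        fix M assume M: "m \<le> M"
        then have "s \<in> B M" "cmod (F s) \<le> real M"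
          using s False m by (auto simp: B_def abs_le_iff)
        then show "ennreal ((cmod (F s))\<^sup>2) * inverse (ennreal (a M s)) = ennreal (Q M s)"
          using a0(1)[of M s] by (simp add: Q_def divide_ennreal flip: divide_ennreal_def)
      qed
      ultimately show ?thesis
        unfolding divide_ennreal_def by (rule Lim_transform_eventually)
    qed
    then show "ennreal ((cmod (F s))\<^sup>2) / ennreal \<bar>f' s\<bar> = liminf (\<lambda>M. ennreal (Q M s))"
      by (intro lim_imp_Liminf[symmetric]) auto
  qed
  also have "\<dots> \<le> liminf (\<lambda>M. \<integral>\<^sup>+ s. ennreal (Q M s) \<partial>lborel)"
    by (intro nn_integral_liminf) measurable
  also have "\<dots> \<le> ennreal (N / (2 * pi))"
  proof (intro Liminf_le always_eventually allI)
    fix M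
    have "(\<integral>\<^sup>+ s. ennreal (Q M s) \<partial>lborel) = ennreal (1 / (2 * pi)) * (ennreal (2 * pi) * (\<integral>\<^sup>+ s. ennreal (Q M s) \<partial>lborel))"
      by (simp add: mult.assoc[symmetric] flip: ennreal_mult)
    also have "\<dots> \<le> ennreal (1 / (2 * pi)) * ennreal N"
      by (intro mult_left_mono bound) auto
    finally show "(\<integral>\<^sup>+ s. ennreal (Q M s) \<partial>lborel) \<le> ennreal (N / (2 * pi))"
      using real by (simp flip: ennreal_mult)
  qed simp
  finally have "ennreal (2 * pi) * (\<integral>\<^sup>+ s. ennreal ((cmod (F s))\<^sup>2) / ennreal \<bar>f' s\<bar> \<partial>lborel)
      \<le> ennreal (2 * pi) * ennreal (N / (2 * pi))"
    by (rule mult_left_mono) simp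
  also have "\<dots> = ennreal N"
    using real by (simp flip: ennreal_mult)
  finally show ?thesis using real by simp
qed

text \<open>
  The identity is meant in \<open>[0, \<infinity>]\<close>: the transform of \<open>F\<close> is square integrable if and only if the
  right-hand side is finite.
\<close>

theorem osc_plancherel:
  fixes f f' :: "real \<Rightarrow> real"
  assumes "integrable lborel F" and "closed S" and "AE s in lborel. s \<notin> S \<longrightarrow> F s = 0"
    and "\<And>s. (f has_real_derivative f' s) (at s)" and "continuous_on UNIV f'"
    and "inj_on f S"
  shows "(\<integral>\<^sup>+ t. ennreal ((cmod (osc f F t))\<^sup>2) \<partial>lborel)
      = ennreal (2 * pi) * (\<integral>\<^sup>+ s. ennreal ((cmod (F s))\<^sup>2) / ennreal \<bar>f' s\<bar> \<partial>lborel)"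
  using osc_L2_upper[OF assms] osc_L2_lower[OF assms] by (rule antisym)

section \<open>Adding further variables\<close>

abbreviation lborel_family :: "'i set \<Rightarrow> ('i \<Rightarrow> real) measure" where
  "lborel_family I \<equiv> \<Pi>\<^sub>M i\<in>I. lborel"

interpretation lborel_family: product_sigma_finite "\<lambda>_::'i. lborel :: real measure"
  by standard

lemma sigma_finite_lborel_family: "finite I \<Longrightarrow> sigma_finite_measure (lborel_family I)"
  by (rule lborel_family.sigma_finite)

lemma lborel_family_insert:
  assumes "finite I" "i \<notin> I"
  shows "lborel_family (insert i I)
    = distr (lborel \<Otimes>\<^sub>M lborel_family I) (lborel_family (insert i I)) (\<lambda>(s, y). y(i := s))"
proof (rule measure_eqI)
  interpret I: sigma_finite_measure "lborel_family I"
    by (rule sigma_finite_lborel_family[OF assms(1)])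
  have [measurable]: "(\<lambda>(s, y). y(i := s)) \<in> lborel \<Otimes>\<^sub>M lborel_family I \<rightarrow>\<^sub>M lborel_family (insert i I)"
    unfolding split_beta by (rule measurable_fun_upd[where J = I]) auto
  fix X assume X: "X \<in> sets (lborel_family (insert i I))"
  then have [measurable]: "X \<in> sets (lborel_family (insert i I))" .
  have "emeasure (lborel_family (insert i I)) X = (\<integral>\<^sup>+ s. \<integral>\<^sup>+ y. indicator X (y(i := s)) \<partial>lborel_family I \<partial>lborel)"
    using X by (subst lborel_family.product_nn_integral_insert_rev[OF assms, symmetric]) auto
  also have "\<dots> = (\<integral>\<^sup>+ s. \<integral>\<^sup>+ y. indicator X (case (s, y) of (s, y) \<Rightarrow> y(i := s)) \<partial>lborel_family I \<partial>lborel)"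
    by simp
  also have "\<dots> = (\<integral>\<^sup>+ p. indicator X (case p of (s, y) \<Rightarrow> y(i := s)) \<partial>(lborel \<Otimes>\<^sub>M lborel_family I))"
    by (rule I.nn_integral_fst) measurable
  also have "\<dots> = emeasure (distr (lborel \<Otimes>\<^sub>M lborel_family I) (lborel_family (insert i I)) (\<lambda>(s, y). y(i := s))) X"
    using X by (subst nn_integral_indicator[symmetric], simp, subst nn_integral_distr) auto
  finally show "emeasure (lborel_family (insert i I)) X = emeasure (distr (lborel \<Otimes>\<^sub>M lborel_family I) (lborel_family (insert i I)) (\<lambda>(s, y). y(i := s))) X" .
qed simp

text \<open>
  For fixed \<open>t\<close> the inner integral is the Fourier transform in \<open>\<eta>\<close> of the oscillatory integral in \<open>s\<close>,
  to which the assumed Plancherel identity applies. After exchanging the order of integration, the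
  integral over \<open>t\<close> is the one-dimensional identity on each line. This serves both as the induction
  step for Plancherel's theorem (phase \<open>f s \<eta> = s\<close>) and, with the actual phase, for the trace norm.
\<close>

lemma plancherel_step:
  fixes F :: "real \<Rightarrow> ('i \<Rightarrow> real) \<Rightarrow> complex" and f f' :: "real \<Rightarrow> ('i \<Rightarrow> real) \<Rightarrow> real"
  assumes I: "finite I"
    and plancherel: "\<And>G. integrable (lborel_family I) G \<Longrightarrow>
        (\<integral>\<^sup>+ y. ennreal ((cmod (LINT \<eta>|lborel_family I. cis (\<Sum>i\<in>I. y i * \<eta> i) * G \<eta>))\<^sup>2) \<partial>lborel_family I)
          = ennreal ((2 * pi) ^ card I) * (\<integral>\<^sup>+ \<eta>. ennreal ((cmod (G \<eta>))\<^sup>2) \<partial>lborel_family I)"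
    and F: "integrable (lborel \<Otimes>\<^sub>M lborel_family I) (case_prod F)"
    and f [measurable]: "case_prod f \<in> borel_measurable (lborel \<Otimes>\<^sub>M lborel_family I)"
    and f' [measurable]: "case_prod f' \<in> borel_measurable (lborel \<Otimes>\<^sub>M lborel_family I)"
    and der: "\<And>s \<eta>. ((\<lambda>s. f s \<eta>) has_real_derivative f' s \<eta>) (at s)"
    and cont: "\<And>\<eta>. continuous_on UNIV (\<lambda>s. f' s \<eta>)"
    and S: "AE \<eta> in lborel_family I. \<exists>S. closed S \<and> inj_on (\<lambda>s. f s \<eta>) S \<and> (AE s in lborel. s \<notin> S \<longrightarrow> F s \<eta> = 0)"
  shows "(\<integral>\<^sup>+ (t, y). ennreal ((cmod (LINT (s, \<eta>)|(lborel \<Otimes>\<^sub>M lborel_family I).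
              cis (t * f s \<eta>) * cis (\<Sum>i\<in>I. y i * \<eta> i) * F s \<eta>))\<^sup>2) \<partial>(lborel \<Otimes>\<^sub>M lborel_family I))
      = ennreal ((2 * pi) ^ Suc (card I))
          * (\<integral>\<^sup>+ (s, \<eta>). ennreal ((cmod (F s \<eta>))\<^sup>2) / ennreal \<bar>f' s \<eta>\<bar> \<partial>(lborel \<Otimes>\<^sub>M lborel_family I))"
proof -
  let ?P = "lborel_family I"
  interpret J: sigma_finite_measure ?P
    by (rule sigma_finite_lborel_family[OF I])
  interpret pair_sigma_finite lborel ?P
    by (intro pair_sigma_finite.intro lborel.sigma_finite_measure_axioms J.sigma_finite_measure_axioms)
  have [measurable]: "case_prod F \<in> borel_measurable (lborel \<Otimes>\<^sub>M ?P)"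
    using F by auto
  have [measurable]: "(\<lambda>\<eta>. \<Sum>i\<in>I. y i * \<eta> i) \<in> borel_measurable ?P" for y
    by (intro borel_measurable_sum borel_measurable_times measurable_const) auto
  have [measurable]: "(\<lambda>p. \<Sum>i\<in>I. fst p i * snd p i) \<in> borel_measurable (?P \<Otimes>\<^sub>M ?P)"
    by (intro borel_measurable_sum borel_measurable_times) auto
  define H where "H t \<eta> = osc (\<lambda>s. f s \<eta>) (\<lambda>s. F s \<eta>) t" for t \<eta>
  have [measurable]: "case_prod H \<in> borel_measurable (lborel \<Otimes>\<^sub>M ?P)"
    unfolding H_def osc_def by measurable
  have Fosc: "integrable (lborel \<Otimes>\<^sub>M ?P) (\<lambda>(s, \<eta>). cis (t * f s \<eta>) * F s \<eta>)" for t
    by (rule Bochner_Integration.integrable_bound[OF F]) (auto simp: norm_mult split_beta)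
  have Hi: "integrable ?P (H t)" for t
    using integrable_snd[OF Fosc[of t]] by (simp add: H_def[abs_def] osc_def)
  have inner: "(LINT (s, \<eta>)|(lborel \<Otimes>\<^sub>M ?P). cis (t * f s \<eta>) * cis (\<Sum>i\<in>I. y i * \<eta> i) * F s \<eta>)
      = (LINT \<eta>|?P. cis (\<Sum>i\<in>I. y i * \<eta> i) * H t \<eta>)" for t y
  proof -
    have "integrable (lborel \<Otimes>\<^sub>M ?P) (\<lambda>(s, \<eta>). cis (t * f s \<eta>) * cis (\<Sum>i\<in>I. y i * \<eta> i) * F s \<eta>)"
      by (rule Bochner_Integration.integrable_bound[OF F]) (auto simp: norm_mult split_beta)
    from integral_snd[OF this, symmetric] show ?thesis
      by (simp add: H_def osc_def mult_ac flip: integral_mult_right_zero)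
  qed
  have "(\<integral>\<^sup>+ (t, y). ennreal ((cmod (LINT (s, \<eta>)|(lborel \<Otimes>\<^sub>M lborel_family I).
              cis (t * f s \<eta>) * cis (\<Sum>i\<in>I. y i * \<eta> i) * F s \<eta>))\<^sup>2) \<partial>(lborel \<Otimes>\<^sub>M ?P))
    = (\<integral>\<^sup>+ t. \<integral>\<^sup>+ y. ennreal ((cmod (LINT \<eta>|?P. cis (\<Sum>i\<in>I. y i * \<eta> i) * H t \<eta>))\<^sup>2) \<partial>?P \<partial>lborel)"
  proof -
    have "(\<lambda>(t, y). ennreal ((cmod (LINT \<eta>|?P. cis (\<Sum>i\<in>I. y i * \<eta> i) * H t \<eta>))\<^sup>2)) \<in> borel_measurable (lborel \<Otimes>\<^sub>M ?P)"
      unfolding case_prod_unfold by measurable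
    from J.nn_integral_fst[OF this] show ?thesis
      unfolding inner by simp
  qed
  also have "\<dots> = (\<integral>\<^sup>+ t. ennreal ((2 * pi) ^ card I) * (\<integral>\<^sup>+ \<eta>. ennreal ((cmod (H t \<eta>))\<^sup>2) \<partial>?P) \<partial>lborel)"
    by (simp add: plancherel[OF Hi])
  also have "\<dots> = ennreal ((2 * pi) ^ card I) * (\<integral>\<^sup>+ t. \<integral>\<^sup>+ \<eta>. ennreal ((cmod (H t \<eta>))\<^sup>2) \<partial>?P \<partial>lborel)"
    by (rule nn_integral_cmult) measurable
  also have "(\<integral>\<^sup>+ t. \<integral>\<^sup>+ \<eta>. ennreal ((cmod (H t \<eta>))\<^sup>2) \<partial>?P \<partial>lborel) = (\<integral>\<^sup>+ \<eta>. \<integral>\<^sup>+ t. ennreal ((cmod (H t \<eta>))\<^sup>2) \<partial>lborel \<partial>?P)"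
    by (rule Fubini'[symmetric]) measurable
  also have "\<dots> = (\<integral>\<^sup>+ \<eta>. ennreal (2 * pi) * (\<integral>\<^sup>+ s. ennreal ((cmod (F s \<eta>))\<^sup>2) / ennreal \<bar>f' s \<eta>\<bar> \<partial>lborel) \<partial>?P)"
  proof (rule nn_integral_cong_AE)
    have "AE \<eta> in ?P. integrable lborel (\<lambda>s. F s \<eta>)"
      using AE_integrable_snd[OF F] by simp
    then show "AE \<eta> in ?P. (\<integral>\<^sup>+ t. ennreal ((cmod (H t \<eta>))\<^sup>2) \<partial>lborel)
       = ennreal (2 * pi) * (\<integral>\<^sup>+ s. ennreal ((cmod (F s \<eta>))\<^sup>2) / ennreal \<bar>f' s \<eta>\<bar> \<partial>lborel)"
      using S unfolding H_def
      by eventually_elim (auto intro!: osc_plancherel der cont)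
  qed
  also have "\<dots> = ennreal (2 * pi) * (\<integral>\<^sup>+ \<eta>. \<integral>\<^sup>+ s. ennreal ((cmod (F s \<eta>))\<^sup>2) / ennreal \<bar>f' s \<eta>\<bar> \<partial>lborel \<partial>?P)"
    by (rule nn_integral_cmult) measurable
  also have "(\<integral>\<^sup>+ \<eta>. \<integral>\<^sup>+ s. ennreal ((cmod (F s \<eta>))\<^sup>2) / ennreal \<bar>f' s \<eta>\<bar> \<partial>lborel \<partial>?P)
     = (\<integral>\<^sup>+ (s, \<eta>). ennreal ((cmod (F s \<eta>))\<^sup>2) / ennreal \<bar>f' s \<eta>\<bar> \<partial>(lborel \<Otimes>\<^sub>M ?P))"
  proof -
    have "(\<lambda>(s, \<eta>). ennreal ((cmod (F s \<eta>))\<^sup>2) / ennreal \<bar>f' s \<eta>\<bar>) \<in> borel_measurable (lborel \<Otimes>\<^sub>M ?P)"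
      by measurable
    from nn_integral_snd[OF this] show ?thesis
      by simp
  qed
  finally show ?thesis
    by (simp add: ennreal_mult mult_ac)
qed

lemma plancherel_family:
  fixes G :: "('i \<Rightarrow> real) \<Rightarrow> complex"
  assumes "finite I" and "integrable (lborel_family I) G"
  shows "(\<integral>\<^sup>+ y. ennreal ((cmod (LINT \<eta>|lborel_family I. cis (\<Sum>i\<in>I. y i * \<eta> i) * G \<eta>))\<^sup>2) \<partial>lborel_family I)
          = ennreal ((2 * pi) ^ card I) * (\<integral>\<^sup>+ \<eta>. ennreal ((cmod (G \<eta>))\<^sup>2) \<partial>lborel_family I)"
  using assms
proof (induction I arbitrary: G)
  case empty
  then show ?case
    by (simp add: PiM_empty nn_integral_count_space_finite lebesgue_integral_count_space_finite)
next
  case (insert i I)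
  let ?P = "lborel_family I" and ?u = "\<lambda>(s, y). y(i := s) :: 'i \<Rightarrow> real"
  have [measurable]: "?u \<in> lborel \<Otimes>\<^sub>M ?P \<rightarrow>\<^sub>M lborel_family (insert i I)"
    unfolding split_beta by (rule measurable_fun_upd[where J = I]) auto
  have G [measurable]: "G \<in> borel_measurable (lborel_family (insert i I))"
    using insert.prems by auto
  note ins = lborel_family_insert[OF insert.hyps(1,2)]
  have [measurable]: "(\<lambda>\<eta>. \<Sum>j\<in>insert i I. y j * \<eta> j) \<in> borel_measurable (lborel_family (insert i I))" for y
    by (intro borel_measurable_sum borel_measurable_times measurable_const) auto
  \<comment> \<open>The new variable contributes the summand \<open>t s\<close>, the phase in \<open>plancherel_step\<close>.\<close>
  have sum: "(\<Sum>j\<in>insert i I. (y(i := t)) j * (\<eta>(i := s)) j) = t * s + (\<Sum>j\<in>I. y j * \<eta> j)" for y \<eta> :: "'i \<Rightarrow> real" and t s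
  proof -
    have "(\<Sum>j\<in>I. (y(i := t)) j * (\<eta>(i := s)) j) = (\<Sum>j\<in>I. y j * \<eta> j)"
      using insert.hyps by (intro sum.cong) auto
    then show ?thesis using insert.hyps by (simp del: fun_upd_apply) simp
  qed
  have nn: "(\<integral>\<^sup>+ y. h y \<partial>lborel_family (insert i I)) = (\<integral>\<^sup>+ (t, y). h (y(i := t)) \<partial>(lborel \<Otimes>\<^sub>M ?P))"
    if [measurable]: "h \<in> borel_measurable (lborel_family (insert i I))" for h
    by (subst ins) (simp add: nn_integral_distr case_prod_unfold)
  have L: "(LINT \<eta>|lborel_family (insert i I). h \<eta>) = (LINT (s, \<eta>)|(lborel \<Otimes>\<^sub>M ?P). h (\<eta>(i := s)))"
    if [measurable]: "h \<in> borel_measurable (lborel_family (insert i I))" for h :: "('i \<Rightarrow> real) \<Rightarrow> complex"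
    by (subst ins) (simp add: integral_distr case_prod_unfold)
  have Gi: "integrable (lborel \<Otimes>\<^sub>M ?P) (\<lambda>(s, \<eta>). G (\<eta>(i := s)))"
    using insert.prems by (subst (asm) ins) (simp add: integrable_distr_eq case_prod_unfold)
  interpret Q: sigma_finite_measure "lborel_family (insert i I)"
    using insert.hyps by (intro sigma_finite_lborel_family) auto
  have [measurable]: "(\<lambda>p. \<Sum>j\<in>insert i I. fst p j * snd p j) \<in> borel_measurable (lborel_family (insert i I) \<Otimes>\<^sub>M lborel_family (insert i I))"
    by (intro borel_measurable_sum borel_measurable_times) auto
  have "(\<integral>\<^sup>+ y. ennreal ((cmod (LINT \<eta>|lborel_family (insert i I). cis (\<Sum>j\<in>insert i I. y j * \<eta> j) * G \<eta>))\<^sup>2) \<partial>lborel_family (insert i I))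
    = (\<integral>\<^sup>+ (t, y). ennreal ((cmod (LINT \<eta>|lborel_family (insert i I). cis (\<Sum>j\<in>insert i I. (y(i := t)) j * \<eta> j) * G \<eta>))\<^sup>2) \<partial>(lborel \<Otimes>\<^sub>M ?P))"
    by (rule nn) measurable
  also have "\<dots> = (\<integral>\<^sup>+ (t, y). ennreal ((cmod (LINT (s, \<eta>)|(lborel \<Otimes>\<^sub>M ?P). cis (t * s) * cis (\<Sum>j\<in>I. y j * \<eta> j) * G (\<eta>(i := s))))\<^sup>2) \<partial>(lborel \<Otimes>\<^sub>M ?P))"
    by (subst L) (measurable, simp only: sum cis_mult)
  also have "\<dots> = ennreal ((2 * pi) ^ Suc (card I))
          * (\<integral>\<^sup>+ (s, \<eta>). ennreal ((cmod (G (\<eta>(i := s))))\<^sup>2) / ennreal \<bar>1\<bar> \<partial>(lborel \<Otimes>\<^sub>M ?P))"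
    by (rule plancherel_step[OF insert.hyps(1) insert.IH Gi])
       (auto intro!: derivative_eq_intros exI[of _ UNIV])
  also have "(\<integral>\<^sup>+ (s, \<eta>). ennreal ((cmod (G (\<eta>(i := s))))\<^sup>2) / ennreal \<bar>1\<bar> \<partial>(lborel \<Otimes>\<^sub>M ?P))
      = (\<integral>\<^sup>+ \<eta>. ennreal ((cmod (G \<eta>))\<^sup>2) \<partial>lborel_family (insert i I))"
    using divide_ennreal[of _ 1] by (subst nn) (auto simp: case_prod_unfold)
  finally show ?case
    using insert.hyps by simp
qed

section \<open>Splitting off the distinguished coordinate\<close>

lemma lborel_rest_eq: "lborel_rest k = lborel_family (UNIV - {k})"
  by (simp add: lborel_rest_def)

lemma measurable_vec_lambda:
  assumes "\<And>i. (\<lambda>x. g x i) \<in> borel_measurable M"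
  shows "(\<lambda>x. (\<chi> i. g x i) :: real ^ 'n) \<in> borel_measurable M"
  by (subst borel_measurable_euclidean_space) (auto simp: Basis_vec_def inner_axis assms)

lemma prod_Basis_vec: "(\<Prod>b\<in>Basis. (x :: real ^ 'n) \<bullet> b) = (\<Prod>i\<in>UNIV. x $ i)"
proof -
  have B: "Basis = (\<lambda>i. axis i 1 :: real ^ 'n) ` UNIV"
    by (auto simp: Basis_vec_def)
  have "inj (\<lambda>i. axis i 1 :: real ^ 'n)"
    by (auto simp: inj_on_def axis_eq_axis)
  then show ?thesis
    unfolding B by (subst prod.reindex) (simp_all add: inner_axis)
qed

lemma lborel_vec: "(lborel :: (real ^ 'n) measure) = distr (lborel_family UNIV) borel (\<lambda>y. \<chi> i. y i)"
proof (rule lborel_eqI)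
  have m [measurable]: "(\<lambda>y. (\<chi> i. y i) :: real ^ 'n) \<in> borel_measurable (lborel_family UNIV)"
    by (rule measurable_vec_lambda) auto
  fix l u :: "real ^ 'n"
  assume "\<And>b. b \<in> Basis \<Longrightarrow> l \<bullet> b \<le> u \<bullet> b"
  then have le: "l $ i \<le> u $ i" for i
    by (metis axis_in_Basis_iff inner_axis inner_real_def mult.right_neutral Basis_real_def insertI1)
  have "emeasure (distr (lborel_family UNIV) borel (\<lambda>y. (\<chi> i. y i) :: real ^ 'n)) (box l u)
     = emeasure (lborel_family UNIV) (\<Pi>\<^sub>E i\<in>UNIV. {l $ i <..< u $ i})"
    by (subst emeasure_distr) (auto simp: mem_box_cart space_PiM PiE_def Pi_def intro!: arg_cong[where f = "emeasure _"])
  also have "\<dots> = (\<Prod>i\<in>UNIV. ennreal (u $ i - l $ i))"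
    by (subst lborel_family.emeasure_PiM) (auto simp: le)
  also have "\<dots> = ennreal (\<Prod>i\<in>UNIV. u $ i - l $ i)"
    using le by (intro prod_ennreal) auto
  also have "(\<Prod>i\<in>UNIV. u $ i - l $ i) = (\<Prod>b\<in>Basis. (u - l) \<bullet> b)"
    by (simp add: prod_Basis_vec)
  finally show "emeasure (distr (lborel_family UNIV) borel (\<lambda>y. (\<chi> i. y i) :: real ^ 'n)) (box l u)
     = ennreal (\<Prod>b\<in>Basis. (u - l) \<bullet> b)"
    by simp
qed simp

lemma measurable_join_coord [measurable]:
  "(\<lambda>(s, y). join_coord k s y) \<in> borel_measurable (lborel \<Otimes>\<^sub>M lborel_rest k)"
  unfolding join_coord_def case_prod_unfold
proof (rule measurable_vec_lambda)
  fix i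
  show "(\<lambda>p. if i = k then fst p else snd p i) \<in> borel_measurable (lborel \<Otimes>\<^sub>M lborel_rest k)"
    by (cases "i = k") (auto simp: lborel_rest_eq)
qed

lemma lborel_join_coord:
  "(lborel :: (real ^ 'n) measure) = distr (lborel \<Otimes>\<^sub>M lborel_rest k) borel (\<lambda>(s, y). join_coord k s y)"
proof -
  have k: "insert k (UNIV - {k}) = UNIV" by auto
  have u [measurable]: "(\<lambda>(s, y). y(k := s)) \<in> lborel \<Otimes>\<^sub>M lborel_rest k \<rightarrow>\<^sub>M lborel_family UNIV"
    unfolding split_beta lborel_rest_eq by (rule measurable_fun_upd[where J = "UNIV - {k}"]) auto
  have m [measurable]: "(\<lambda>y. (\<chi> i. y i) :: real ^ 'n) \<in> borel_measurable (lborel_family UNIV)"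
    by (rule measurable_vec_lambda) auto
  have "(lborel :: (real ^ 'n) measure) = distr (distr (lborel \<Otimes>\<^sub>M lborel_rest k) (lborel_family UNIV) (\<lambda>(s, y). y(k := s))) borel (\<lambda>y. \<chi> i. y i)"
    using lborel_family_insert[of "UNIV - {k}" k] unfolding k lborel_rest_eq by (subst lborel_vec) simp
  also have "\<dots> = distr (lborel \<Otimes>\<^sub>M lborel_rest k) borel ((\<lambda>y. \<chi> i. y i) \<circ> (\<lambda>(s, y). y(k := s)))"
    by (rule distr_distr) measurable
  also have "(\<lambda>y. \<chi> i. y i) \<circ> (\<lambda>(s, y). y(k := s)) = (\<lambda>(s, y). join_coord k s y :: real ^ 'n)"
    by (auto simp: fun_eq_iff join_coord_def vec_eq_iff)
  finally show ?thesis .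
qed

lemma inner_join_coord:
  fixes k :: "'n::finite"
  shows "join_coord k a y \<bullet> join_coord k s \<eta> = a * s + (\<Sum>i\<in>UNIV - {k}. y i * \<eta> i)"
  by (simp add: inner_vec_def join_coord_def sum.remove[of UNIV k])

lemma join_coord_line: "join_coord k s y = join_coord k 0 y + s *\<^sub>R axis k 1"
  by (auto simp: vec_eq_iff join_coord_def axis_def)

lemma
  assumes "C1_fun f"
  shows continuous_partial_deriv: "continuous_on UNIV (partial_deriv k f)"
    and has_partial_deriv: "((\<lambda>s. f (join_coord k s y)) has_real_derivative partial_deriv k f (join_coord k s y)) (at s)"
    and C1_fun_continuous: "continuous_on UNIV f"
proof -
  obtain f' :: "real ^ 'a \<Rightarrow> (real ^ 'a) \<Rightarrow>\<^sub>L real" where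
    f': "\<And>x. (f has_derivative blinfun_apply (f' x)) (at x)" and c: "continuous_on UNIV f'"
    using assms unfolding C1_fun_def by blast
  have line: "((\<lambda>s. f (\<xi> + s *\<^sub>R axis k 1)) has_real_derivative blinfun_apply (f' (\<xi> + s *\<^sub>R axis k 1)) (axis k 1)) (at s)" for \<xi> s
  proof -
    have "((\<lambda>s. \<xi> + s *\<^sub>R axis k 1) has_derivative (\<lambda>h. h *\<^sub>R axis k 1)) (at s)"
      by (auto intro!: derivative_eq_intros)
    from has_derivative_compose[OF this f'] show ?thesis
      by (simp add: has_field_derivative_def blinfun.scaleR_right mult.commute mult_commute_abs)
  qed
  have pd: "partial_deriv k f \<xi> = blinfun_apply (f' \<xi>) (axis k 1)" for \<xi>
    unfolding partial_deriv_def using line[of \<xi> 0] by (intro DERIV_imp_deriv) simp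
  show "continuous_on UNIV (partial_deriv k f)"
    unfolding pd[abs_def] by (intro continuous_intros c)
  show "((\<lambda>s. f (join_coord k s y)) has_real_derivative partial_deriv k f (join_coord k s y)) (at s)"
    using line[of "join_coord k 0 y" s] unfolding pd by (simp flip: join_coord_line)
  show "continuous_on UNIV f"
    using f' by (intro continuous_at_imp_continuous_on ballI has_derivative_continuous) auto
qed

text \<open>
  The complement of the support is a union of arbitrarily many open sets on each of which the function
  vanishes almost everywhere; by Lindeloef's theorem countably many of them suffice.
\<close>

lemma AE_zero_outside_ess_support:
  fixes h :: "'a::euclidean_space \<Rightarrow> complex"
  shows "AE \<xi> in lborel. \<xi> \<notin> ess_support h \<longrightarrow> h \<xi> = 0"
proof -
  let ?\<U> = "{U. open U \<and> (AE \<xi> in lborel. \<xi> \<in> U \<longrightarrow> h \<xi> = 0)}"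
  obtain \<V> where V: "\<V> \<subseteq> ?\<U>" "countable \<V>" "\<Union>\<V> = \<Union>?\<U>"
    using Lindelof[of ?\<U>] by blast
  have "AE \<xi> in lborel. \<forall>U\<in>\<V>. \<xi> \<in> U \<longrightarrow> h \<xi> = 0"
    using V by (subst AE_ball_countable) auto
  then show ?thesis
    unfolding ess_support_def V(3)[symmetric] by eventually_elim auto
qed

lemma closed_ess_support: "closed (ess_support h)"
  unfolding ess_support_def by auto

lemma strictly_monotone_on_imp_inj: "strictly_monotone_on S h \<Longrightarrow> inj_on h S"
  unfolding strictly_monotone_on_def
  by (auto simp: inj_on_def monotone_on_def) (metis linorder_neqE_linordered_idom less_irrefl)+

lemma lebesgue_measurable_borel_version:
  fixes F :: "'a::euclidean_space \<Rightarrow> complex"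
  assumes "F \<in> borel_measurable lebesgue"
  obtains G where "G \<in> borel_measurable borel" "AE x in lborel. F x = G x"
proof -
  have "(\<lambda>x. Re (F x)) \<in> borel_measurable lebesgue" "(\<lambda>x. Im (F x)) \<in> borel_measurable lebesgue"
    using assms by auto
  from this[THEN completion_ex_borel_measurable_real] obtain a b
    where [measurable]: "a \<in> borel_measurable lborel" "b \<in> borel_measurable lborel"
      and ab: "AE x in lborel. Re (F x) = a x" "AE x in lborel. Im (F x) = b x"
    by blast
  show ?thesis
  proof (rule that[of "\<lambda>x. Complex (a x) (b x)"])
    have "(\<lambda>x. Complex (a x) (b x)) = (\<lambda>x. of_real (a x) + \<i> * of_real (b x))"
      by (auto simp: fun_eq_iff complex_eq_iff)
    then show "(\<lambda>x. Complex (a x) (b x)) \<in> borel_measurable borel"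
      by simp
    show "AE x in lborel. F x = Complex (a x) (b x)"
      using ab by eventually_elim (simp add: complex_eq_iff)
  qed
qed

section \<open>Trace norms and weighted norms\<close>

text \<open>
  The quotient is taken in \<open>[0, \<infinity>]\<close> with \<open>0 / 0 = 0\<close> and \<open>c / 0 = \<infinity>\<close> for \<open>c > 0\<close>, so a finite energy
  forces \<open>F\<close> to vanish almost everywhere on the critical set.
\<close>

definition derivative_weighted_energy ::
    "'n::finite \<Rightarrow> (real ^ 'n \<Rightarrow> real) \<Rightarrow> (real ^ 'n \<Rightarrow> complex) \<Rightarrow> ennreal" where
  "derivative_weighted_energy k f F =
     (\<integral>\<^sup>+ \<xi>. ennreal ((cmod (F \<xi>))\<^sup>2) / ennreal \<bar>partial_deriv k f \<xi>\<bar> \<partial>lborel)"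

text \<open>
  Fubini's theorem is applied to products of Borel measures, so the integrand, which is only Lebesgue
  measurable, is replaced by a Borel function equal to it almost everywhere.
\<close>

lemma evolution_borel_version:
  fixes x :: "real ^ 'n::finite"
  assumes F: "integrable lebesgue (\<lambda>\<xi>. X \<xi> * \<sigma> \<xi> * fourier \<phi> \<xi>)"
    and G: "G \<in> borel_measurable borel" "AE \<xi> in lborel. X \<xi> * \<sigma> \<xi> * fourier \<phi> \<xi> = G \<xi>"
    and f: "f \<in> borel_measurable borel"
  shows "evolution X \<sigma> f \<phi> t x = (LINT \<xi>|lborel. cis (x \<bullet> \<xi>) * cis (t * f \<xi>) * G \<xi>) / of_real ((2 * pi) ^ CARD('n))"
proof -
  have [measurable]: "G \<in> borel_measurable borel" "f \<in> borel_measurable borel"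
    by (fact G f)+
  let ?h = "\<lambda>\<xi>. cis (x \<bullet> \<xi>) * cis (t * f \<xi>)"
  have h: "?h \<in> borel_measurable lebesgue" "(\<lambda>\<xi>. ?h \<xi> * G \<xi>) \<in> borel_measurable lebesgue"
    by (intro measurable_completion; measurable)+
  have "(LINT \<xi>|lebesgue. cis (x \<bullet> \<xi>) * (X \<xi> * \<sigma> \<xi> * cis (t * f \<xi>)) * fourier \<phi> \<xi>)
      = (LINT \<xi>|lebesgue. ?h \<xi> * (X \<xi> * \<sigma> \<xi> * fourier \<phi> \<xi>))"
    by (intro Bochner_Integration.integral_cong refl) (simp add: mult_ac)
  also have "\<dots> = (LINT \<xi>|lebesgue. ?h \<xi> * G \<xi>)"
  proof (rule integral_cong_AE)
    show "AE \<xi> in lebesgue. ?h \<xi> * (X \<xi> * \<sigma> \<xi> * fourier \<phi> \<xi>) = ?h \<xi> * G \<xi>"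
      by (rule AE_completion) (use G(2) in eventually_elim, simp)
  qed (use h F in auto)
  also have "\<dots> = (LINT \<xi>|lborel. ?h \<xi> * G \<xi>)"
    by (rule integral_completion) measurable
  finally show ?thesis
    by (simp add: evolution_def fourier_multiplier_def)
qed

lemma ennreal_mult_divide_square: "c > 0 \<Longrightarrow> ennreal c * x / ennreal (c\<^sup>2) = x / ennreal c"
  by (cases x) (auto simp: divide_ennreal power2_eq_square ennreal_mult_top ennreal_top_divide simp flip: ennreal_mult)

text \<open>
  In the coordinates \<open>\<xi> = (s, \<eta>)\<close> the position \<open>x\<^sub>1\<close> enters only through the unimodular factor
  \<open>cis (x\<^sub>1 s)\<close>, which is absorbed into the amplitude and disappears from its modulus. This is why
  the trace norm is the same on all hyperplanes.
\<close>

lemma trace_energy: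
  fixes k :: "'n::finite" and f :: "real ^ 'n \<Rightarrow> real"
  assumes f: "C1_fun f"
    and mono: "AE \<xi>' in lborel_rest k.
           strictly_monotone_on {s. join_coord k s \<xi>' \<in> ess_support X} (\<lambda>s. f (join_coord k s \<xi>'))"
    and F: "integrable lebesgue (\<lambda>\<xi>. X \<xi> * \<sigma> \<xi> * fourier \<phi> \<xi>)"
  shows "(\<integral>\<^sup>+ (t, x'). ennreal ((cmod (evolution X \<sigma> f \<phi> t (join_coord k x\<^sub>1 x')))\<^sup>2) \<partial>(lborel \<Otimes>\<^sub>M lborel_rest k))
     = derivative_weighted_energy k f (\<lambda>\<xi>. X \<xi> * \<sigma> \<xi> * fourier \<phi> \<xi>) / ennreal ((2 * pi) ^ CARD('n))"
proof -
  let ?I = "UNIV - {k}"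
  define c where "c = (2 * pi) ^ CARD('n)"
  have c: "c > 0" by (simp add: c_def)
  let ?F = "\<lambda>\<xi>. X \<xi> * \<sigma> \<xi> * fourier \<phi> \<xi>"
  obtain G where G [measurable]: "G \<in> borel_measurable borel" and FG: "AE \<xi> in lborel. ?F \<xi> = G \<xi>"
    using lebesgue_measurable_borel_version[of ?F] F by auto
  have [measurable]: "f \<in> borel_measurable borel" "partial_deriv k f \<in> borel_measurable borel"
    using C1_fun_continuous[OF f] continuous_partial_deriv[OF f]
    by (auto intro: borel_measurable_continuous_onI)
  have Gi: "integrable lborel G"
  proof -
    have "integrable lebesgue G"
      using F by (rule integrable_cong_AE_imp) (use FG in \<open>auto intro: AE_completion measurable_completion\<close>)
    then show ?thesis by (simp add: integrable_completion)
  qed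
  have [measurable]: "ess_support X \<in> sets borel"
    using closed_ess_support[of X] by (rule borel_closed)
  interpret J: sigma_finite_measure "lborel_rest k"
    unfolding lborel_rest_eq by (rule sigma_finite_lborel_family) simp
  interpret pair_sigma_finite lborel "lborel_rest k"
    by (intro pair_sigma_finite.intro lborel.sigma_finite_measure_axioms J.sigma_finite_measure_axioms)
  note m = measurable_join_coord[of k]
  have m' [measurable]: "(\<lambda>p. h (join_coord k (fst p) (snd p))) \<in> borel_measurable (lborel \<Otimes>\<^sub>M lborel_rest k)"
    if "h \<in> borel_measurable borel" for h :: "real ^ 'n \<Rightarrow> 'b::topological_space"
    using measurable_compose[OF m that] by (simp add: case_prod_unfold)
  have nn: "(\<integral>\<^sup>+ \<xi>. h \<xi> \<partial>lborel) = (\<integral>\<^sup>+ (s, \<eta>). h (join_coord k s \<eta>) \<partial>(lborel \<Otimes>\<^sub>M lborel_rest k))"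
    if "h \<in> borel_measurable borel" for h :: "real ^ 'n \<Rightarrow> ennreal"
    using that by (subst lborel_join_coord[of k], subst nn_integral_distr[OF m]) (simp_all add: case_prod_unfold)
  have L: "(LINT \<xi>|lborel. h \<xi>) = (LINT (s, \<eta>)|(lborel \<Otimes>\<^sub>M lborel_rest k). h (join_coord k s \<eta>))"
    if "h \<in> borel_measurable borel" for h :: "real ^ 'n \<Rightarrow> complex"
    using that by (subst lborel_join_coord[of k], subst integral_distr[OF m]) (simp_all add: case_prod_unfold)
  define F' where "F' s \<eta> = cis (x\<^sub>1 * s) * G (join_coord k s \<eta>)" for s \<eta>
  have F'i: "integrable (lborel \<Otimes>\<^sub>M lborel_rest k) (case_prod F')"
  proof -
    have "integrable (lborel \<Otimes>\<^sub>M lborel_rest k) (\<lambda>(s, \<eta>). G (join_coord k s \<eta>))"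
      using Gi by (subst (asm) lborel_join_coord[of k], subst (asm) integrable_distr_eq[OF m]) (simp_all add: case_prod_unfold)
    then show ?thesis
      by (rule Bochner_Integration.integrable_bound) (auto simp: F'_def norm_mult case_prod_unfold)
  qed
  have support: "AE \<eta> in lborel_rest k. AE s in lborel. join_coord k s \<eta> \<notin> ess_support X \<longrightarrow> G (join_coord k s \<eta>) = 0"
  proof -
    have "AE \<xi> in lborel. \<xi> \<notin> ess_support X \<longrightarrow> G \<xi> = 0"
      using AE_zero_outside_ess_support[of X] FG by eventually_elim auto
    then have "AE \<xi> in distr (lborel \<Otimes>\<^sub>M lborel_rest k) borel (\<lambda>(s, y). join_coord k s y). \<xi> \<notin> ess_support X \<longrightarrow> G \<xi> = 0"
      by (simp only: lborel_join_coord[of k, symmetric])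
    from AE_distrD[OF m this]
    have AEp: "AE p in lborel \<Otimes>\<^sub>M lborel_rest k. join_coord k (fst p) (snd p) \<notin> ess_support X \<longrightarrow> G (join_coord k (fst p) (snd p)) = 0"
      by (simp only: case_prod_unfold)
    have "AE s in lborel. AE \<eta> in lborel_rest k. join_coord k s \<eta> \<notin> ess_support X \<longrightarrow> G (join_coord k s \<eta>) = 0"
      using AE_pair[OF AEp] by (simp only: fst_conv snd_conv)
    moreover have "Measurable.pred (lborel \<Otimes>\<^sub>M lborel_rest k)
        (\<lambda>p. join_coord k (fst p) (snd p) \<notin> ess_support X \<longrightarrow> G (join_coord k (fst p) (snd p)) = 0)"
    proof -
      have "Measurable.pred borel (\<lambda>\<xi>. \<xi> \<notin> ess_support X \<longrightarrow> G \<xi> = 0)"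
        by measurable
      from measurable_compose[OF m this] show ?thesis
        by (simp only: case_prod_unfold)
    qed
    ultimately show ?thesis
      by (subst AE_commute[symmetric]) (simp_all only: pred_def)
  qed
  have evo: "evolution X \<sigma> f \<phi> t (join_coord k x\<^sub>1 x')
      = (LINT (s, \<eta>)|(lborel \<Otimes>\<^sub>M lborel_rest k). cis (t * f (join_coord k s \<eta>)) * cis (\<Sum>i\<in>?I. x' i * \<eta> i) * F' s \<eta>) / of_real c" for t x'
  proof -
    have "evolution X \<sigma> f \<phi> t (join_coord k x\<^sub>1 x')
      = (LINT (s, \<eta>)|(lborel \<Otimes>\<^sub>M lborel_rest k). cis (join_coord k x\<^sub>1 x' \<bullet> join_coord k s \<eta>) * cis (t * f (join_coord k s \<eta>)) * G (join_coord k s \<eta>)) / of_real c"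
      by (subst evolution_borel_version[OF F G FG]) (auto simp: L c_def)
    then show ?thesis
      by (simp add: inner_join_coord F'_def mult_ac flip: cis_mult)
  qed
  have "(\<integral>\<^sup>+ (t, x'). ennreal ((cmod (evolution X \<sigma> f \<phi> t (join_coord k x\<^sub>1 x')))\<^sup>2) \<partial>(lborel \<Otimes>\<^sub>M lborel_rest k))
    = (\<integral>\<^sup>+ (t, x'). ennreal ((cmod (LINT (s, \<eta>)|(lborel \<Otimes>\<^sub>M lborel_rest k).
           cis (t * f (join_coord k s \<eta>)) * cis (\<Sum>i\<in>?I. x' i * \<eta> i) * F' s \<eta>))\<^sup>2) / ennreal (c\<^sup>2) \<partial>(lborel \<Otimes>\<^sub>M lborel_rest k))"
    unfolding evo by (intro nn_integral_cong) (use c in \<open>auto simp: norm_divide power_divide divide_ennreal\<close>)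
  also have "\<dots> = (\<integral>\<^sup>+ (t, x'). ennreal ((cmod (LINT (s, \<eta>)|(lborel \<Otimes>\<^sub>M lborel_rest k).
           cis (t * f (join_coord k s \<eta>)) * cis (\<Sum>i\<in>?I. x' i * \<eta> i) * F' s \<eta>))\<^sup>2) \<partial>(lborel \<Otimes>\<^sub>M lborel_rest k)) / ennreal (c\<^sup>2)"
  proof -
    have [measurable]: "case_prod F' \<in> borel_measurable (lborel \<Otimes>\<^sub>M lborel_rest k)"
      using F'i by auto
    have [measurable]: "(\<lambda>p. \<Sum>i\<in>?I. snd (fst p) i * snd (snd p) i) \<in> borel_measurable ((lborel \<Otimes>\<^sub>M lborel_rest k) \<Otimes>\<^sub>M (lborel \<Otimes>\<^sub>M lborel_rest k))"
      unfolding lborel_rest_eq by (intro borel_measurable_sum borel_measurable_times) auto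
    show ?thesis
      unfolding case_prod_unfold by (rule nn_integral_divide) measurable
  qed
  also have "(\<integral>\<^sup>+ (t, x'). ennreal ((cmod (LINT (s, \<eta>)|(lborel \<Otimes>\<^sub>M lborel_rest k).
           cis (t * f (join_coord k s \<eta>)) * cis (\<Sum>i\<in>?I. x' i * \<eta> i) * F' s \<eta>))\<^sup>2) \<partial>(lborel \<Otimes>\<^sub>M lborel_rest k))
    = ennreal ((2 * pi) ^ Suc (card ?I))
          * (\<integral>\<^sup>+ (s, \<eta>). ennreal ((cmod (F' s \<eta>))\<^sup>2) / ennreal \<bar>partial_deriv k f (join_coord k s \<eta>)\<bar> \<partial>(lborel \<Otimes>\<^sub>M lborel_rest k))"
    unfolding lborel_rest_eq
  proof (rule plancherel_step[OF _ plancherel_family])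
    show "AE \<eta> in lborel_family ?I. \<exists>S. closed S \<and> inj_on (\<lambda>s. f (join_coord k s \<eta>)) S \<and> (AE s in lborel. s \<notin> S \<longrightarrow> F' s \<eta> = 0)"
      using mono support unfolding lborel_rest_eq
    proof eventually_elim
      case (elim \<eta>)
      have "closed ((\<lambda>s. join_coord k s \<eta>) -` ess_support X)"
        by (intro closed_vimage closed_ess_support, subst join_coord_line) (intro continuous_intros)
      then show ?case
        using elim by (intro exI[of _ "(\<lambda>s. join_coord k s \<eta>) -` ess_support X"])
          (auto simp: F'_def vimage_def dest: strictly_monotone_on_imp_inj)
    qed
    show "continuous_on UNIV (\<lambda>s. partial_deriv k f (join_coord k s \<eta>))" for \<eta>
      by (rule continuous_on_compose2[OF continuous_partial_deriv[OF f]])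
         (subst join_coord_line, auto intro!: continuous_intros)
  qed (use F'i has_partial_deriv[OF f] m'[of f] m'[of "partial_deriv k f"] in \<open>auto simp: lborel_rest_eq case_prod_unfold\<close>)
  also have "(\<integral>\<^sup>+ (s, \<eta>). ennreal ((cmod (F' s \<eta>))\<^sup>2) / ennreal \<bar>partial_deriv k f (join_coord k s \<eta>)\<bar> \<partial>(lborel \<Otimes>\<^sub>M lborel_rest k))
    = derivative_weighted_energy k f G"
    unfolding derivative_weighted_energy_def F'_def by (subst nn) (auto simp: norm_mult)
  also have "derivative_weighted_energy k f G = derivative_weighted_energy k f ?F"
    unfolding derivative_weighted_energy_def
    by (intro nn_integral_cong_AE) (use FG in eventually_elim, simp)
  also have "Suc (card ?I) = CARD('n)"
    by (simp add: card_Diff_singleton)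
  finally show ?thesis
    unfolding c_def[symmetric] ennreal_mult_divide_square[OF c] .
qed

lemma ennreal_power2_le_iff: "x\<^sup>2 \<le> y\<^sup>2 \<longleftrightarrow> x \<le> y" for x y :: ennreal
  by (cases x; cases y) (auto simp: ennreal_power top_unique)

lemma L2_norm_square: "(L2_norm M u)\<^sup>2 = (\<integral>\<^sup>+ x. ennreal ((cmod (u x))\<^sup>2) \<partial>M)"
  by (cases "\<integral>\<^sup>+ x. ennreal ((cmod (u x))\<^sup>2) \<partial>M") (auto simp: L2_norm_def Let_def ennreal_power)

lemma trace_norm_square:
  fixes k :: "'n::finite"
  assumes "C1_fun f"
    and "AE \<xi>' in lborel_rest k.
           strictly_monotone_on {s. join_coord k s \<xi>' \<in> ess_support X} (\<lambda>s. f (join_coord k s \<xi>'))"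
    and "integrable lebesgue (\<lambda>\<xi>. X \<xi> * \<sigma> \<xi> * fourier \<phi> \<xi>)"
  shows "(trace_norm k X \<sigma> f \<phi> x\<^sub>1)\<^sup>2
     = derivative_weighted_energy k f (\<lambda>\<xi>. X \<xi> * \<sigma> \<xi> * fourier \<phi> \<xi>) / ennreal ((2 * pi) ^ CARD('n))"
  using trace_energy[OF assms] unfolding trace_norm_def L2_norm_square by (simp only: case_prod_unfold)

lemma AE_pair_snd:
  assumes "sigma_finite_measure N" and P: "AE y in N. P y"
  shows "AE p in M \<Otimes>\<^sub>M N. P (snd p)"
proof -
  interpret sigma_finite_measure N by fact
  obtain Z where Z: "{y \<in> space N. \<not> P y} \<subseteq> Z" "emeasure N Z = 0" "Z \<in> sets N"
    using P by (rule AE_E)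
  have "space M \<times> Z \<in> null_sets (M \<Otimes>\<^sub>M N)"
    using Z by (intro null_setsI) (auto simp: emeasure_pair_measure_Times)
  then show ?thesis
    by (rule AE_I') (use Z(1) in \<open>auto simp: space_pair_measure\<close>)
qed

lemma AE_coordinate:
  fixes k :: "'n::finite"
  assumes P: "AE s in lborel. P s"
  shows "AE x in (lborel :: (real ^ 'n) measure). P (x $ k)"
proof -
  interpret J: sigma_finite_measure "lborel_rest k"
    unfolding lborel_rest_eq by (rule sigma_finite_lborel_family) simp
  obtain Z where Z: "{s \<in> space lborel. \<not> P s} \<subseteq> Z" "emeasure lborel Z = 0" "Z \<in> sets lborel"
    using P by (rule AE_E)
  have [measurable]: "Z \<in> sets borel" using Z by simp
  have "(\<lambda>x :: real ^ 'n. x $ k) \<in> borel_measurable borel"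
    by (intro borel_measurable_continuous_onI continuous_intros)
  then have B: "(\<lambda>x :: real ^ 'n. x $ k) -` Z \<in> sets borel"
    using measurable_sets[of "\<lambda>x :: real ^ 'n. x $ k" borel borel Z] by simp
  have "emeasure (lborel :: (real ^ 'n) measure) ((\<lambda>x. x $ k) -` Z)
      = emeasure (lborel \<Otimes>\<^sub>M lborel_rest k) (Z \<times> space (lborel_rest k))"
    using B by (subst lborel_join_coord[of k], subst emeasure_distr[OF measurable_join_coord])
      (auto simp: join_coord_def space_pair_measure intro!: arg_cong[where f = "emeasure _"])
  also have "\<dots> = 0"
    using Z by (simp add: J.emeasure_pair_measure_Times)
  finally have "(\<lambda>x :: real ^ 'n. x $ k) -` Z \<in> null_sets lborel"
    using B by (intro null_setsI) auto
  then show ?thesis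
    by (rule AE_I') (use Z(1) in auto)
qed

text \<open>
  Integrate over the hyperplanes \<open>x\<^sub>k = s\<close> separately: on each of them the weight is the constant \<open>w s\<close>,
  and the trace norm does not depend on \<open>s\<close>.
\<close>

lemma weighted_norm_square:
  fixes k :: "'n::finite"
  assumes f: "C1_fun f"
    and mono: "AE \<xi>' in lborel_rest k.
           strictly_monotone_on {s. join_coord k s \<xi>' \<in> ess_support X} (\<lambda>s. f (join_coord k s \<xi>'))"
    and F: "integrable lebesgue (\<lambda>\<xi>. X \<xi> * \<sigma> \<xi> * fourier \<phi> \<xi>)"
    and w: "w \<in> borel_measurable lebesgue"
  shows "(weighted_norm k w X \<sigma> f \<phi>)\<^sup>2 = (\<integral>\<^sup>+ s. ennreal ((cmod (w s))\<^sup>2) \<partial>lborel) * (trace_norm k X \<sigma> f \<phi> 0)\<^sup>2"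
proof -
  obtain v where v [measurable]: "v \<in> borel_measurable borel" and wv: "AE s in lborel. w s = v s"
    using lebesgue_measurable_borel_version[OF w] by blast
  obtain G where G [measurable]: "G \<in> borel_measurable borel" and FG: "AE \<xi> in lborel. X \<xi> * \<sigma> \<xi> * fourier \<phi> \<xi> = G \<xi>"
    using lebesgue_measurable_borel_version[of "\<lambda>\<xi>. X \<xi> * \<sigma> \<xi> * fourier \<phi> \<xi>"] F by auto
  have [measurable]: "f \<in> borel_measurable borel"
    using C1_fun_continuous[OF f] by (rule borel_measurable_continuous_onI)
  define U where "U t x = evolution X \<sigma> f \<phi> t x" for t and x :: "real ^ 'n"
  have U [measurable]: "case_prod U \<in> borel_measurable (borel \<Otimes>\<^sub>M borel)"
    unfolding U_def evolution_borel_version[OF F G FG \<open>f \<in> borel_measurable borel\<close>] by measurable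
  interpret J: sigma_finite_measure "lborel_rest k"
    unfolding lborel_rest_eq by (rule sigma_finite_lborel_family) simp
  note m = measurable_join_coord[of k]
  have mj [measurable]: "(\<lambda>x. join_coord k (a x) (b x)) \<in> borel_measurable M"
    if [measurable]: "a \<in> borel_measurable M" "b \<in> M \<rightarrow>\<^sub>M lborel_rest k" for a b and M :: "'b measure"
    using measurable_compose[OF _ m, of "\<lambda>x. (a x, b x)" M] by simp
  have [measurable]: "(\<lambda>x :: real ^ 'n. x $ k) \<in> borel_measurable borel"
    by (intro borel_measurable_continuous_onI continuous_intros)
  have nn: "(\<integral>\<^sup>+ \<xi>. h \<xi> \<partial>lborel) = (\<integral>\<^sup>+ s. \<integral>\<^sup>+ \<eta>. h (join_coord k s \<eta>) \<partial>lborel_rest k \<partial>lborel)"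
    if [measurable]: "h \<in> borel_measurable borel" for h :: "real ^ 'n \<Rightarrow> ennreal"
  proof -
    have "(\<integral>\<^sup>+ \<xi>. h \<xi> \<partial>lborel) = (\<integral>\<^sup>+ p. h (join_coord k (fst p) (snd p)) \<partial>(lborel \<Otimes>\<^sub>M lborel_rest k))"
      by (subst lborel_join_coord[of k], subst nn_integral_distr[OF m]) (simp_all add: case_prod_unfold)
    then show ?thesis
      by (subst J.nn_integral_fst[of "\<lambda>p. h (join_coord k (fst p) (snd p))", simplified]) simp_all
  qed
  have "(weighted_norm k w X \<sigma> f \<phi>)\<^sup>2 = (\<integral>\<^sup>+ p. ennreal ((cmod (w (snd p $ k) * U (fst p) (snd p)))\<^sup>2) \<partial>(lborel \<Otimes>\<^sub>M lborel))"
    unfolding weighted_norm_def L2_norm_square U_def by (simp only: case_prod_unfold)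
  also have "\<dots> = (\<integral>\<^sup>+ p. ennreal ((cmod (v (snd p $ k) * U (fst p) (snd p)))\<^sup>2) \<partial>(lborel \<Otimes>\<^sub>M lborel))"
    by (rule nn_integral_cong_AE)
       (use AE_pair_snd[OF lborel.sigma_finite_measure_axioms AE_coordinate[OF wv, where k = k]] in eventually_elim, simp)
  also have "\<dots> = (\<integral>\<^sup>+ t. \<integral>\<^sup>+ x. ennreal ((cmod (v (x $ k) * U t x))\<^sup>2) \<partial>lborel \<partial>lborel)"
    by (subst lborel.nn_integral_fst[of "\<lambda>p. ennreal ((cmod (v (snd p $ k) * U (fst p) (snd p)))\<^sup>2)", simplified, symmetric]) simp_all
  also have "\<dots> = (\<integral>\<^sup>+ t. \<integral>\<^sup>+ s. \<integral>\<^sup>+ y. ennreal ((cmod (v s * U t (join_coord k s y)))\<^sup>2) \<partial>lborel_rest k \<partial>lborel \<partial>lborel)"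
    by (subst nn) (simp_all add: join_coord_def)
  also have "\<dots> = (\<integral>\<^sup>+ s. \<integral>\<^sup>+ t. \<integral>\<^sup>+ y. ennreal ((cmod (v s * U t (join_coord k s y)))\<^sup>2) \<partial>lborel_rest k \<partial>lborel \<partial>lborel)"
    by (rule lborel_pair.Fubini') measurable
  also have "\<dots> = (\<integral>\<^sup>+ s. ennreal ((cmod (v s))\<^sup>2) * (\<integral>\<^sup>+ t. \<integral>\<^sup>+ y. ennreal ((cmod (U t (join_coord k s y)))\<^sup>2) \<partial>lborel_rest k \<partial>lborel) \<partial>lborel)"
    by (simp add: norm_mult power_mult_distrib ennreal_mult nn_integral_cmult)
  also have "\<dots> = (\<integral>\<^sup>+ s. ennreal ((cmod (v s))\<^sup>2) * (trace_norm k X \<sigma> f \<phi> 0)\<^sup>2 \<partial>lborel)"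
  proof (intro nn_integral_cong arg_cong2[where f = "(*)"] refl)
    fix s
    have "(\<integral>\<^sup>+ t. \<integral>\<^sup>+ y. ennreal ((cmod (U t (join_coord k s y)))\<^sup>2) \<partial>lborel_rest k \<partial>lborel)
        = (\<integral>\<^sup>+ p. ennreal ((cmod (U (fst p) (join_coord k s (snd p))))\<^sup>2) \<partial>(lborel \<Otimes>\<^sub>M lborel_rest k))"
      by (subst J.nn_integral_fst[of "\<lambda>p. ennreal ((cmod (U (fst p) (join_coord k s (snd p))))\<^sup>2)", simplified, symmetric]) simp_all
    also have "\<dots> = (trace_norm k X \<sigma> f \<phi> s)\<^sup>2"
      unfolding trace_norm_def L2_norm_square U_def by (simp only: case_prod_unfold)
    also have "\<dots> = (trace_norm k X \<sigma> f \<phi> 0)\<^sup>2"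
      by (simp only: trace_norm_square[OF f mono F])
    finally show "(\<integral>\<^sup>+ t. \<integral>\<^sup>+ y. ennreal ((cmod (U t (join_coord k s y)))\<^sup>2) \<partial>lborel_rest k \<partial>lborel) = (trace_norm k X \<sigma> f \<phi> 0)\<^sup>2" .
  qed
  also have "\<dots> = (\<integral>\<^sup>+ s. ennreal ((cmod (v s))\<^sup>2) \<partial>lborel) * (trace_norm k X \<sigma> f \<phi> 0)\<^sup>2"
    by (rule nn_integral_multc) measurable
  also have "(\<integral>\<^sup>+ s. ennreal ((cmod (v s))\<^sup>2) \<partial>lborel) = (\<integral>\<^sup>+ s. ennreal ((cmod (w s))\<^sup>2) \<partial>lborel)"
    by (rule nn_integral_cong_AE) (use wv in eventually_elim, simp)
  finally show ?thesis .
qed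

section \<open>From the symbol comparison to the norm estimates\<close>

text \<open>
  The comparisons at critical and at noncritical points are the same inequality between quotients in
  \<open>[0, \<infinity>]\<close>. Multiplied by \<open>|X \<phi>^|\<close> and squared, it compares the two integrands.
\<close>

lemma energy_comparison:
  fixes k :: "'n::finite"
  assumes sym: "symbol_comparison k X \<sigma> f \<tau> g A" and crit: "critical_comparison k X \<sigma> f \<tau> g A"
    and A: "A > 0" and g: "C1_fun g"
    and F: "integrable lebesgue (\<lambda>\<xi>. X \<xi> * \<tau> \<xi> * fourier \<phi> \<xi>)"
  shows "derivative_weighted_energy k f (\<lambda>\<xi>. X \<xi> * \<sigma> \<xi> * fourier \<phi> \<xi>)
    \<le> ennreal (A\<^sup>2) * derivative_weighted_energy k g (\<lambda>\<xi>. X \<xi> * \<tau> \<xi> * fourier \<phi> \<xi>)"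
proof -
  have sq: "(ennreal c * (ennreal a / ennreal (sqrt \<bar>b\<bar>)))\<^sup>2 = ennreal ((c * a)\<^sup>2) / ennreal \<bar>b\<bar>"
    if "0 \<le> a" "0 \<le> c" for a b c :: real
  proof (cases "b = 0")
    case True
    then show ?thesis using that
      by (cases "a = 0 \<or> c = 0") (auto simp: ennreal_zero_divide ennreal_mult_top)
  next
    case False
    then show ?thesis using that
      by (simp add: divide_ennreal ennreal_power power_mult_distrib power_divide flip: ennreal_mult)
  qed
  have "AE \<xi> in lborel. ennreal ((cmod (X \<xi> * \<sigma> \<xi> * fourier \<phi> \<xi>))\<^sup>2) / ennreal \<bar>partial_deriv k f \<xi>\<bar>
     \<le> ennreal (A\<^sup>2) * (ennreal ((cmod (X \<xi> * \<tau> \<xi> * fourier \<phi> \<xi>))\<^sup>2) / ennreal \<bar>partial_deriv k g \<xi>\<bar>)"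
    using AE_zero_outside_ess_support[of X] crit[unfolded critical_comparison_def]
  proof eventually_elim
    case (elim \<xi>)
    let ?a = "partial_deriv k f \<xi>" and ?b = "partial_deriv k g \<xi>" and ?c = "cmod (X \<xi> * fourier \<phi> \<xi>)"
    show ?case
    proof (cases "\<xi> \<in> ess_support X")
      case False
      then show ?thesis using elim by simp
    next
      case True
      have le: "ennreal (cmod (\<sigma> \<xi>)) / ennreal (sqrt \<bar>?a\<bar>) \<le> ennreal A * (ennreal (cmod (\<tau> \<xi>)) / ennreal (sqrt \<bar>?b\<bar>))"
      proof (cases "?a = 0 \<or> ?b = 0")
        case True
        then show ?thesis using elim \<open>\<xi> \<in> ess_support X\<close> by blast
      next
        case False
        then have "cmod (\<sigma> \<xi>) / sqrt \<bar>?a\<bar> \<le> A * (cmod (\<tau> \<xi>) / sqrt \<bar>?b\<bar>)"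
          using sym True unfolding symbol_comparison_def by blast
        then show ?thesis
          using False A by (simp add: divide_ennreal ennreal_leI flip: ennreal_mult)
      qed
      have "(ennreal ?c * (ennreal (cmod (\<sigma> \<xi>)) / ennreal (sqrt \<bar>?a\<bar>)))\<^sup>2
          \<le> (ennreal ?c * (ennreal A * (ennreal (cmod (\<tau> \<xi>)) / ennreal (sqrt \<bar>?b\<bar>))))\<^sup>2"
        by (intro power_mono mult_left_mono le) auto
      also have "\<dots> = (ennreal A)\<^sup>2 * (ennreal ?c * (ennreal (cmod (\<tau> \<xi>)) / ennreal (sqrt \<bar>?b\<bar>)))\<^sup>2"
        by (simp only: power_mult_distrib mult_ac)
      finally have "(ennreal ?c * (ennreal (cmod (\<sigma> \<xi>)) / ennreal (sqrt \<bar>?a\<bar>)))\<^sup>2 \<le> \<dots>" .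
      then show ?thesis
        using A by (simp add: sq norm_mult mult_ac ennreal_power)
    qed
  qed
  then have "derivative_weighted_energy k f (\<lambda>\<xi>. X \<xi> * \<sigma> \<xi> * fourier \<phi> \<xi>)
    \<le> (\<integral>\<^sup>+ \<xi>. ennreal (A\<^sup>2) * (ennreal ((cmod (X \<xi> * \<tau> \<xi> * fourier \<phi> \<xi>))\<^sup>2) / ennreal \<bar>partial_deriv k g \<xi>\<bar>) \<partial>lborel)"
    unfolding derivative_weighted_energy_def by (rule nn_integral_mono_AE)
  also have "\<dots> = ennreal (A\<^sup>2) * derivative_weighted_energy k g (\<lambda>\<xi>. X \<xi> * \<tau> \<xi> * fourier \<phi> \<xi>)"
  proof -
    have [measurable]: "partial_deriv k g \<in> borel_measurable borel"
      using continuous_partial_deriv[OF g] by (rule borel_measurable_continuous_onI)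
    have "(\<lambda>\<xi>. ennreal ((cmod (X \<xi> * \<tau> \<xi> * fourier \<phi> \<xi>))\<^sup>2)) \<in> borel_measurable lebesgue"
      using borel_measurable_integrable[OF F] by measurable
    moreover have "(\<lambda>\<xi>. ennreal \<bar>partial_deriv k g \<xi>\<bar>) \<in> borel_measurable lebesgue"
      by (intro measurable_completion) measurable
    ultimately have "(\<lambda>\<xi>. ennreal ((cmod (X \<xi> * \<tau> \<xi> * fourier \<phi> \<xi>))\<^sup>2) / ennreal \<bar>partial_deriv k g \<xi>\<bar>) \<in> borel_measurable lebesgue"
      by measurable
    from nn_integral_cmult[OF this] show ?thesis
      unfolding derivative_weighted_energy_def nn_integral_completion .
  qed
  finally show ?thesis .
qed

section \<open>Test functions with localised Fourier transform\<close>

text \<open>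
  Let \<open>u\<close> be the Fourier transform of the indicator \<open>h\<close> of \<open>[-a, a]\<close>; then \<open>\<psi> = |u|\<^sup>2\<close> is integrable by
  Plancherel's theorem, with nonzero integral. Multiplying \<open>u\<close> by a character translates \<open>h\<close>, so the
  transform of \<open>\<psi>\<close> at \<open>\<xi>\<close> is a multiple of the inner product of \<open>h\<close> with its translate by \<open>\<xi>\<close>. That vanishes
  once the two intervals are disjoint.
\<close>

lemma fejer_bump:
  fixes a :: real
  assumes a: "a > 0"
  obtains \<psi> :: "real \<Rightarrow> complex" where "integrable lborel \<psi>"
    and "(LINT x|lborel. \<psi> x) \<noteq> 0"
    and "\<And>\<xi>. \<bar>\<xi>\<bar> > 2 * a \<Longrightarrow> (LINT x|lborel. cis (- (x * \<xi>)) * \<psi> x) = 0"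
proof -
  define h :: "real \<Rightarrow> complex" where "h = indicator {-a..a}"
  define u where "u = osc (\<lambda>s. s) h"
  have shift_int: "integrable lborel (\<lambda>y. h (y - \<xi>))" for \<xi>
  proof -
    have "(\<lambda>y. h (y - \<xi>)) = (\<lambda>y. of_real (indicator {\<xi> - a..\<xi> + a} y))"
      by (auto simp: h_def indicator_def fun_eq_iff)
    then show ?thesis
      by (simp only:) (intro integrable_of_real integrable_real_indicator, auto simp: emeasure_lborel_Icc_eq)
  qed
  have hi: "integrable lborel h"
    using shift_int[of 0] by simp
  have [measurable]: "h \<in> borel_measurable borel"
    by (simp add: h_def)
  have plancherel: "(\<integral>\<^sup>+ t. ennreal ((cmod (osc (\<lambda>s. s) F t))\<^sup>2) \<partial>lborel)
      = ennreal (2 * pi) * (\<integral>\<^sup>+ s. ennreal ((cmod (F s))\<^sup>2) \<partial>lborel)" if "integrable lborel F" for F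
  proof -
    have "(\<integral>\<^sup>+ t. ennreal ((cmod (osc (\<lambda>s. s) F t))\<^sup>2) \<partial>lborel)
      = ennreal (2 * pi) * (\<integral>\<^sup>+ s. ennreal ((cmod (F s))\<^sup>2) / ennreal \<bar>1\<bar> \<partial>lborel)"
      by (rule osc_plancherel[OF that closed_UNIV]) (auto intro: derivative_intros)
    then show ?thesis using divide_ennreal[of _ 1] by simp
  qed
  have mass: "(\<integral>\<^sup>+ y. ennreal ((cmod (h (y - \<xi>)))\<^sup>2) \<partial>lborel) = ennreal (2 * a)" for \<xi>
  proof -
    have "(\<integral>\<^sup>+ y. ennreal ((cmod (h (y - \<xi>)))\<^sup>2) \<partial>lborel) = (\<integral>\<^sup>+ y. indicator {\<xi> - a..\<xi> + a} y \<partial>lborel)"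
      by (intro nn_integral_cong) (auto simp: h_def indicator_def)
    then show ?thesis using a by (simp add: emeasure_lborel_Icc_eq)
  qed
  have u2: "(\<integral>\<^sup>+ t. ennreal ((cmod (u t))\<^sup>2) \<partial>lborel) = ennreal (4 * pi * a)"
    using plancherel[OF hi] mass[of 0] a by (simp add: u_def mult_ac flip: ennreal_mult)
  have [measurable]: "u \<in> borel_measurable borel"
    unfolding u_def by measurable
  have ui: "integrable lborel (\<lambda>t. (cmod (u t))\<^sup>2)"
    using u2 by (intro integrableI_nonneg) auto
  have uval: "(LINT t|lborel. (cmod (u t))\<^sup>2) = 4 * pi * a"
    using a by (subst integral_eq_nn_integral) (auto simp: u2)
  show ?thesis
  proof (rule that[of "\<lambda>t. of_real ((cmod (u t))\<^sup>2)"])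
    show "integrable lborel (\<lambda>t. complex_of_real ((cmod (u t))\<^sup>2))"
      using ui by (rule integrable_of_real)
    show "(LINT t|lborel. complex_of_real ((cmod (u t))\<^sup>2)) \<noteq> 0"
      unfolding integral_complex_of_real uval using a by simp
  next
    fix \<xi> assume \<xi>: "\<bar>\<xi>\<bar> > 2 * a"
    have osc_shift: "osc (\<lambda>s. s) (\<lambda>y. h y + c * h (y - \<xi>)) t = u t * (1 + c * cis (t * \<xi>))" for c t
    proof -
      have i1: "integrable lborel (\<lambda>y. cis (t * y) * h y)"
        by (rule Bochner_Integration.integrable_bound[OF hi]) (auto simp: norm_mult)
      have i2: "integrable lborel (\<lambda>y. cis (t * y) * h (y - \<xi>))"
        by (rule Bochner_Integration.integrable_bound[OF shift_int]) (auto simp: norm_mult)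
      have "(LINT y|lborel. cis (t * y) * h (y - \<xi>)) = (LINT y|lborel. cis (t * (\<xi> + 1 * y)) * h (\<xi> + 1 * y - \<xi>))"
        using lborel_integral_real_affine[of 1 "\<lambda>y. cis (t * y) * h (y - \<xi>)" \<xi>] by simp
      also have "\<dots> = (LINT y|lborel. cis (t * \<xi>) * (cis (t * y) * h y))"
        by (simp add: distrib_left mult_ac flip: cis_mult)
      also have "\<dots> = cis (t * \<xi>) * u t"
        by (simp add: u_def osc_def)
      finally have shift: "(LINT y|lborel. cis (t * y) * h (y - \<xi>)) = cis (t * \<xi>) * u t" .
      have "osc (\<lambda>s. s) (\<lambda>y. h y + c * h (y - \<xi>)) t
         = (LINT y|lborel. cis (t * y) * h y + c * (cis (t * y) * h (y - \<xi>)))"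
        unfolding osc_def by (intro Bochner_Integration.integral_cong refl) (simp add: algebra_simps)
      also have "\<dots> = u t + c * (LINT y|lborel. cis (t * y) * h (y - \<xi>))"
        using i1 i2 by (subst Bochner_Integration.integral_add) (auto simp: u_def osc_def)
      finally show ?thesis
        unfolding shift by (simp add: algebra_simps)
    qed
    have one_plus_norm: "(cmod (1 + w))\<^sup>2 = 1 + 2 * Re w + (cmod w)\<^sup>2" for w
      by (simp add: cmod_power2 power2_sum)
    \<comment> \<open>Polarisation: \<open>h\<close> and its translate have disjoint supports, so by Plancherel's theorem the squared
      norm of the transform of \<open>h + c h(\<cdot> - \<xi>)\<close> is the sum of the squared norms, and the cross term is zero.
      The values \<open>c = 1\<close> and \<open>c = \<i>\<close> give its real and imaginary part.\<close>
    have cross: "(LINT t|lborel. (cmod (u t))\<^sup>2 * Re (c * cis (t * \<xi>))) = 0" if c: "cmod c = 1" for c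
    proof -
      have expand: "(cmod (osc (\<lambda>s. s) (\<lambda>y. h y + c * h (y - \<xi>)) t))\<^sup>2
          = 2 * (cmod (u t))\<^sup>2 + 2 * ((cmod (u t))\<^sup>2 * Re (c * cis (t * \<xi>)))" for t
      proof -
        have "cmod (c * cis (t * \<xi>)) = 1"
          using c by (simp add: norm_mult)
        then have e: "(cmod (1 + c * cis (t * \<xi>)))\<^sup>2 = 2 + 2 * Re (c * cis (t * \<xi>))"
          by (simp add: one_plus_norm del: times_complex.sel)
        show ?thesis
          unfolding osc_shift norm_mult[of "u t"] power_mult_distrib e by (simp only: algebra_simps)
      qed
      have int: "integrable lborel (\<lambda>y. h y + c * h (y - \<xi>))"
        using hi shift_int by auto
      have crossi: "integrable lborel (\<lambda>t. (cmod (u t))\<^sup>2 * Re (c * cis (t * \<xi>)))"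
      proof (rule Bochner_Integration.integrable_bound[OF ui])
        have "\<bar>Re (c * cis (t * \<xi>))\<bar> \<le> 1" for t
          using abs_Re_le_cmod[of "c * cis (t * \<xi>)"] c by (simp add: norm_mult)
        then show "AE t in lborel. norm ((cmod (u t))\<^sup>2 * Re (c * cis (t * \<xi>))) \<le> norm ((cmod (u t))\<^sup>2)"
          by (intro AE_I2) (simp add: abs_mult mult_left_le del: times_complex.sel)
      qed measurable
      have "(LINT t|lborel. (cmod (osc (\<lambda>s. s) (\<lambda>y. h y + c * h (y - \<xi>)) t))\<^sup>2)
        = enn2real (ennreal (2 * pi) * (\<integral>\<^sup>+ y. ennreal ((cmod (h y + c * h (y - \<xi>)))\<^sup>2) \<partial>lborel))"
        unfolding plancherel[OF int, symmetric]
        by (rule integral_eq_nn_integral) auto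
      also have "(\<integral>\<^sup>+ y. ennreal ((cmod (h y + c * h (y - \<xi>)))\<^sup>2) \<partial>lborel)
         = (\<integral>\<^sup>+ y. ennreal ((cmod (h (y - 0)))\<^sup>2) + ennreal ((cmod (h (y - \<xi>)))\<^sup>2) \<partial>lborel)"
        using \<xi> c by (intro nn_integral_cong) (auto simp: h_def indicator_def norm_mult)
      also have "\<dots> = ennreal (4 * a)"
        using a by (subst nn_integral_add) (simp_all only: mass, simp_all flip: ennreal_plus)
      finally have "(LINT t|lborel. 2 * (cmod (u t))\<^sup>2 + 2 * ((cmod (u t))\<^sup>2 * Re (c * cis (t * \<xi>)))) = 8 * pi * a"
        unfolding expand using a by (simp flip: ennreal_mult)
      moreover have "(LINT t|lborel. 2 * (cmod (u t))\<^sup>2 + 2 * ((cmod (u t))\<^sup>2 * Re (c * cis (t * \<xi>))))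
         = 8 * pi * a + 2 * (LINT t|lborel. (cmod (u t))\<^sup>2 * Re (c * cis (t * \<xi>)))"
        using ui crossi by (subst Bochner_Integration.integral_add) (simp_all add: uval del: times_complex.sel)
      ultimately show ?thesis by simp
    qed
    have bound: "integrable lborel (\<lambda>t. cis (- (t * \<xi>)) * complex_of_real ((cmod (u t))\<^sup>2))"
      by (rule Bochner_Integration.integrable_bound[OF ui]) (auto simp: norm_mult norm_power)
    show "(LINT t|lborel. cis (- (t * \<xi>)) * complex_of_real ((cmod (u t))\<^sup>2)) = 0"
    proof (rule complex_eqI)
      show "Re (LINT t|lborel. cis (- (t * \<xi>)) * complex_of_real ((cmod (u t))\<^sup>2)) = Re 0"
        using cross[of 1] by (subst integral_Re[OF bound, symmetric]) (simp add: mult.commute)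
      show "Im (LINT t|lborel. cis (- (t * \<xi>)) * complex_of_real ((cmod (u t))\<^sup>2)) = Im 0"
        using cross[of \<i>] by (subst integral_Im[OF bound, symmetric]) (simp add: mult.commute)
    qed
  qed
qed

lemma cis_sum: "finite I \<Longrightarrow> cis (\<Sum>i\<in>I. f i) = (\<Prod>i\<in>I. cis (f i))"
  by (induction I rule: finite_induct) (auto simp flip: cis_mult)

lemma continuous_fourier:
  fixes \<phi> :: "real ^ 'n::finite \<Rightarrow> complex"
  assumes "integrable lebesgue \<phi>"
  shows "continuous_on UNIV (fourier \<phi>)"
proof -
  have "continuous (at \<xi>) (fourier \<phi>)" for \<xi>
  proof (rule continuous_at_sequentiallyI)
    fix u assume u: "u \<longlonglongrightarrow> \<xi>"
    show "(\<lambda>n. fourier \<phi> (u n)) \<longlonglongrightarrow> fourier \<phi> \<xi>"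
      unfolding fourier_def
    proof (rule integral_dominated_convergence[where w = "\<lambda>x. cmod (\<phi> x)"])
      have [measurable]: "(\<lambda>x. cis (- (x \<bullet> \<eta>))) \<in> borel_measurable lebesgue" for \<eta> :: "real ^ 'n"
        by (intro measurable_completion) measurable
      have [measurable]: "\<phi> \<in> borel_measurable lebesgue" using assms by auto
      show "(\<lambda>x. cis (- (x \<bullet> \<xi>)) * \<phi> x) \<in> borel_measurable lebesgue"
        "\<And>n. (\<lambda>x. cis (- (x \<bullet> u n)) * \<phi> x) \<in> borel_measurable lebesgue"
        by measurable
      show "AE x in lebesgue. (\<lambda>n. cis (- (x \<bullet> u n)) * \<phi> x) \<longlonglongrightarrow> cis (- (x \<bullet> \<xi>)) * \<phi> x"
        using u by (intro AE_I2 tendsto_intros isCont_tendsto_compose[of _ cis])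
          (auto intro: continuous_intros tendsto_intros)
    qed (use assms in \<open>auto simp: norm_mult\<close>)
  qed
  then show ?thesis by (simp add: continuous_at_imp_continuous_on)
qed

text \<open>
  A product of the functions of \<open>fejer_bump\<close> in the separate coordinates, modulated so that the Fourier
  transform is centred at \<open>\<xi>\<^sub>0\<close>.
\<close>

lemma fourier_localized_test_function:
  fixes \<xi>\<^sub>0 :: "real ^ 'n::finite" and a :: real
  assumes a: "a > 0"
  obtains \<phi> where "integrable lebesgue \<phi>" and "fourier \<phi> \<xi>\<^sub>0 \<noteq> 0"
    and "\<And>\<xi> i. \<bar>\<xi> $ i - \<xi>\<^sub>0 $ i\<bar> > 2 * a \<Longrightarrow> fourier \<phi> \<xi> = 0"
proof -
  obtain \<psi> :: "real \<Rightarrow> complex" where \<psi>: "integrable lborel \<psi>" "(LINT x|lborel. \<psi> x) \<noteq> 0"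
    "\<And>\<xi>. \<bar>\<xi>\<bar> > 2 * a \<Longrightarrow> (LINT x|lborel. cis (- (x * \<xi>)) * \<psi> x) = 0"
    using fejer_bump[OF a] by blast
  have [measurable]: "\<psi> \<in> borel_measurable borel" using \<psi> by auto
  define \<phi> :: "real ^ 'n \<Rightarrow> complex" where "\<phi> x = cis (x \<bullet> \<xi>\<^sub>0) * (\<Prod>i\<in>UNIV. \<psi> (x $ i))" for x
  have [measurable]: "(\<lambda>x :: real ^ 'n. x $ i) \<in> borel_measurable borel" for i
    by (intro borel_measurable_continuous_onI continuous_intros)
  have [measurable]: "\<phi> \<in> borel_measurable borel"
    unfolding \<phi>_def by measurable
  have m: "(\<lambda>y. (\<chi> i. y i) :: real ^ 'n) \<in> borel_measurable (lborel_family UNIV)"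
    by (rule measurable_vec_lambda) auto
  have shift: "integrable lborel (\<lambda>x. cis (x * c) * \<psi> x)" for c
    by (rule Bochner_Integration.integrable_bound[OF \<psi>(1)]) (auto simp: norm_mult)
  have \<phi>_prod: "cis (- ((\<chi> i. y i) \<bullet> \<xi>)) * \<phi> (\<chi> i. y i) = (\<Prod>i\<in>UNIV. cis (- (y i * (\<xi> $ i - \<xi>\<^sub>0 $ i))) * \<psi> (y i))" for y \<xi>
  proof -
    have "cis (- ((\<chi> i. y i) \<bullet> \<xi>)) * cis ((\<chi> i. y i) \<bullet> \<xi>\<^sub>0) = cis (\<Sum>i\<in>UNIV. - (y i * (\<xi> $ i - \<xi>\<^sub>0 $ i)))"
      by (simp add: cis_mult inner_vec_def sum_negf[symmetric] sum.distrib[symmetric] algebra_simps)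
    then show ?thesis
      by (simp add: \<phi>_def cis_sum prod.distrib mult.assoc[symmetric])
  qed
  have F: "integrable lborel (\<lambda>x. cis (- (x \<bullet> \<xi>)) * \<phi> x)
      \<and> (LINT x|lborel. cis (- (x \<bullet> \<xi>)) * \<phi> x) = (\<Prod>i\<in>UNIV. LINT x|lborel. cis (- (x * (\<xi> $ i - \<xi>\<^sub>0 $ i))) * \<psi> x)" for \<xi>
  proof
    have i: "integrable lborel (\<lambda>x. cis (- (x * (\<xi> $ i - \<xi>\<^sub>0 $ i))) * \<psi> x)" for i
      using shift[of "- (\<xi> $ i - \<xi>\<^sub>0 $ i)"] by (simp only: mult_minus_right)
    have "integrable (lborel_family UNIV) (\<lambda>y. \<Prod>i\<in>(UNIV :: 'n set). cis (- (y i * (\<xi> $ i - \<xi>\<^sub>0 $ i))) * \<psi> (y i))"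
      by (rule lborel_family.product_integrable_prod) (auto intro: i)
    then show "integrable lborel (\<lambda>x. cis (- (x \<bullet> \<xi>)) * \<phi> x)"
      by (subst lborel_vec, subst integrable_distr_eq[OF m]) (simp_all add: \<phi>_prod)
    have "(LINT x|lborel. cis (- (x \<bullet> \<xi>)) * \<phi> x)
       = (LINT y|lborel_family UNIV. (\<Prod>i\<in>(UNIV :: 'n set). cis (- (y i * (\<xi> $ i - \<xi>\<^sub>0 $ i))) * \<psi> (y i)))"
      by (subst lborel_vec, subst integral_distr[OF m]) (simp_all add: \<phi>_prod)
    also have "\<dots> = (\<Prod>i\<in>UNIV. LINT x|lborel. cis (- (x * (\<xi> $ i - \<xi>\<^sub>0 $ i))) * \<psi> x)"
      by (rule lborel_family.product_integral_prod) (auto intro: i)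
    finally show "(LINT x|lborel. cis (- (x \<bullet> \<xi>)) * \<phi> x) = (\<Prod>i\<in>UNIV. LINT x|lborel. cis (- (x * (\<xi> $ i - \<xi>\<^sub>0 $ i))) * \<psi> x)" .
  qed
  have fourier: "fourier \<phi> \<xi> = (\<Prod>i\<in>UNIV. LINT x|lborel. cis (- (x * (\<xi> $ i - \<xi>\<^sub>0 $ i))) * \<psi> x)" for \<xi>
    unfolding fourier_def by (subst integral_completion) (use F in auto)
  show ?thesis
  proof (rule that[of \<phi>])
    show "integrable lebesgue \<phi>"
      using F[of 0] by (subst integrable_completion) auto
    show "fourier \<phi> \<xi>\<^sub>0 \<noteq> 0"
      unfolding fourier using \<psi>(2) by simp
    show "fourier \<phi> \<xi> = 0" if "\<bar>\<xi> $ i - \<xi>\<^sub>0 $ i\<bar> > 2 * a" for \<xi> i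
      unfolding fourier using \<psi>(3)[OF that] by (intro prod_zero) auto
  qed
qed

section \<open>From the norm estimates back to the symbol comparison\<close>

lemma continuous_compact_support_integrable:
  fixes h :: "real ^ 'n \<Rightarrow> 'b::{banach, second_countable_topology}"
  assumes "compact B" "continuous_on B h" "\<And>\<xi>. \<xi> \<notin> B \<Longrightarrow> h \<xi> = 0"
  shows "integrable lborel h"
proof -
  have "h = (\<lambda>\<xi>. indicator B \<xi> *\<^sub>R h \<xi>)"
    using assms(3) by (auto simp: fun_eq_iff indicator_def)
  then show ?thesis
    using borel_integrable_compact[OF assms(1,2)] by simp
qed

lemma divide_less_divide_iff: "0 < b \<Longrightarrow> 0 < d \<Longrightarrow> a / b < c / d \<longleftrightarrow> a * d < c * b" for a b c d :: real
  by (simp add: field_simps)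

lemma energy_real:
  fixes h :: "real ^ 'n::finite \<Rightarrow> complex"
  assumes g: "C1_fun g" and B: "compact B" and h: "continuous_on UNIV h" "\<forall>\<xi>. \<xi> \<notin> B \<longrightarrow> h \<xi> = 0"
    and nz: "\<forall>\<xi>\<in>B. partial_deriv k g \<xi> \<noteq> 0"
  shows "integrable lborel (\<lambda>\<xi>. (cmod (h \<xi>))\<^sup>2 / \<bar>partial_deriv k g \<xi>\<bar>)"
    and "derivative_weighted_energy k g h = (\<integral>\<^sup>+ \<xi>. ennreal ((cmod (h \<xi>))\<^sup>2 / \<bar>partial_deriv k g \<xi>\<bar>) \<partial>lborel)"
    and "derivative_weighted_energy k g h < \<infinity>"
proof -
  show int: "integrable lborel (\<lambda>\<xi>. (cmod (h \<xi>))\<^sup>2 / \<bar>partial_deriv k g \<xi>\<bar>)"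
    by (rule continuous_compact_support_integrable[OF B])
      (use nz h(2) in \<open>auto intro!: continuous_intros continuous_on_subset[OF h(1)] continuous_on_subset[OF continuous_partial_deriv[OF g]]\<close>)
  show eq: "derivative_weighted_energy k g h = (\<integral>\<^sup>+ \<xi>. ennreal ((cmod (h \<xi>))\<^sup>2 / \<bar>partial_deriv k g \<xi>\<bar>) \<partial>lborel)"
    unfolding derivative_weighted_energy_def
  proof (intro nn_integral_cong)
    fix \<xi>
    show "ennreal ((cmod (h \<xi>))\<^sup>2) / ennreal \<bar>partial_deriv k g \<xi>\<bar> = ennreal ((cmod (h \<xi>))\<^sup>2 / \<bar>partial_deriv k g \<xi>\<bar>)"
      using nz h(2) by (cases "\<xi> \<in> B") (auto simp: divide_ennreal)
  qed
  show "derivative_weighted_energy k g h < \<infinity>"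
    unfolding eq by (simp add: nn_integral_eq_integral[OF int])
qed

text \<open>
  If the comparison fails at a point of the support, squaring and clearing denominators turns the failure
  into a strict inequality between continuous functions. It therefore persists nearby, in particular on
  a ball around a point where \<open>X \<noteq> 0\<close>. A test function whose Fourier transform lives in that
  ball has finite energies, and the strict pointwise inequality contradicts the inequality between them.
\<close>

lemma symbol_comparison_if_energies:
  fixes k :: "'n::finite"
  assumes X: "continuous_on UNIV X" and \<sigma>: "continuous_on UNIV \<sigma>" and \<tau>: "continuous_on UNIV \<tau>"
    and f: "C1_fun f" and g: "C1_fun g" and A: "A > 0"
    and le: "\<And>\<phi>. multiplier_defined (\<lambda>\<xi>. X \<xi> * \<sigma> \<xi>) \<phi> \<Longrightarrow> multiplier_defined (\<lambda>\<xi>. X \<xi> * \<tau> \<xi>) \<phi> \<Longrightarrow>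
        derivative_weighted_energy k f (\<lambda>\<xi>. X \<xi> * \<sigma> \<xi> * fourier \<phi> \<xi>) < \<infinity> \<Longrightarrow>
        derivative_weighted_energy k g (\<lambda>\<xi>. X \<xi> * \<tau> \<xi> * fourier \<phi> \<xi>) < \<infinity> \<Longrightarrow>
        derivative_weighted_energy k f (\<lambda>\<xi>. X \<xi> * \<sigma> \<xi> * fourier \<phi> \<xi>)
          \<le> ennreal (A\<^sup>2) * derivative_weighted_energy k g (\<lambda>\<xi>. X \<xi> * \<tau> \<xi> * fourier \<phi> \<xi>)"
  shows "symbol_comparison k X \<sigma> f \<tau> g A"
proof (rule ccontr)
  let ?a = "partial_deriv k f" and ?b = "partial_deriv k g"
  assume "\<not> symbol_comparison k X \<sigma> f \<tau> g A"
  then obtain \<xi>\<^sub>1 where \<xi>\<^sub>1: "\<xi>\<^sub>1 \<in> ess_support X" "?a \<xi>\<^sub>1 \<noteq> 0" "?b \<xi>\<^sub>1 \<noteq> 0"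
    and gt: "A * (cmod (\<tau> \<xi>\<^sub>1) / sqrt \<bar>?b \<xi>\<^sub>1\<bar>) < cmod (\<sigma> \<xi>\<^sub>1) / sqrt \<bar>?a \<xi>\<^sub>1\<bar>"
    unfolding symbol_comparison_def by (auto simp: not_le)
  note ca = continuous_partial_deriv[OF f, of k] and cb = continuous_partial_deriv[OF g, of k]
  define W where "W = {\<xi>. ?a \<xi> \<noteq> 0} \<inter> {\<xi>. ?b \<xi> \<noteq> 0} \<inter>
     {\<xi>. A\<^sup>2 * (cmod (\<tau> \<xi>))\<^sup>2 * \<bar>?a \<xi>\<bar> < (cmod (\<sigma> \<xi>))\<^sup>2 * \<bar>?b \<xi>\<bar>}"
  have W: "open W"
    unfolding W_def
    by (intro open_Int open_Collect_neq open_Collect_less continuous_intros ca cb \<sigma> \<tau>)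
  have "\<xi>\<^sub>1 \<in> W"
  proof -
    have "(A * (cmod (\<tau> \<xi>\<^sub>1) / sqrt \<bar>?b \<xi>\<^sub>1\<bar>))\<^sup>2 < (cmod (\<sigma> \<xi>\<^sub>1) / sqrt \<bar>?a \<xi>\<^sub>1\<bar>)\<^sup>2"
      using gt A by (intro power_strict_mono) auto
    then have "A\<^sup>2 * (cmod (\<tau> \<xi>\<^sub>1))\<^sup>2 / \<bar>?b \<xi>\<^sub>1\<bar> < (cmod (\<sigma> \<xi>\<^sub>1))\<^sup>2 / \<bar>?a \<xi>\<^sub>1\<bar>"
      by (simp add: power_mult_distrib power_divide)
    then show ?thesis
      using \<xi>\<^sub>1 by (simp add: W_def divide_less_divide_iff)
  qed
  then have "W \<inter> closure {\<xi>. X \<xi> \<noteq> 0} \<noteq> {}"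
    using \<xi>\<^sub>1(1) unfolding ess_support_continuous[OF X] by blast
  then obtain \<xi>\<^sub>0 where \<xi>\<^sub>0: "\<xi>\<^sub>0 \<in> W \<inter> {\<xi>. X \<xi> \<noteq> 0}"
    using open_Int_closure_eq_empty[OF W] by blast
  moreover have "open (W \<inter> {\<xi>. X \<xi> \<noteq> 0})"
    by (intro open_Int W open_Collect_neq continuous_intros X)
  ultimately obtain e where e: "e > 0" "cball \<xi>\<^sub>0 e \<subseteq> W \<inter> {\<xi>. X \<xi> \<noteq> 0}"
    using open_contains_cball by blast
  \<comment> \<open>With this choice the cube of half-width \<open>2 a\<close> around \<open>\<xi>\<^sub>0\<close> has \<open>l\<^sup>1\<close> radius \<open>e\<close> and lies in the ball.\<close>
  define a where "a = e / (2 * real CARD('n))"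
  have a: "a > 0" using e by (simp add: a_def)
  obtain \<phi> where \<phi>: "integrable lebesgue \<phi>" "fourier \<phi> \<xi>\<^sub>0 \<noteq> 0"
    "\<And>\<xi> i. \<bar>\<xi> $ i - \<xi>\<^sub>0 $ i\<bar> > 2 * a \<Longrightarrow> fourier \<phi> \<xi> = 0"
    using fourier_localized_test_function[OF a, of \<xi>\<^sub>0] by blast
  define B where "B = cball \<xi>\<^sub>0 e"
  have B: "compact B" "\<And>\<xi>. \<xi> \<in> B \<Longrightarrow> \<xi> \<in> W \<and> X \<xi> \<noteq> 0"
    using e by (auto simp: B_def)
  have \<phi>0: "fourier \<phi> \<xi> = 0" if "\<xi> \<notin> B" for \<xi>
  proof (rule ccontr)
    assume "fourier \<phi> \<xi> \<noteq> 0"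
    then have "\<bar>(\<xi> - \<xi>\<^sub>0) $ i\<bar> \<le> 2 * a" for i
      using \<phi>(3)[of \<xi> i] by force
    then have "(\<Sum>i\<in>UNIV. \<bar>(\<xi> - \<xi>\<^sub>0) $ i\<bar>) \<le> real CARD('n) * (2 * a)"
      by (intro sum_bounded_above)
    then have "norm (\<xi> - \<xi>\<^sub>0) \<le> e"
      using norm_le_l1_cart[of "\<xi> - \<xi>\<^sub>0"] by (simp add: a_def)
    then show False
      using that by (simp add: B_def dist_norm norm_minus_commute)
  qed
  have \<phi>c: "continuous_on UNIV (fourier \<phi>)"
    by (rule continuous_fourier[OF \<phi>(1)])
  let ?F = "\<lambda>\<xi>. X \<xi> * \<sigma> \<xi> * fourier \<phi> \<xi>" and ?G = "\<lambda>\<xi>. X \<xi> * \<tau> \<xi> * fourier \<phi> \<xi>"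
  have c: "continuous_on UNIV ?F" "continuous_on UNIV ?G"
    by (intro continuous_intros X \<sigma> \<tau> \<phi>c)+
  have zero: "\<forall>\<xi>. \<xi> \<notin> B \<longrightarrow> ?F \<xi> = 0" "\<forall>\<xi>. \<xi> \<notin> B \<longrightarrow> ?G \<xi> = 0"
    using \<phi>0 by auto
  have "integrable lborel ?F" "integrable lborel ?G"
    using c zero by (auto intro!: continuous_compact_support_integrable[OF B(1)] intro: continuous_on_subset)
  then have def: "multiplier_defined (\<lambda>\<xi>. X \<xi> * \<sigma> \<xi>) \<phi>" "multiplier_defined (\<lambda>\<xi>. X \<xi> * \<tau> \<xi>) \<phi>"
    using \<phi>(1) by (auto simp: multiplier_defined_def integrable_completion)
  have nz: "\<forall>\<xi>\<in>B. ?a \<xi> \<noteq> 0" "\<forall>\<xi>\<in>B. ?b \<xi> \<noteq> 0"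
    using B(2) by (auto simp: W_def)
  note Ef = energy_real[OF f B(1) c(1) zero(1) nz(1)]
  note Eg = energy_real[OF g B(1) c(2) zero(2) nz(2)]
  let ?p = "\<lambda>\<xi>. (cmod (?F \<xi>))\<^sup>2 / \<bar>?a \<xi>\<bar>" and ?q = "\<lambda>\<xi>. A\<^sup>2 * ((cmod (?G \<xi>))\<^sup>2 / \<bar>?b \<xi>\<bar>)"
  have strict: "?q \<xi> < ?p \<xi>" if "fourier \<phi> \<xi> \<noteq> 0" for \<xi>
  proof -
    have \<xi>: "\<xi> \<in> B" using \<phi>0 that by blast
    then have *: "A\<^sup>2 * (cmod (\<tau> \<xi>))\<^sup>2 * \<bar>?a \<xi>\<bar> < (cmod (\<sigma> \<xi>))\<^sup>2 * \<bar>?b \<xi>\<bar>" and ab: "\<bar>?a \<xi>\<bar> > 0" "\<bar>?b \<xi>\<bar> > 0" and "X \<xi> \<noteq> 0"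
      using B(2)[OF \<xi>] by (auto simp: W_def)
    have "A\<^sup>2 * (cmod (\<tau> \<xi>))\<^sup>2 / \<bar>?b \<xi>\<bar> < (cmod (\<sigma> \<xi>))\<^sup>2 / \<bar>?a \<xi>\<bar>"
      using * ab by (simp add: divide_less_divide_iff)
    moreover have "(cmod (X \<xi> * fourier \<phi> \<xi>))\<^sup>2 > 0"
      using that \<open>X \<xi> \<noteq> 0\<close> by simp
    ultimately have "(cmod (X \<xi> * fourier \<phi> \<xi>))\<^sup>2 * (A\<^sup>2 * (cmod (\<tau> \<xi>))\<^sup>2 / \<bar>?b \<xi>\<bar>)
        < (cmod (X \<xi> * fourier \<phi> \<xi>))\<^sup>2 * ((cmod (\<sigma> \<xi>))\<^sup>2 / \<bar>?a \<xi>\<bar>)"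
      by (rule mult_strict_left_mono)
    then show ?thesis
      by (simp add: norm_mult power_mult_distrib mult_ac)
  qed
  have weak: "?q \<xi> \<le> ?p \<xi>" for \<xi>
    using strict[of \<xi>] by (cases "fourier \<phi> \<xi> = 0") auto
  have meas: "?p \<in> borel_measurable lborel" "(\<lambda>\<xi>. (cmod (?G \<xi>))\<^sup>2 / \<bar>?b \<xi>\<bar>) \<in> borel_measurable lborel"
    using borel_measurable_integrable[OF Ef(1)] borel_measurable_integrable[OF Eg(1)] by simp_all
  have A2: "(\<integral>\<^sup>+ \<xi>. ennreal (?q \<xi>) \<partial>lborel) = ennreal (A\<^sup>2) * derivative_weighted_energy k g ?G"
  proof -
    have "(\<integral>\<^sup>+ \<xi>. ennreal (?q \<xi>) \<partial>lborel) = (\<integral>\<^sup>+ \<xi>. ennreal (A\<^sup>2) * ennreal ((cmod (?G \<xi>))\<^sup>2 / \<bar>?b \<xi>\<bar>) \<partial>lborel)"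
      by (intro nn_integral_cong ennreal_mult) auto
    also have "\<dots> = ennreal (A\<^sup>2) * derivative_weighted_energy k g ?G"
      unfolding Eg(2) by (rule nn_integral_cmult[OF measurable_compose[OF meas(2) measurable_ennreal]])
    finally show ?thesis .
  qed
  have "(\<integral>\<^sup>+ \<xi>. ennreal (?q \<xi>) \<partial>lborel) < (\<integral>\<^sup>+ \<xi>. ennreal (?p \<xi>) \<partial>lborel)"
  proof (rule nn_integral_less)
    show "(\<lambda>\<xi>. ennreal (?q \<xi>)) \<in> borel_measurable lborel" "(\<lambda>\<xi>. ennreal (?p \<xi>)) \<in> borel_measurable lborel"
      using meas by measurable
    show "(\<integral>\<^sup>+ \<xi>. ennreal (?q \<xi>) \<partial>lborel) \<noteq> \<infinity>"
      unfolding A2 using Eg(3) by (simp add: ennreal_mult_eq_top_iff)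
    show "AE \<xi> in lborel. ennreal (?q \<xi>) \<le> ennreal (?p \<xi>)"
      by (intro AE_I2 ennreal_leI weak)
    show "\<not> (AE \<xi> in lborel. ennreal (?p \<xi>) \<le> ennreal (?q \<xi>))"
    proof
      assume "AE \<xi> in lborel. ennreal (?p \<xi>) \<le> ennreal (?q \<xi>)"
      then have ae: "AE \<xi> in lborel. fourier \<phi> \<xi> = 0"
      proof eventually_elim
        case (elim \<xi>)
        have "0 \<le> ?q \<xi>" by simp
        then have "?p \<xi> \<le> ?q \<xi>" using elim by (simp only: ennreal_le_iff)
        then show ?case using strict[of \<xi>] by force
      qed
      have "ess_support (fourier \<phi>) = {}"
        unfolding ess_support_def using ae by (auto intro!: exI[of _ UNIV])
      then show False
        using \<phi>(2) closure_subset[of "{\<xi>. fourier \<phi> \<xi> \<noteq> 0}"] unfolding ess_support_continuous[OF \<phi>c] by blast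
    qed
  qed
  also have "\<dots> = derivative_weighted_energy k f ?F"
    by (rule Ef(2)[symmetric])
  also have "\<dots> \<le> ennreal (A\<^sup>2) * derivative_weighted_energy k g ?G"
    by (rule le[OF def Ef(3) Eg(3)])
  finally show False
    unfolding A2 by simp
qed

theorem corollary2p2:
  fixes k :: "'n::finite"
    and f g :: "real ^ 'n \<Rightarrow> real"
    and X \<sigma> \<tau> :: "real ^ 'n \<Rightarrow> complex"
    and A :: real
  assumes "C1_fun f" and "C1_fun g"
    and "X \<in> borel_measurable lebesgue"
    and "AE \<xi>' in lborel_rest k.
           strictly_monotone_on {s. join_coord k s \<xi>' \<in> ess_support X} (\<lambda>s. f (join_coord k s \<xi>')) \<and>
           strictly_monotone_on {s. join_coord k s \<xi>' \<in> ess_support X} (\<lambda>s. g (join_coord k s \<xi>'))"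
    and "continuous_on UNIV \<sigma>" and "continuous_on UNIV \<tau>"
    and "A > 0"
  shows
    "(symbol_comparison k X \<sigma> f \<tau> g A \<and> critical_comparison k X \<sigma> f \<tau> g A \<longrightarrow>
        (\<forall>\<phi>. multiplier_defined (\<lambda>\<xi>. X \<xi> * \<sigma> \<xi>) \<phi> \<and> multiplier_defined (\<lambda>\<xi>. X \<xi> * \<tau> \<xi>) \<phi> \<longrightarrow>
           (\<forall>x\<^sub>1 y\<^sub>1. trace_norm k X \<sigma> f \<phi> x\<^sub>1 \<le> ennreal A * trace_norm k X \<tau> g \<phi> y\<^sub>1) \<and>
           (\<forall>w \<in> borel_measurable lebesgue.
              weighted_norm k w X \<sigma> f \<phi> \<le> ennreal A * weighted_norm k w X \<tau> g \<phi>)))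
     \<and> (continuous_on UNIV X \<longrightarrow>
        (\<exists>x\<^sub>1 y\<^sub>1. \<forall>\<phi>.
           multiplier_defined (\<lambda>\<xi>. X \<xi> * \<sigma> \<xi>) \<phi> \<and> multiplier_defined (\<lambda>\<xi>. X \<xi> * \<tau> \<xi>) \<phi> \<and>
           trace_norm k X \<sigma> f \<phi> x\<^sub>1 < \<infinity> \<and> trace_norm k X \<tau> g \<phi> y\<^sub>1 < \<infinity> \<longrightarrow>
           trace_norm k X \<sigma> f \<phi> x\<^sub>1 \<le> ennreal A * trace_norm k X \<tau> g \<phi> y\<^sub>1) \<longrightarrow>
        symbol_comparison k X \<sigma> f \<tau> g A)
     \<and> (continuous_on UNIV X \<longrightarrow>
        (\<forall>w \<in> borel_measurable lebesgue. emeasure lebesgue {s. w s \<noteq> 0} > 0 \<longrightarrow>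
           (\<forall>\<phi>. multiplier_defined (\<lambda>\<xi>. X \<xi> * \<sigma> \<xi>) \<phi> \<and> multiplier_defined (\<lambda>\<xi>. X \<xi> * \<tau> \<xi>) \<phi> \<and>
              (\<forall>x\<^sub>1. trace_norm k X \<sigma> f \<phi> x\<^sub>1 < \<infinity> \<and> trace_norm k X \<tau> g \<phi> x\<^sub>1 < \<infinity>) \<longrightarrow>
              weighted_norm k w X \<sigma> f \<phi> < \<infinity> \<and> weighted_norm k w X \<tau> g \<phi> < \<infinity> \<and>
              weighted_norm k w X \<sigma> f \<phi> \<le> ennreal A * weighted_norm k w X \<tau> g \<phi>) \<longrightarrow>
           symbol_comparison k X \<sigma> f \<tau> g A))"
proof -
  note f = assms(1) and g = assms(2) and \<sigma> = assms(5) and \<tau> = assms(6) and A = assms(7)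
  have mono_f: "AE \<xi>' in lborel_rest k.
      strictly_monotone_on {s. join_coord k s \<xi>' \<in> ess_support X} (\<lambda>s. f (join_coord k s \<xi>'))"
    and mono_g: "AE \<xi>' in lborel_rest k.
      strictly_monotone_on {s. join_coord k s \<xi>' \<in> ess_support X} (\<lambda>s. g (join_coord k s \<xi>'))"
    using assms(4) by auto
  define c where "c = (2 * pi) ^ CARD('n)"
  have c: "c > 0" by (simp add: c_def)
  let ?E = "\<lambda>\<phi>. derivative_weighted_energy k f (\<lambda>\<xi>. X \<xi> * \<sigma> \<xi> * fourier \<phi> \<xi>)"
    and ?D = "\<lambda>\<phi>. derivative_weighted_energy k g (\<lambda>\<xi>. X \<xi> * \<tau> \<xi> * fourier \<phi> \<xi>)"
  have T\<sigma>: "(trace_norm k X \<sigma> f \<phi> x)\<^sup>2 = ?E \<phi> / ennreal c"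
    and W\<sigma>: "w \<in> borel_measurable lebesgue \<Longrightarrow>
      (weighted_norm k w X \<sigma> f \<phi>)\<^sup>2 = (\<integral>\<^sup>+ s. ennreal ((cmod (w s))\<^sup>2) \<partial>lborel) * (?E \<phi> / ennreal c)"
    if "multiplier_defined (\<lambda>\<xi>. X \<xi> * \<sigma> \<xi>) \<phi>" for \<phi> x w
  proof -
    have F: "integrable lebesgue (\<lambda>\<xi>. X \<xi> * \<sigma> \<xi> * fourier \<phi> \<xi>)"
      using that by (simp add: multiplier_defined_def)
    show T: "(trace_norm k X \<sigma> f \<phi> x)\<^sup>2 = ?E \<phi> / ennreal c" for x
      unfolding c_def by (rule trace_norm_square[OF f mono_f F])
    show "w \<in> borel_measurable lebesgue \<Longrightarrow>
      (weighted_norm k w X \<sigma> f \<phi>)\<^sup>2 = (\<integral>\<^sup>+ s. ennreal ((cmod (w s))\<^sup>2) \<partial>lborel) * (?E \<phi> / ennreal c)"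
      by (simp only: weighted_norm_square[OF f mono_f F] T)
  qed
  have T\<tau>: "(trace_norm k X \<tau> g \<phi> x)\<^sup>2 = ?D \<phi> / ennreal c"
    and W\<tau>: "w \<in> borel_measurable lebesgue \<Longrightarrow>
      (weighted_norm k w X \<tau> g \<phi>)\<^sup>2 = (\<integral>\<^sup>+ s. ennreal ((cmod (w s))\<^sup>2) \<partial>lborel) * (?D \<phi> / ennreal c)"
    if "multiplier_defined (\<lambda>\<xi>. X \<xi> * \<tau> \<xi>) \<phi>" for \<phi> x w
  proof -
    have F: "integrable lebesgue (\<lambda>\<xi>. X \<xi> * \<tau> \<xi> * fourier \<phi> \<xi>)"
      using that by (simp add: multiplier_defined_def)
    show T: "(trace_norm k X \<tau> g \<phi> x)\<^sup>2 = ?D \<phi> / ennreal c" for x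
      unfolding c_def by (rule trace_norm_square[OF g mono_g F])
    show "w \<in> borel_measurable lebesgue \<Longrightarrow>
      (weighted_norm k w X \<tau> g \<phi>)\<^sup>2 = (\<integral>\<^sup>+ s. ennreal ((cmod (w s))\<^sup>2) \<partial>lborel) * (?D \<phi> / ennreal c)"
      by (simp only: weighted_norm_square[OF g mono_g F] T)
  qed
  have sq_le: "x \<le> ennreal A * y \<longleftrightarrow> x\<^sup>2 \<le> ennreal (A\<^sup>2) * y\<^sup>2" for x y
    using A by (subst ennreal_power2_le_iff[symmetric]) (simp add: power_mult_distrib ennreal_power)
  have div_le: "d / ennreal c \<le> ennreal (A\<^sup>2) * (e / ennreal c) \<longleftrightarrow> d \<le> ennreal (A\<^sup>2) * e" for d e
  proof
    assume "d / ennreal c \<le> ennreal (A\<^sup>2) * (e / ennreal c)"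
    then have "ennreal c * (d / ennreal c) \<le> ennreal c * (ennreal (A\<^sup>2) * (e / ennreal c))"
      by (rule mult_left_mono) simp
    then show "d \<le> ennreal (A\<^sup>2) * e"
      using c by (simp add: ennreal_times_divide mult.left_commute[of "ennreal c"] ennreal_mult_divide_eq mult.commute[of "ennreal c"])
  next
    assume "d \<le> ennreal (A\<^sup>2) * e"
    then show "d / ennreal c \<le> ennreal (A\<^sup>2) * (e / ennreal c)"
      by (simp add: ennreal_times_divide divide_right_mono_ennreal)
  qed
  have fin: "x < \<infinity>" if "x\<^sup>2 = d / ennreal c" "d < \<infinity>" for x d
  proof -
    have "d / ennreal c \<noteq> \<infinity>"
      using that(2) c by (auto simp: ennreal_divide_eq_top_iff)
    then have "x\<^sup>2 < \<infinity>"
      unfolding that(1)[symmetric] by (simp add: less_top)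
    then show ?thesis
      by (simp add: power_less_top_ennreal)
  qed
  show ?thesis
  proof (intro conjI impI allI ballI)
    fix \<phi> x y
    assume *: "symbol_comparison k X \<sigma> f \<tau> g A \<and> critical_comparison k X \<sigma> f \<tau> g A"
      and d: "multiplier_defined (\<lambda>\<xi>. X \<xi> * \<sigma> \<xi>) \<phi> \<and> multiplier_defined (\<lambda>\<xi>. X \<xi> * \<tau> \<xi>) \<phi>"
    have "?E \<phi> \<le> ennreal (A\<^sup>2) * ?D \<phi>"
      using energy_comparison[of k X \<sigma> f \<tau> g A \<phi>] * d f g A unfolding multiplier_defined_def by blast
    then show "trace_norm k X \<sigma> f \<phi> x \<le> ennreal A * trace_norm k X \<tau> g \<phi> y"
      unfolding sq_le using d by (simp only: T\<sigma> T\<tau> div_le)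
  next
    fix \<phi> and w :: "real \<Rightarrow> complex"
    assume *: "symbol_comparison k X \<sigma> f \<tau> g A \<and> critical_comparison k X \<sigma> f \<tau> g A"
      and d: "multiplier_defined (\<lambda>\<xi>. X \<xi> * \<sigma> \<xi>) \<phi> \<and> multiplier_defined (\<lambda>\<xi>. X \<xi> * \<tau> \<xi>) \<phi>"
      and w: "w \<in> borel_measurable lebesgue"
    have "?E \<phi> \<le> ennreal (A\<^sup>2) * ?D \<phi>"
      using energy_comparison[of k X \<sigma> f \<tau> g A \<phi>] * d f g A unfolding multiplier_defined_def by blast
    then have "?E \<phi> / ennreal c \<le> ennreal (A\<^sup>2) * (?D \<phi> / ennreal c)"
      by (simp only: div_le)
    then show "weighted_norm k w X \<sigma> f \<phi> \<le> ennreal A * weighted_norm k w X \<tau> g \<phi>"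
      unfolding sq_le using d w by (simp only: W\<sigma> W\<tau> mult.left_commute[of "ennreal (A\<^sup>2)"]) (intro mult_left_mono, auto)
  next
    assume X: "continuous_on UNIV X" and "\<exists>x\<^sub>1 y\<^sub>1. \<forall>\<phi>.
           multiplier_defined (\<lambda>\<xi>. X \<xi> * \<sigma> \<xi>) \<phi> \<and> multiplier_defined (\<lambda>\<xi>. X \<xi> * \<tau> \<xi>) \<phi> \<and>
           trace_norm k X \<sigma> f \<phi> x\<^sub>1 < \<infinity> \<and> trace_norm k X \<tau> g \<phi> y\<^sub>1 < \<infinity> \<longrightarrow>
           trace_norm k X \<sigma> f \<phi> x\<^sub>1 \<le> ennreal A * trace_norm k X \<tau> g \<phi> y\<^sub>1"
    then obtain x y where H: "\<And>\<phi>. multiplier_defined (\<lambda>\<xi>. X \<xi> * \<sigma> \<xi>) \<phi> \<Longrightarrow> multiplier_defined (\<lambda>\<xi>. X \<xi> * \<tau> \<xi>) \<phi> \<Longrightarrow>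
           trace_norm k X \<sigma> f \<phi> x < \<infinity> \<Longrightarrow> trace_norm k X \<tau> g \<phi> y < \<infinity> \<Longrightarrow>
           trace_norm k X \<sigma> f \<phi> x \<le> ennreal A * trace_norm k X \<tau> g \<phi> y"
      by blast
    show "symbol_comparison k X \<sigma> f \<tau> g A"
    proof (rule symbol_comparison_if_energies[OF X \<sigma> \<tau> f g A])
      fix \<phi> assume d: "multiplier_defined (\<lambda>\<xi>. X \<xi> * \<sigma> \<xi>) \<phi>" "multiplier_defined (\<lambda>\<xi>. X \<xi> * \<tau> \<xi>) \<phi>"
        and "?E \<phi> < \<infinity>" "?D \<phi> < \<infinity>"
      then have "trace_norm k X \<sigma> f \<phi> x \<le> ennreal A * trace_norm k X \<tau> g \<phi> y"
        by (intro H d fin[OF T\<sigma>] fin[OF T\<tau>])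
      then show "?E \<phi> \<le> ennreal (A\<^sup>2) * ?D \<phi>"
        unfolding sq_le T\<sigma>[OF d(1)] T\<tau>[OF d(2)] div_le .
    qed
  next
    fix w :: "real \<Rightarrow> complex"
    assume X: "continuous_on UNIV X" and w: "w \<in> borel_measurable lebesgue"
      and pos: "emeasure lebesgue {s. w s \<noteq> 0} > 0"
      and H: "\<forall>\<phi>. multiplier_defined (\<lambda>\<xi>. X \<xi> * \<sigma> \<xi>) \<phi> \<and> multiplier_defined (\<lambda>\<xi>. X \<xi> * \<tau> \<xi>) \<phi> \<and>
              (\<forall>x\<^sub>1. trace_norm k X \<sigma> f \<phi> x\<^sub>1 < \<infinity> \<and> trace_norm k X \<tau> g \<phi> x\<^sub>1 < \<infinity>) \<longrightarrow>
              weighted_norm k w X \<sigma> f \<phi> < \<infinity> \<and> weighted_norm k w X \<tau> g \<phi> < \<infinity> \<and>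
              weighted_norm k w X \<sigma> f \<phi> \<le> ennreal A * weighted_norm k w X \<tau> g \<phi>"
    define I where "I = (\<integral>\<^sup>+ s. ennreal ((cmod (w s))\<^sup>2) \<partial>lborel)"
    have I0: "I \<noteq> 0"
    proof
      assume "I = 0"
      have "{s \<in> space lebesgue. w s \<noteq> 0} \<in> sets lebesgue"
        using w by measurable
      then have meas: "{s. w s \<noteq> 0} \<in> sets lebesgue"
        by simp
      have "AE s in lebesgue. w s = 0"
        using w \<open>I = 0\<close> unfolding I_def nn_integral_completion[of lborel, symmetric] by (subst (asm) nn_integral_0_iff_AE) auto
      then show False
        using pos meas by (subst (asm) AE_iff_measurable[OF _ refl]) auto
    qed
    show "symbol_comparison k X \<sigma> f \<tau> g A"
    proof (rule symbol_comparison_if_energies[OF X \<sigma> \<tau> f g A])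
      fix \<phi> assume d: "multiplier_defined (\<lambda>\<xi>. X \<xi> * \<sigma> \<xi>) \<phi>" "multiplier_defined (\<lambda>\<xi>. X \<xi> * \<tau> \<xi>) \<phi>"
        and "?E \<phi> < \<infinity>" "?D \<phi> < \<infinity>"
      then have "trace_norm k X \<sigma> f \<phi> x < \<infinity>" "trace_norm k X \<tau> g \<phi> x < \<infinity>" for x
        using fin[OF T\<sigma>[OF d(1)]] fin[OF T\<tau>[OF d(2)]] by auto
      then have "weighted_norm k w X \<sigma> f \<phi> < \<infinity>" and le: "weighted_norm k w X \<sigma> f \<phi> \<le> ennreal A * weighted_norm k w X \<tau> g \<phi>"
        using H d by blast+
      then have fin_w: "I * (?E \<phi> / ennreal c) < \<infinity>"
        unfolding I_def W\<sigma>[OF d(1) w, symmetric] by (simp add: power_less_top_ennreal)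
      have le2: "I * (?E \<phi> / ennreal c) \<le> I * (ennreal (A\<^sup>2) * (?D \<phi> / ennreal c))"
        using le unfolding sq_le W\<sigma>[OF d(1) w] W\<tau>[OF d(2) w] I_def by (simp only: mult.left_commute)
      have "?E \<phi> / ennreal c \<le> ennreal (A\<^sup>2) * (?D \<phi> / ennreal c)"
      \<comment> \<open>A weight that is not square integrable has finite weighted norm only if the trace vanishes;
        otherwise the factor \<open>I\<close> cancels.\<close>
      proof (cases "I = \<infinity>")
        case True
        then have "?E \<phi> / ennreal c = 0"
          using fin_w by (auto simp: ennreal_top_mult split: if_splits)
        then show ?thesis by simp
      next
        case False
        then show ?thesis
          using le2 I0 by (subst (asm) ennreal_mult_le_mult_iff) auto
      qed
      then show "?E \<phi> \<le> ennreal (A\<^sup>2) * ?D \<phi>"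
        unfolding div_le .
    qed
  qed
qed

end
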